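(* Let $\mathcal K$ be a 2-category. The data $\mathrm{Bimnd}^T(\mathcal K)$ consisting of the 0-cells $(\mathcal A,F,(\lambda_\alpha)_{\alpha\in G(F)})$, the system of groups $G_{F,F'}$ with transitive product $*$ and projections $\pi$, the hom-categories $\mathrm{Bimnd}^T(F,F')=\bigcup^{\bullet}_{(\alpha,\beta)\in G'\times G}\mathrm{Bimnd}^T(F_\beta,F'_\alpha)$, the identity 1-cells $(\mathrm{Id}_{\mathcal A},\mathrm{id}_F,\mathrm{id}_F)$ and identity 2-cells $\mathrm{id}_X$, the composition $(X,\psi_X,\phi_X)\cdot(Y,\psi_Y,\phi_Y)=(XY,\psi_{XY},\phi_{XY})$ and the assignments $\varphi^{F,F'}:(\alpha,\beta)\mapsto\varphi^{F,F'}_{(\alpha,\beta)}$, all as specified in the context, is a Turaev 2-category. Moreover it is a Turaev extension of the 2-category $\mathrm{Bimnd}(\mathcal K)$ of bimonads in $\mathcal K$.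
   Context: **Conventions.** In the 2-category $\mathcal K$ composition of 1-cells and whiskering are written by juxtaposition ($XF$ means first $F$, then $X$), $\times$ is horizontal and $\circ$ vertical composition of 2-cells. **1-cells over (co)monads.** For monads $(\mathcal A,F,\mu,\eta)$, $(\mathcal A',F',\mu',\eta')$ a 1-cell $(X,\psi):(\mathcal A,F)\to(\mathcal A',F')$ in $\mathrm{Mnd}(\mathcal K)$ is a 1-cell $X:\mathcal A\to\mathcal A'$ with a 2-cell $\psi:F'X\to XF$ such that $(X\mu)\circ(\psi F)\circ(F'\psi)=\psi\circ(\mu'X)$ and $\psi\circ(\eta'X)=X\eta$; a 2-cell $(X,\psi_X)\to(Y,\psi_Y)$ is a 2-cell $\zeta:X\to Y$ with $(\zeta F)\circ\psi_X=\psi_Y\circ(F'\zeta)$. For comonads a 1-cell $(X,\phi)$ in $\mathrm{Comnd}(\mathcal K)$ has $\phi:XF\to F'X$ with $(F'\phi)\circ(\phi F)\circ(X\Delta)=(\Delta'X)\circ\phi$ and $(\varepsilon'X)\circ\phi=X\varepsilon$; a 2-cell is $\zeta:X\to Y$ with $(F'\zeta)\circ\phi_X=\phi_Y\circ(\zeta F)$. **Bimonads.** A bimonad $(\mathcal A,F,\lambda)$ in $\mathcal K$ is a 1-cell $F:\mathcal A\to\mathcal A$ with a monad structure $(\mu,\eta)$, a comonad structure $(\Delta,\varepsilon)$ and a 2-cell $\lambda:FF\to FF$ such that $(F,\lambda)$ is a 1-cell $(\mathcal A,F)\to(\mathcal A,F)$ in both $\mathrm{Mnd}(\mathcal K)$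 and $\mathrm{Comnd}(\mathcal K)$, and $\Delta\circ\mu=(F\mu)\circ(\lambda F)\circ(F\Delta)$, $\varepsilon\circ\mu=\varepsilon\times\varepsilon$, $\Delta\circ\eta=\eta\times\eta$, $\varepsilon\circ\eta=\mathrm{id}$. The 2-category $\mathrm{Bimnd}(\mathcal K)$ has bimonads as 0-cells; 1-cells $(\mathcal A,F,\lambda)\to(\mathcal A',F',\lambda')$ are triples $(X,\psi,\phi)$ with $(X,\psi)$ a 1-cell in $\mathrm{Mnd}(\mathcal K)$, $(X,\phi)$ a 1-cell in $\mathrm{Comnd}(\mathcal K)$ and $(\phi F)\circ(X\lambda)\circ(\psi F)=(F'\psi)\circ(\lambda'X)\circ(F'\phi)$; 2-cells are those 2-cells of $\mathcal K$ which are 2-cells in both $\mathrm{Mnd}(\mathcal K)$ and $\mathrm{Comnd}(\mathcal K)$; composition of 1-cells is $\psi_{XY}=(X\psi_Y)\circ(\psi_XY)$, $\phi_{XY}=(\phi_XY)\circ(X\phi_Y)$. **0-automorphism groups.** For a bimonad $(\mathcal A,F,\lambda)$, $G(F)=\mathrm{Aut}_0(F)$ is the group (under $\alpha\beta=\alpha\circ\beta$) of invertible 2-cells $\alpha:F\to F$ with $\alpha\circ\mu=\mu\circ(\alpha\times\alpha)$, $\alpha\circ\eta=\eta$, $\Delta\circ\alpha=(\alpha\times\alpha)\circ\Delta$, $\varepsilon\circ\alpha=\varepsilon$ and $(\alpha^{-1}F)\circ\lambda\circ(\alpha F)=(F\alpha)\circ\lambda\circ(F\alpha^{-1})$. Write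 $G=G(F)$, $G'=G(F')$, $G''=G(F'')$. **Fusion maps.** Among bimonads with mutually isomorphic 0-automorphism groups, group isomorphisms $j_{F,F'}:G(F)\to G(F')$ are fixed with $j_{F,F}=\mathrm{id}$, $j_{F',F}=j_{F,F'}^{-1}$, $j_{F,F''}=j_{F',F''}\circ j_{F,F'}$. Write $j=j_{F,F'}$, $j'=j_{F',F''}$. **Groups.** If $G\cong G'$, then $G_{F,F'}$ is the set $G'\times G$ with product $(\alpha,\beta)*(\gamma,\delta)=(\alpha\gamma,\ \delta\, j^{-1}(\gamma^{-1})\,\beta\, j^{-1}(\gamma))$; if $G\not\cong G'$, then $G_{F,F'}=\{e\}$. For $F,F',F''$ with isomorphic groups the transitive product $G_{F',F''}\times G_{F,F'}\to G_{F,F''}$ is $(\alpha,\beta)*(\gamma,\delta)=(\alpha j'(\gamma),\ \delta\, j^{-1}(\gamma^{-1}\beta\gamma))$ and $\pi:G_{F,F''}\to G_{F',F''}\times G_{F,F'}$ is $\pi(\alpha,\beta)=\big((\alpha,j(\beta)),(j'^{-1}(\alpha),\beta)\big)$. **0-cells of $\mathrm{Bimnd}^T(\mathcal K)$.** $(\mathcal A,F,(\lambda_\alpha)_{\alpha\in G})$ $=\bigcup^\bullet_{\alpha\in G}(\mathcal A,F,\lambda_\alpha)$, where $(\mathcal A,F,\lambda_e)$ is a bimonad ($\lambda=\lambda_e$), $G=\mathrm{Aut}_0(F)$, each $(F,\lambda_\alpha)$ is a 1-cell in both $\mathrm{Mnd}(\mathcal K)$ and $\mathrm{Comnd}(\mathcal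 K)$, and $\lambda_{\alpha\beta}=(\alpha\times\beta^{-1})\circ\lambda\circ(\beta\times\alpha^{-1})$ for all $\alpha,\beta\in G$. Write $F_\alpha=(\mathcal A,F,\lambda_\alpha)$. **Hom-categories.** If $G\not\cong G'$, $\mathrm{Bimnd}^T(F,F')=\emptyset$. If $G\cong G'$, its $(\alpha,\beta)$-component ($(\alpha,\beta)\in G'\times G$) is the category $\mathrm{Bimnd}^T(F_\beta,F'_\alpha)$, also written $\mathrm{Bimnd}^T_{(\alpha,\beta)}(F,F')$, with objects triples $(X,\psi_X,\phi_X)$ where $(X,\psi_X)$ is a 1-cell $(\mathcal A,F)\to(\mathcal A',F')$ in $\mathrm{Mnd}(\mathcal K)$, $(X,\phi_X)$ is one in $\mathrm{Comnd}(\mathcal K)$, and $(\phi_XF)\circ(X\lambda_\beta)\circ(\psi_XF)=(F'\psi_X)\circ(\lambda'_\alpha X)\circ(F'\phi_X)$; morphisms are 2-cells of $\mathcal K$ that are 2-cells both in $\mathrm{Mnd}(\mathcal K)$ and $\mathrm{Comnd}(\mathcal K)$. The identity 1-cell lies in $\mathrm{Bimnd}^T(F_e,F_e)$. **Composition.** For $X\in\mathrm{Bimnd}^T(F'_\beta,F''_\alpha)$, $Y\in\mathrm{Bimnd}^T(F_\delta,F'_\gamma)$, put $\psi_X^{\gamma}=(X\gamma^{-1})\circ\psi_X\circ(j'(\gamma)X)$ and, for $\omega\in G'$, $\psi_Y^{\omega}=(Yj^{-1}(\omega^{-1}))\circ\psi_Y\circ(\omega Y)$. Then $\psi_{XY}=(X\psi_Y^{\gamma^{-1}\beta\gamma})\circ(\psi_X^{\gamma}Y)$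 and $\phi_{XY}=(\phi_XY)\circ(X\phi_Y)$. **The functors $\varphi$.** For $(\alpha,\beta),(\gamma,\delta)\in G'\times G$, $\varphi^{F,F'}_{(\alpha,\beta)}$ sends $(Y,\psi_Y,\phi_Y)\in\mathrm{Bimnd}^T_{(\gamma,\delta)}(F,F')$ to $(Y,\psi_Y^{\omega},\phi_Y^{\sigma})$, $\omega=\gamma^{-1}j(\beta)\gamma\alpha^{-1}\in G'$, $\sigma=\beta j^{-1}(\alpha^{-1})\in G$, where $\psi_Y^\omega=(Yj^{-1}(\omega^{-1}))\circ\psi_Y\circ(\omega Y)$ and $\phi_Y^\sigma=(j(\sigma^{-1})Y)\circ\phi_Y\circ(Y\sigma)$; it is the identity on underlying 2-cells. **Transitive system of groups with projections over a class $\mathcal I$.** Groups $G_{\mathcal A,\mathcal B}$ ($\mathcal A,\mathcal B\in\mathcal I$) with: (1) maps $*:G_{\mathcal B,\mathcal C}\times G_{\mathcal A,\mathcal B}\to G_{\mathcal A,\mathcal C}$ that are associative, with $e_{\mathcal B,\mathcal B}*\alpha=\alpha=\alpha*e_{\mathcal A,\mathcal A}$ for $\alpha\in G_{\mathcal A,\mathcal B}$, $e_{\mathcal B,\mathcal C}*e_{\mathcal A,\mathcal B}=e_{\mathcal A,\mathcal C}$, and equal to the group product when $\mathcal A=\mathcal B=\mathcal C$; (2) group maps $G_{\mathcal A,\mathcal C}\to G_{\mathcal B,\mathcal C}$, $\omega\mapsto\omega_{(1)}$, and $G_{\mathcal A,\mathcal C}\to G_{\mathcal A,\mathcal B}$,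 $\omega\mapsto\omega_{(2)}$ (jointly $\pi$) such that $\omega(\beta*\alpha)\omega^{-1}=(\omega_{(1)}\beta)*(\alpha\omega_{(2)}^{-1})$, $\pi$ is coassociative ($(\omega_{(1)(1)},\omega_{(1)(2)},\omega_{(2)})=(\omega_{(1)},\omega_{(2)(1)},\omega_{(2)(2)})$) and counital ($\omega_{(1)}*e=\omega=e*\omega_{(2)}$). **Turaev 2-category.** It consists of: a class $\mathcal L^0$ of 0-cells; a transitive system of groups with projections over $\mathcal L^0$; for all $\mathcal A,\mathcal B$ a category $\mathcal L(\mathcal A,\mathcal B)=\bigcup^\bullet_{\alpha\in G_{\mathcal A,\mathcal B}}\mathcal L(\mathcal A,\mathcal B)_\alpha$ (disjoint union of categories) and a group map $\varphi^{\mathcal A,\mathcal B}:G_{\mathcal A,\mathcal B}\to\mathrm{Aut}(\mathcal L(\mathcal A,\mathcal B))$ (group of automorphisms of the category) with $\varphi_\beta(\mathcal L(\mathcal A,\mathcal B)_\alpha)=\mathcal L(\mathcal A,\mathcal B)_{\beta\alpha\beta^{-1}}$; identity 1-cells $\mathrm{Id}_{\mathcal A}\in\mathcal L(\mathcal A,\mathcal A)_e$ and identity 2-cells; composition functors $\mathcal L(\mathcal B,\mathcal C)_\beta\times\mathcal L(\mathcal A,\mathcal B)_\alpha\to\mathcal L(\mathcal A,\mathcal C)_{\beta*\alpha}$, $(Y,X)\mapsto Y\cdot X$, strictly associative and strictly unital, such that $\varphi^{\mathcal A,\mathcal C}_\omega(Y\cdot X)=\varphi^{\mathcal B,\mathcal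 C}_{\omega_{(1)}}(Y)\cdot\varphi^{\mathcal A,\mathcal B}_{\omega_{(2)}}(X)$ and $\varphi^{\mathcal A,\mathcal A}_\gamma(\mathrm{Id}_{\mathcal A})=\mathrm{Id}_{\mathcal A}$, naturally in $X,Y$. **Turaev extension.** If in a Turaev bicategory (in particular, a Turaev 2-category) $\mathcal L$ every 0-cell has the form $\mathcal A=\bigcup^\bullet_{\alpha\in G_{\mathcal A,\mathcal A}}\mathcal A_\alpha$ and $\mathcal L(\mathcal A,\mathcal B)_e=\mathcal L(\mathcal A_e,\mathcal B_e)_e$, its underlying bicategory has 0-cells $\mathcal A_e$ and hom-categories $\mathcal L(\mathcal A,\mathcal B)_e$. $\mathcal L$ is a Turaev extension of a bicategory if the latter is its underlying bicategory. Here $F=\bigcup^\bullet_{\alpha\in G}F_\alpha$ and the part $F_e$ is the bimonad $(\mathcal A,F,\lambda_e)$.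
   Formalization: Literal claim fails if some Aut_0 is nontrivial. Full claim is proved on classes with mutually isomorphic Aut_0; over all 0-cells, (co)associativity and counitality of the groups are dropped and Bimnd(K) keeps only homs between bimonads with isomorphic Aut_0. *)

theory Defs
  imports "HOL-Algebra.Group"
begin

section \<open>Categories and functors\<close>

record ('x, 'y) cat =
  Ob :: "'x set"
  Ar :: "'y set"
  dm :: "'y \<Rightarrow> 'x"
  cd :: "'y \<Rightarrow> 'x"
  idn :: "'x \<Rightarrow> 'y"
  cmp :: "'y \<Rightarrow> 'y \<Rightarrow> 'y"

locale category =
  fixes C :: "('x, 'y) cat"
  assumes dm_Ob: "f \<in> Ar C \<Longrightarrow> dm C f \<in> Ob C"
    and cd_Ob: "f \<in> Ar C \<Longrightarrow> cd C f \<in> Ob C"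
    and idn_Ar: "x \<in> Ob C \<Longrightarrow> idn C x \<in> Ar C"
    and dm_idn: "x \<in> Ob C \<Longrightarrow> dm C (idn C x) = x"
    and cd_idn: "x \<in> Ob C \<Longrightarrow> cd C (idn C x) = x"
    and cmp_Ar: "f \<in> Ar C \<Longrightarrow> g \<in> Ar C \<Longrightarrow> cd C f = dm C g \<Longrightarrow> cmp C g f \<in> Ar C"
    and dm_cmp: "f \<in> Ar C \<Longrightarrow> g \<in> Ar C \<Longrightarrow> cd C f = dm C g \<Longrightarrow> dm C (cmp C g f) = dm C f"
    and cd_cmp: "f \<in> Ar C \<Longrightarrow> g \<in> Ar C \<Longrightarrow> cd C f = dm C g \<Longrightarrow> cd C (cmp C g f) = cd C g"
    and idn_left: "f \<in> Ar C \<Longrightarrow> cmp C (idn C (cd C f)) f = f"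
    and idn_right: "f \<in> Ar C \<Longrightarrow> cmp C f (idn C (dm C f)) = f"
    and cmp_assoc: "f \<in> Ar C \<Longrightarrow> g \<in> Ar C \<Longrightarrow> h \<in> Ar C \<Longrightarrow> cd C f = dm C g \<Longrightarrow> cd C g = dm C h
      \<Longrightarrow> cmp C h (cmp C g f) = cmp C (cmp C h g) f"

text \<open>Equality of categories: the structure maps only matter on objects and arrows.\<close>

definition same_cat :: "('x, 'y) cat \<Rightarrow> ('x, 'y) cat \<Rightarrow> bool" where
  "same_cat C D \<longleftrightarrow> Ob C = Ob D \<and> Ar C = Ar D
     \<and> (\<forall>f\<in>Ar C. dm C f = dm D f \<and> cd C f = cd D f)
     \<and> (\<forall>x\<in>Ob C. idn C x = idn D x)
     \<and> (\<forall>f\<in>Ar C. \<forall>g\<in>Ar C. cd C f = dm C g \<longrightarrow> cmp C g f = cmp D g f)"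

text \<open>A functor is a pair of an object map and an arrow map.\<close>

definition is_functor ::
  "('x, 'y) cat \<Rightarrow> ('u, 'v) cat \<Rightarrow> ('x \<Rightarrow> 'u) \<times> ('y \<Rightarrow> 'v) \<Rightarrow> bool" where
  "is_functor C D F \<longleftrightarrow>
     fst F \<in> Ob C \<rightarrow> Ob D \<and> snd F \<in> Ar C \<rightarrow> Ar D
     \<and> (\<forall>f\<in>Ar C. dm D (snd F f) = fst F (dm C f) \<and> cd D (snd F f) = fst F (cd C f))
     \<and> (\<forall>x\<in>Ob C. snd F (idn C x) = idn D (fst F x))
     \<and> (\<forall>f\<in>Ar C. \<forall>g\<in>Ar C. cd C f = dm C g
          \<longrightarrow> snd F (cmp C g f) = cmp D (snd F g) (snd F f))"

definition prod_cat :: "('x, 'y) cat \<Rightarrow> ('u, 'v) cat \<Rightarrow> ('x \<times> 'u, 'y \<times> 'v) cat" where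
  "prod_cat C D =
     \<lparr> Ob = Ob C \<times> Ob D, Ar = Ar C \<times> Ar D,
       dm = (\<lambda>(f, g). (dm C f, dm D g)), cd = (\<lambda>(f, g). (cd C f, cd D g)),
       idn = (\<lambda>(x, y). (idn C x, idn D y)),
       cmp = (\<lambda>(f', g') (f, g). (cmp C f' f, cmp D g' g)) \<rparr>"

text \<open>The disjoint union of a family of categories; only arrows with equal tags compose.\<close>

definition disj_union_cat :: "'g set \<Rightarrow> ('g \<Rightarrow> ('x, 'y) cat) \<Rightarrow> ('g \<times> 'x, 'g \<times> 'y) cat" where
  "disj_union_cat J C =
     \<lparr> Ob = (SIGMA a:J. Ob (C a)), Ar = (SIGMA a:J. Ar (C a)),
       dm = (\<lambda>(a, f). (a, dm (C a) f)), cd = (\<lambda>(a, f). (a, cd (C a) f)),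
       idn = (\<lambda>(a, x). (a, idn (C a) x)),
       cmp = (\<lambda>(b, g) (a, f). (a, cmp (C a) g f)) \<rparr>"

text \<open>Automorphisms are the invertible endofunctors. As in the library's treatment of bijections,
  their object and arrow maps are extensional, so that equality of functors is equality in HOL.\<close>

definition endofunctors :: "('x, 'y) cat \<Rightarrow> (('x \<Rightarrow> 'x) \<times> ('y \<Rightarrow> 'y)) set" where
  "endofunctors C =
     {F. is_functor C C F \<and> fst F \<in> extensional (Ob C) \<and> snd F \<in> extensional (Ar C)}"

definition functor_comp :: "('x, 'y) cat \<Rightarrow> ('x \<Rightarrow> 'x) \<times> ('y \<Rightarrow> 'y)
    \<Rightarrow> ('x \<Rightarrow> 'x) \<times> ('y \<Rightarrow> 'y) \<Rightarrow> ('x \<Rightarrow> 'x) \<times> ('y \<Rightarrow> 'y)" where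
  "functor_comp C F H = (compose (Ob C) (fst F) (fst H), compose (Ar C) (snd F) (snd H))"

definition functor_id :: "('x, 'y) cat \<Rightarrow> ('x \<Rightarrow> 'x) \<times> ('y \<Rightarrow> 'y)" where
  "functor_id C = (\<lambda>x\<in>Ob C. x, \<lambda>f\<in>Ar C. f)"

definition Aut_cat :: "('x, 'y) cat \<Rightarrow> (('x \<Rightarrow> 'x) \<times> ('y \<Rightarrow> 'y)) monoid" where
  "Aut_cat C =
     \<lparr> carrier = {F \<in> endofunctors C. \<exists>H\<in>endofunctors C.
         functor_comp C F H = functor_id C \<and> functor_comp C H F = functor_id C},
       monoid.mult = functor_comp C, one = functor_id C \<rparr>"


section \<open>Strict 2-categories\<close>

text \<open>\<open>X \<cdot> F\<close> is the 1-cell written \<open>XF\<close> on paper (first \<open>F\<close>, then \<open>X\<close>), \<open>\<bullet>\<close> is vertical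
  and \<open>\<star>\<close> horizontal composition of 2-cells.\<close>

record ('o, 'm, 'c) two_cat =
  cells0 :: "'o set"
  cells1 :: "'m set"
  cells2 :: "'c set"
  src1 :: "'m \<Rightarrow> 'o"
  trg1 :: "'m \<Rightarrow> 'o"
  src2 :: "'c \<Rightarrow> 'm"
  trg2 :: "'c \<Rightarrow> 'm"
  id1 :: "'o \<Rightarrow> 'm"
  id2 :: "'m \<Rightarrow> 'c"
  comp1 :: "'m \<Rightarrow> 'm \<Rightarrow> 'm" (infixl "\<cdot>\<index>" 75)
  vcomp :: "'c \<Rightarrow> 'c \<Rightarrow> 'c" (infixl "\<bullet>\<index>" 65)
  hcomp :: "'c \<Rightarrow> 'c \<Rightarrow> 'c" (infixl "\<star>\<index>" 70)

definition hom1 :: "('o, 'm, 'c) two_cat \<Rightarrow> 'o \<Rightarrow> 'o \<Rightarrow> 'm set" where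
  "hom1 K A B = {X \<in> cells1 K. src1 K X = A \<and> trg1 K X = B}"

definition hom2 :: "('o, 'm, 'c) two_cat \<Rightarrow> 'm \<Rightarrow> 'm \<Rightarrow> 'c set" where
  "hom2 K X Y = {\<zeta> \<in> cells2 K. src2 K \<zeta> = X \<and> trg2 K \<zeta> = Y}"

locale two_category =
  fixes K :: "('o, 'm, 'c) two_cat" (structure)
  assumes src1_cells0: "X \<in> cells1 K \<Longrightarrow> src1 K X \<in> cells0 K"
    and trg1_cells0: "X \<in> cells1 K \<Longrightarrow> trg1 K X \<in> cells0 K"
    and src2_cells1: "\<zeta> \<in> cells2 K \<Longrightarrow> src2 K \<zeta> \<in> cells1 K"
    and trg2_cells1: "\<zeta> \<in> cells2 K \<Longrightarrow> trg2 K \<zeta> \<in> cells1 K"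
    and parallel_src: "\<zeta> \<in> cells2 K \<Longrightarrow> src1 K (src2 K \<zeta>) = src1 K (trg2 K \<zeta>)"
    and parallel_trg: "\<zeta> \<in> cells2 K \<Longrightarrow> trg1 K (src2 K \<zeta>) = trg1 K (trg2 K \<zeta>)"
    and id1_hom1: "A \<in> cells0 K \<Longrightarrow> id1 K A \<in> hom1 K A A"
    and comp1_hom1: "X \<in> hom1 K A B \<Longrightarrow> Y \<in> hom1 K B C \<Longrightarrow> Y \<cdot> X \<in> hom1 K A C"
    and comp1_assoc: "X \<in> hom1 K A B \<Longrightarrow> Y \<in> hom1 K B C \<Longrightarrow> Z \<in> hom1 K C D
      \<Longrightarrow> Z \<cdot> (Y \<cdot> X) = Z \<cdot> Y \<cdot> X"
    and comp1_id_left: "X \<in> hom1 K A B \<Longrightarrow> id1 K B \<cdot> X = X"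
    and comp1_id_right: "X \<in> hom1 K A B \<Longrightarrow> X \<cdot> id1 K A = X"
    and id2_hom2: "X \<in> cells1 K \<Longrightarrow> id2 K X \<in> hom2 K X X"
    and vcomp_hom2: "\<zeta> \<in> hom2 K X Y \<Longrightarrow> \<xi> \<in> hom2 K Y Z \<Longrightarrow> \<xi> \<bullet> \<zeta> \<in> hom2 K X Z"
    and vcomp_assoc: "\<zeta> \<in> hom2 K X Y \<Longrightarrow> \<xi> \<in> hom2 K Y Z \<Longrightarrow> \<theta> \<in> hom2 K Z W
      \<Longrightarrow> \<theta> \<bullet> (\<xi> \<bullet> \<zeta>) = \<theta> \<bullet> \<xi> \<bullet> \<zeta>"
    and vcomp_id_left: "\<zeta> \<in> hom2 K X Y \<Longrightarrow> id2 K Y \<bullet> \<zeta> = \<zeta>"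
    and vcomp_id_right: "\<zeta> \<in> hom2 K X Y \<Longrightarrow> \<zeta> \<bullet> id2 K X = \<zeta>"
    and hcomp_hom2: "\<zeta> \<in> hom2 K X X' \<Longrightarrow> \<xi> \<in> hom2 K Y Y' \<Longrightarrow> trg1 K X = src1 K Y
      \<Longrightarrow> \<xi> \<star> \<zeta> \<in> hom2 K (Y \<cdot> X) (Y' \<cdot> X')"
    and hcomp_assoc: "\<zeta> \<in> hom2 K X X' \<Longrightarrow> \<xi> \<in> hom2 K Y Y' \<Longrightarrow> \<theta> \<in> hom2 K Z Z'
      \<Longrightarrow> trg1 K X = src1 K Y \<Longrightarrow> trg1 K Y = src1 K Z
      \<Longrightarrow> \<theta> \<star> (\<xi> \<star> \<zeta>) = \<theta> \<star> \<xi> \<star> \<zeta>"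
    and hcomp_id_left: "X \<in> hom1 K A B \<Longrightarrow> \<zeta> \<in> hom2 K X Y \<Longrightarrow> id2 K (id1 K B) \<star> \<zeta> = \<zeta>"
    and hcomp_id_right: "X \<in> hom1 K A B \<Longrightarrow> \<zeta> \<in> hom2 K X Y \<Longrightarrow> \<zeta> \<star> id2 K (id1 K A) = \<zeta>"
    and hcomp_id2: "X \<in> hom1 K A B \<Longrightarrow> Y \<in> hom1 K B C \<Longrightarrow> id2 K Y \<star> id2 K X = id2 K (Y \<cdot> X)"
    and interchange: "\<zeta> \<in> hom2 K X X' \<Longrightarrow> \<zeta>' \<in> hom2 K X' X'' \<Longrightarrow> \<xi> \<in> hom2 K Y Y'
      \<Longrightarrow> \<xi>' \<in> hom2 K Y' Y'' \<Longrightarrow> trg1 K X = src1 K Y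
      \<Longrightarrow> (\<xi>' \<bullet> \<xi>) \<star> (\<zeta>' \<bullet> \<zeta>) = (\<xi>' \<star> \<zeta>') \<bullet> (\<xi> \<star> \<zeta>)"

abbreviation whisker_left :: "('o, 'm, 'c) two_cat \<Rightarrow> 'm \<Rightarrow> 'c \<Rightarrow> 'c" (infixr "\<triangleright>\<index>" 80) where
  "X \<triangleright>\<^bsub>K\<^esub> \<zeta> \<equiv> id2 K X \<star>\<^bsub>K\<^esub> \<zeta>"

abbreviation whisker_right :: "('o, 'm, 'c) two_cat \<Rightarrow> 'c \<Rightarrow> 'm \<Rightarrow> 'c" (infixl "\<triangleleft>\<index>" 80) where
  "\<zeta> \<triangleleft>\<^bsub>K\<^esub> X \<equiv> \<zeta> \<star>\<^bsub>K\<^esub> id2 K X"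

definition hom_cat :: "('o, 'm, 'c) two_cat \<Rightarrow> 'o \<Rightarrow> 'o \<Rightarrow> ('m, 'c) cat" where
  "hom_cat K A B =
     \<lparr> Ob = hom1 K A B,
       Ar = {\<zeta> \<in> cells2 K. src2 K \<zeta> \<in> hom1 K A B \<and> trg2 K \<zeta> \<in> hom1 K A B},
       dm = src2 K, cd = trg2 K, idn = id2 K, cmp = vcomp K \<rparr>"

text \<open>The sub-2-category on the 0-cells in \<open>J\<close> that keeps exactly the hom-categories between
  0-cells related by \<open>R\<close>.\<close>

definition sub_two_cat ::
  "('o, 'm, 'c) two_cat \<Rightarrow> 'o set \<Rightarrow> ('o \<Rightarrow> 'o \<Rightarrow> bool) \<Rightarrow> ('o, 'm, 'c) two_cat" where
  "sub_two_cat K J R =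
     (let M = {X \<in> cells1 K. src1 K X \<in> J \<and> trg1 K X \<in> J \<and> R (src1 K X) (trg1 K X)}
      in K\<lparr> cells0 := J, cells1 := M,
            cells2 := {\<zeta> \<in> cells2 K. src2 K \<zeta> \<in> M \<and> trg2 K \<zeta> \<in> M} \<rparr>)"


section \<open>Monads, comonads and bimonads in a 2-category\<close>

text \<open>Data of a monad and a comonad on the same endo-1-cell; \<open>mnd_1cell\<close> and \<open>comnd_1cell\<close>
  each use only one half of it.\<close>

record ('o, 'm, 'c) monad_comonad =
  base :: 'o
  endo :: 'm
  mu :: 'c
  eta :: 'c
  Delta :: 'c
  eps :: 'c

type_synonym ('o, 'm, 'c) bimnd = "('o, 'm, 'c) monad_comonad \<times> 'c"

type_synonym ('o, 'm, 'c) bimnd_1cell = "('o, 'm, 'c) bimnd \<times> ('m \<times> 'c \<times> 'c) \<times> ('o, 'm, 'c) bimnd"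

type_synonym ('o, 'm, 'c) bimnd_2cell = "('o, 'm, 'c) bimnd_1cell \<times> 'c \<times> ('o, 'm, 'c) bimnd_1cell"

context
  fixes K :: "('o, 'm, 'c) two_cat" (structure)
begin

definition is_monad :: "('o, 'm, 'c) monad_comonad \<Rightarrow> bool" where
  "is_monad S \<longleftrightarrow> (let A = base S; F = endo S; \<mu> = mu S; \<eta> = eta S in
     A \<in> cells0 K \<and> F \<in> hom1 K A A \<and> \<mu> \<in> hom2 K (F \<cdot> F) F \<and> \<eta> \<in> hom2 K (id1 K A) F
     \<and> \<mu> \<bullet> (\<mu> \<triangleleft> F) = \<mu> \<bullet> (F \<triangleright> \<mu>)
     \<and> \<mu> \<bullet> (\<eta> \<triangleleft> F) = id2 K F \<and> \<mu> \<bullet> (F \<triangleright> \<eta>) = id2 K F)"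

definition is_comonad :: "('o, 'm, 'c) monad_comonad \<Rightarrow> bool" where
  "is_comonad S \<longleftrightarrow> (let A = base S; F = endo S; \<Delta> = Delta S; \<epsilon> = eps S in
     A \<in> cells0 K \<and> F \<in> hom1 K A A \<and> \<Delta> \<in> hom2 K F (F \<cdot> F) \<and> \<epsilon> \<in> hom2 K F (id1 K A)
     \<and> (\<Delta> \<triangleleft> F) \<bullet> \<Delta> = (F \<triangleright> \<Delta>) \<bullet> \<Delta>
     \<and> (\<epsilon> \<triangleleft> F) \<bullet> \<Delta> = id2 K F \<and> (F \<triangleright> \<epsilon>) \<bullet> \<Delta> = id2 K F)"

definition mnd_1cell ::
  "('o, 'm, 'c) monad_comonad \<Rightarrow> ('o, 'm, 'c) monad_comonad \<Rightarrow> 'm \<Rightarrow> 'c \<Rightarrow> bool" where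
  "mnd_1cell S S' X \<psi> \<longleftrightarrow> (let F = endo S; F' = endo S' in
     X \<in> hom1 K (base S) (base S') \<and> \<psi> \<in> hom2 K (F' \<cdot> X) (X \<cdot> F)
     \<and> (X \<triangleright> mu S) \<bullet> (\<psi> \<triangleleft> F) \<bullet> (F' \<triangleright> \<psi>) = \<psi> \<bullet> (mu S' \<triangleleft> X)
     \<and> \<psi> \<bullet> (eta S' \<triangleleft> X) = X \<triangleright> eta S)"

definition comnd_1cell ::
  "('o, 'm, 'c) monad_comonad \<Rightarrow> ('o, 'm, 'c) monad_comonad \<Rightarrow> 'm \<Rightarrow> 'c \<Rightarrow> bool" where
  "comnd_1cell S S' X \<phi> \<longleftrightarrow> (let F = endo S; F' = endo S' in
     X \<in> hom1 K (base S) (base S') \<and> \<phi> \<in> hom2 K (X \<cdot> F) (F' \<cdot> X)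
     \<and> (F' \<triangleright> \<phi>) \<bullet> (\<phi> \<triangleleft> F) \<bullet> (X \<triangleright> Delta S) = (Delta S' \<triangleleft> X) \<bullet> \<phi>
     \<and> (eps S' \<triangleleft> X) \<bullet> \<phi> = X \<triangleright> eps S)"

definition is_bimonad :: "('o, 'm, 'c) bimnd \<Rightarrow> bool" where
  "is_bimonad P \<longleftrightarrow> (let S = fst P; l = snd P; F = endo S in
     is_monad S \<and> is_comonad S \<and> mnd_1cell S S F l \<and> comnd_1cell S S F l
     \<and> Delta S \<bullet> mu S = (F \<triangleright> mu S) \<bullet> (l \<triangleleft> F) \<bullet> (F \<triangleright> Delta S)
     \<and> eps S \<bullet> mu S = eps S \<star> eps S
     \<and> Delta S \<bullet> eta S = eta S \<star> eta S
     \<and> eps S \<bullet> eta S = id2 K (id1 K (base S)))"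

text \<open>The next two notions make sense for all pairs \<open>(S, \<lambda>)\<close>, not only for bimonads: they define
  the 1- and 2-cells of \<open>Bimnd(K)\<close> as well as the categories \<open>Bimnd\<^sup>T(F\<^sub>\<beta>, F'\<^sub>\<alpha>)\<close>, where
  \<open>(F, \<lambda>\<^sub>\<beta>)\<close> need not be a bimonad.\<close>

definition bimnd_1cells :: "('o, 'm, 'c) bimnd \<Rightarrow> ('o, 'm, 'c) bimnd \<Rightarrow> ('o, 'm, 'c) bimnd_1cell set" where
  "bimnd_1cells P P' = {(P, (X, \<psi>, \<phi>), P') | X \<psi> \<phi>.
     let F = endo (fst P); F' = endo (fst P') in
     mnd_1cell (fst P) (fst P') X \<psi> \<and> comnd_1cell (fst P) (fst P') X \<phi>
     \<and> (\<phi> \<triangleleft> F) \<bullet> (X \<triangleright> snd P) \<bullet> (\<psi> \<triangleleft> F) = (F' \<triangleright> \<psi>) \<bullet> (snd P' \<triangleleft> X) \<bullet> (F' \<triangleright> \<phi>)}"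

definition bimnd_2cells :: "('o, 'm, 'c) bimnd \<Rightarrow> ('o, 'm, 'c) bimnd \<Rightarrow> ('o, 'm, 'c) bimnd_2cell set" where
  "bimnd_2cells P P' = {((P, (X, \<psi>\<^sub>X, \<phi>\<^sub>X), P'), \<zeta>, (P, (Y, \<psi>\<^sub>Y, \<phi>\<^sub>Y), P')) | X \<psi>\<^sub>X \<phi>\<^sub>X \<zeta> Y \<psi>\<^sub>Y \<phi>\<^sub>Y.
     let F = endo (fst P); F' = endo (fst P') in
     (P, (X, \<psi>\<^sub>X, \<phi>\<^sub>X), P') \<in> bimnd_1cells P P' \<and> (P, (Y, \<psi>\<^sub>Y, \<phi>\<^sub>Y), P') \<in> bimnd_1cells P P'
     \<and> \<zeta> \<in> hom2 K X Y
     \<and> (\<zeta> \<triangleleft> F) \<bullet> \<psi>\<^sub>X = \<psi>\<^sub>Y \<bullet> (F' \<triangleright> \<zeta>)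
     \<and> (F' \<triangleright> \<zeta>) \<bullet> \<phi>\<^sub>X = \<phi>\<^sub>Y \<bullet> (\<zeta> \<triangleleft> F)}"

definition bimnd_id1 :: "('o, 'm, 'c) bimnd \<Rightarrow> ('o, 'm, 'c) bimnd_1cell" where
  "bimnd_id1 P = (P, (id1 K (base (fst P)), id2 K (endo (fst P)), id2 K (endo (fst P))), P)"

definition bimnd_id2 :: "('o, 'm, 'c) bimnd_1cell \<Rightarrow> ('o, 'm, 'c) bimnd_2cell" where
  "bimnd_id2 x = (x, id2 K (fst (fst (snd x))), x)"

definition bimnd_vcomp ::
  "('o, 'm, 'c) bimnd_2cell \<Rightarrow> ('o, 'm, 'c) bimnd_2cell \<Rightarrow> ('o, 'm, 'c) bimnd_2cell" where
  "bimnd_vcomp = (\<lambda>(_, \<xi>, z) (x, \<zeta>, _). (x, \<xi> \<bullet> \<zeta>, z))"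

definition bimnd_comp1 ::
  "('o, 'm, 'c) bimnd_1cell \<Rightarrow> ('o, 'm, 'c) bimnd_1cell \<Rightarrow> ('o, 'm, 'c) bimnd_1cell" where
  "bimnd_comp1 = (\<lambda>(_, (X, \<psi>\<^sub>X, \<phi>\<^sub>X), P'') (P, (Y, \<psi>\<^sub>Y, \<phi>\<^sub>Y), _).
     (P, (X \<cdot> Y, (X \<triangleright> \<psi>\<^sub>Y) \<bullet> (\<psi>\<^sub>X \<triangleleft> Y), (\<phi>\<^sub>X \<triangleleft> Y) \<bullet> (X \<triangleright> \<phi>\<^sub>Y)), P''))"

definition Bimnd ::
  "(('o, 'm, 'c) bimnd, ('o, 'm, 'c) bimnd_1cell, ('o, 'm, 'c) bimnd_2cell) two_cat" where
  "Bimnd =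
     \<lparr> cells0 = Collect is_bimonad,
       cells1 = (\<Union>P\<in>Collect is_bimonad. \<Union>P'\<in>Collect is_bimonad. bimnd_1cells P P'),
       cells2 = (\<Union>P\<in>Collect is_bimonad. \<Union>P'\<in>Collect is_bimonad. bimnd_2cells P P'),
       src1 = fst, trg1 = (\<lambda>x. snd (snd x)),
       src2 = fst, trg2 = (\<lambda>z. snd (snd z)),
       id1 = bimnd_id1, id2 = bimnd_id2,
       comp1 = bimnd_comp1, vcomp = bimnd_vcomp,
       hcomp = (\<lambda>(x', \<xi>, y') (x, \<zeta>, y). (bimnd_comp1 x' x, \<xi> \<star> \<zeta>, bimnd_comp1 y' y)) \<rparr>"

definition bimnd_hom_cat :: "('o, 'm, 'c) bimnd \<Rightarrow> ('o, 'm, 'c) bimnd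
    \<Rightarrow> (('o, 'm, 'c) bimnd_1cell, ('o, 'm, 'c) bimnd_2cell) cat" where
  "bimnd_hom_cat P P' =
     \<lparr> Ob = bimnd_1cells P P', Ar = bimnd_2cells P P',
       dm = fst, cd = (\<lambda>z. snd (snd z)), idn = bimnd_id2, cmp = bimnd_vcomp \<rparr>"

definition Aut0 :: "('o, 'm, 'c) bimnd \<Rightarrow> 'c monoid" where
  "Aut0 P = (let S = fst P; l = snd P; F = endo S in
     \<lparr> carrier = {\<alpha> \<in> hom2 K F F.
         \<alpha> \<bullet> mu S = mu S \<bullet> (\<alpha> \<star> \<alpha>) \<and> \<alpha> \<bullet> eta S = eta S
         \<and> Delta S \<bullet> \<alpha> = (\<alpha> \<star> \<alpha>) \<bullet> Delta S \<and> eps S \<bullet> \<alpha> = eps S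
         \<and> (\<exists>\<alpha>'\<in>hom2 K F F. \<alpha> \<bullet> \<alpha>' = id2 K F \<and> \<alpha>' \<bullet> \<alpha> = id2 K F
              \<and> (\<alpha>' \<triangleleft> F) \<bullet> l \<bullet> (\<alpha> \<triangleleft> F) = (F \<triangleright> \<alpha>) \<bullet> l \<bullet> (F \<triangleright> \<alpha>'))},
       monoid.mult = vcomp K, one = id2 K F \<rparr>)"

definition fusion_maps ::
  "(('o, 'm, 'c) bimnd \<Rightarrow> ('o, 'm, 'c) bimnd \<Rightarrow> 'c \<Rightarrow> 'c) \<Rightarrow> bool" where
  "fusion_maps j \<longleftrightarrow>
     (\<forall>P P'. is_bimonad P \<and> is_bimonad P' \<and> Aut0 P \<cong> Aut0 P' \<longrightarrow>
        j P P' \<in> iso (Aut0 P) (Aut0 P')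
        \<and> (\<forall>\<alpha>\<in>carrier (Aut0 P). j P' P (j P P' \<alpha>) = \<alpha>))
     \<and> (\<forall>P. is_bimonad P \<longrightarrow> (\<forall>\<alpha>\<in>carrier (Aut0 P). j P P \<alpha> = \<alpha>))
     \<and> (\<forall>P P' P''. is_bimonad P \<and> is_bimonad P' \<and> is_bimonad P''
          \<and> Aut0 P \<cong> Aut0 P' \<and> Aut0 P' \<cong> Aut0 P''
          \<longrightarrow> (\<forall>\<alpha>\<in>carrier (Aut0 P). j P P'' \<alpha> = j P' P'' (j P P' \<alpha>)))"

end


section \<open>Turaev 2-categories\<close>

text \<open>A transitive system of groups with projections: \<open>m A B C\<close> is the product
  \<open>G\<^bsub>B,C\<^esub> \<times> G\<^bsub>A,B\<^esub> \<rightarrow> G\<^bsub>A,C\<^esub>\<close>; \<open>p1 A B C\<close> and \<open>p2 A B C\<close> are the projections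
  \<open>G\<^bsub>A,C\<^esub> \<rightarrow> G\<^bsub>B,C\<^esub>\<close> and \<open>G\<^bsub>A,C\<^esub> \<rightarrow> G\<^bsub>A,B\<^esub>\<close>. Associativity, coassociativity and counitality are
  kept apart, because for \<open>Bimnd\<^sup>T(K)\<close> they hold only between 0-cells whose 0-automorphism groups are
  isomorphic: if \<open>G\<^bsub>A,C\<^esub>\<close> is trivial, then already \<open>\<alpha> = (e\<^bsub>C,A\<^esub> * e\<^bsub>A,C\<^esub>) * \<alpha> = e\<^bsub>C,A\<^esub> * (e\<^bsub>A,C\<^esub> * \<alpha>) = e\<close>
  for all \<open>\<alpha>\<close> in \<open>G\<^bsub>A,A\<^esub>\<close>.\<close>

locale graded_groups =
  fixes I :: "'o set"
    and G :: "'o \<Rightarrow> 'o \<Rightarrow> 'g monoid"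
    and m :: "'o \<Rightarrow> 'o \<Rightarrow> 'o \<Rightarrow> 'g \<Rightarrow> 'g \<Rightarrow> 'g"
    and p1 p2 :: "'o \<Rightarrow> 'o \<Rightarrow> 'o \<Rightarrow> 'g \<Rightarrow> 'g"
  assumes groups: "\<lbrakk>A \<in> I; B \<in> I\<rbrakk> \<Longrightarrow> group (G A B)"
    and m_closed: "\<lbrakk>A \<in> I; B \<in> I; C \<in> I; \<alpha> \<in> carrier (G A B); \<beta> \<in> carrier (G B C)\<rbrakk>
      \<Longrightarrow> m A B C \<beta> \<alpha> \<in> carrier (G A C)"
    and m_unit_left: "\<lbrakk>A \<in> I; B \<in> I; \<alpha> \<in> carrier (G A B)\<rbrakk> \<Longrightarrow> m A B B \<one>\<^bsub>G B B\<^esub> \<alpha> = \<alpha>"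
    and m_unit_right: "\<lbrakk>A \<in> I; B \<in> I; \<alpha> \<in> carrier (G A B)\<rbrakk> \<Longrightarrow> m A A B \<alpha> \<one>\<^bsub>G A A\<^esub> = \<alpha>"
    and m_one: "\<lbrakk>A \<in> I; B \<in> I; C \<in> I\<rbrakk> \<Longrightarrow> m A B C \<one>\<^bsub>G B C\<^esub> \<one>\<^bsub>G A B\<^esub> = \<one>\<^bsub>G A C\<^esub>"
    and m_group: "\<lbrakk>A \<in> I; \<alpha> \<in> carrier (G A A); \<beta> \<in> carrier (G A A)\<rbrakk>
      \<Longrightarrow> m A A A \<beta> \<alpha> = \<beta> \<otimes>\<^bsub>G A A\<^esub> \<alpha>"
    and p1_hom: "\<lbrakk>A \<in> I; B \<in> I; C \<in> I\<rbrakk> \<Longrightarrow> p1 A B C \<in> hom (G A C) (G B C)"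
    and p2_hom: "\<lbrakk>A \<in> I; B \<in> I; C \<in> I\<rbrakk> \<Longrightarrow> p2 A B C \<in> hom (G A C) (G A B)"
    and conjugation: "\<lbrakk>A \<in> I; B \<in> I; C \<in> I; \<alpha> \<in> carrier (G A B); \<beta> \<in> carrier (G B C);
        \<omega> \<in> carrier (G A C)\<rbrakk>
      \<Longrightarrow> \<omega> \<otimes>\<^bsub>G A C\<^esub> m A B C \<beta> \<alpha> \<otimes>\<^bsub>G A C\<^esub> inv\<^bsub>G A C\<^esub> \<omega>
          = m A B C (p1 A B C \<omega> \<otimes>\<^bsub>G B C\<^esub> \<beta>) (\<alpha> \<otimes>\<^bsub>G A B\<^esub> inv\<^bsub>G A B\<^esub> (p2 A B C \<omega>))"

locale transitive_system = graded_groups I G m p1 p2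
  for I :: "'o set"
    and G :: "'o \<Rightarrow> 'o \<Rightarrow> 'g monoid"
    and m :: "'o \<Rightarrow> 'o \<Rightarrow> 'o \<Rightarrow> 'g \<Rightarrow> 'g \<Rightarrow> 'g"
    and p1 p2 :: "'o \<Rightarrow> 'o \<Rightarrow> 'o \<Rightarrow> 'g \<Rightarrow> 'g" +
  assumes m_assoc: "\<lbrakk>A \<in> I; B \<in> I; C \<in> I; D \<in> I; \<alpha> \<in> carrier (G A B); \<beta> \<in> carrier (G B C);
        \<gamma> \<in> carrier (G C D)\<rbrakk>
      \<Longrightarrow> m A C D \<gamma> (m A B C \<beta> \<alpha>) = m A B D (m B C D \<gamma> \<beta>) \<alpha>"
    and coassoc: "\<lbrakk>A \<in> I; B \<in> I; C \<in> I; D \<in> I; \<omega> \<in> carrier (G A D)\<rbrakk>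
      \<Longrightarrow> (p1 B C D (p1 A B D \<omega>), p2 B C D (p1 A B D \<omega>), p2 A B D \<omega>)
          = (p1 A C D \<omega>, p1 A B C (p2 A C D \<omega>), p2 A B C (p2 A C D \<omega>))"
    and counit_left: "\<lbrakk>A \<in> I; B \<in> I; C \<in> I; \<omega> \<in> carrier (G A C)\<rbrakk>
      \<Longrightarrow> m A B C (p1 A B C \<omega>) \<one>\<^bsub>G A B\<^esub> = \<omega>"
    and counit_right: "\<lbrakk>A \<in> I; B \<in> I; C \<in> I; \<omega> \<in> carrier (G A C)\<rbrakk>
      \<Longrightarrow> m A B C \<one>\<^bsub>G B C\<^esub> (p2 A B C \<omega>) = \<omega>"

text \<open>\<open>tcomp T A B C \<beta> \<alpha>\<close> is the composition functor on the components of degrees \<open>\<beta>\<close> and \<open>\<alpha>\<close>;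
  \<open>tact T A B\<close> is \<open>\<phi>\<^bsup>A,B\<^esup>\<close>, acting on the disjoint union of the components.\<close>

record ('o, 'g, 'x, 'y) turaev_data =
  tcells0 :: "'o set"
  tgrp :: "'o \<Rightarrow> 'o \<Rightarrow> 'g monoid"
  tmult :: "'o \<Rightarrow> 'o \<Rightarrow> 'o \<Rightarrow> 'g \<Rightarrow> 'g \<Rightarrow> 'g"
  tpr1 :: "'o \<Rightarrow> 'o \<Rightarrow> 'o \<Rightarrow> 'g \<Rightarrow> 'g"
  tpr2 :: "'o \<Rightarrow> 'o \<Rightarrow> 'o \<Rightarrow> 'g \<Rightarrow> 'g"
  tpart :: "'o \<Rightarrow> 'o \<Rightarrow> 'g \<Rightarrow> ('x, 'y) cat"
  tact :: "'o \<Rightarrow> 'o \<Rightarrow> 'g \<Rightarrow> ('g \<times> 'x \<Rightarrow> 'g \<times> 'x) \<times> ('g \<times> 'y \<Rightarrow> 'g \<times> 'y)"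
  tid :: "'o \<Rightarrow> 'x"
  tcomp :: "'o \<Rightarrow> 'o \<Rightarrow> 'o \<Rightarrow> 'g \<Rightarrow> 'g \<Rightarrow> ('x \<times> 'x \<Rightarrow> 'x) \<times> ('y \<times> 'y \<Rightarrow> 'y)"

definition thom :: "('o, 'g, 'x, 'y) turaev_data \<Rightarrow> 'o \<Rightarrow> 'o \<Rightarrow> ('g \<times> 'x, 'g \<times> 'y) cat" where
  "thom T A B = disj_union_cat (carrier (tgrp T A B)) (tpart T A B)"

definition tcomp0 :: "('o, 'g, 'x, 'y) turaev_data \<Rightarrow> 'o \<Rightarrow> 'o \<Rightarrow> 'o
    \<Rightarrow> 'g \<times> 'x \<Rightarrow> 'g \<times> 'x \<Rightarrow> 'g \<times> 'x" where
  "tcomp0 T A B C = (\<lambda>(\<beta>, Y) (\<alpha>, X). (tmult T A B C \<beta> \<alpha>, fst (tcomp T A B C \<beta> \<alpha>) (Y, X)))"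

definition tcomp1 :: "('o, 'g, 'x, 'y) turaev_data \<Rightarrow> 'o \<Rightarrow> 'o \<Rightarrow> 'o
    \<Rightarrow> 'g \<times> 'y \<Rightarrow> 'g \<times> 'y \<Rightarrow> 'g \<times> 'y" where
  "tcomp1 T A B C = (\<lambda>(\<beta>, g) (\<alpha>, f). (tmult T A B C \<beta> \<alpha>, snd (tcomp T A B C \<beta> \<alpha>) (g, f)))"

text \<open>The part of the definition of a Turaev 2-category that concerns the hom-categories.\<close>

locale turaev_homs =
  fixes T :: "('o, 'g, 'x, 'y) turaev_data"
  assumes part_category: "\<lbrakk>A \<in> tcells0 T; B \<in> tcells0 T; \<alpha> \<in> carrier (tgrp T A B)\<rbrakk>
      \<Longrightarrow> category (tpart T A B \<alpha>)"
    and act_group_hom: "\<lbrakk>A \<in> tcells0 T; B \<in> tcells0 T\<rbrakk>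
      \<Longrightarrow> group_hom (tgrp T A B) (Aut_cat (thom T A B)) (tact T A B)"
    and act_part_Ob: "\<lbrakk>A \<in> tcells0 T; B \<in> tcells0 T; \<alpha> \<in> carrier (tgrp T A B); \<beta> \<in> carrier (tgrp T A B);
        \<gamma> = \<beta> \<otimes>\<^bsub>tgrp T A B\<^esub> \<alpha> \<otimes>\<^bsub>tgrp T A B\<^esub> inv\<^bsub>tgrp T A B\<^esub> \<beta>\<rbrakk>
      \<Longrightarrow> fst (tact T A B \<beta>) ` ({\<alpha>} \<times> Ob (tpart T A B \<alpha>)) = {\<gamma>} \<times> Ob (tpart T A B \<gamma>)"
    and act_part_Ar: "\<lbrakk>A \<in> tcells0 T; B \<in> tcells0 T; \<alpha> \<in> carrier (tgrp T A B); \<beta> \<in> carrier (tgrp T A B);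
        \<gamma> = \<beta> \<otimes>\<^bsub>tgrp T A B\<^esub> \<alpha> \<otimes>\<^bsub>tgrp T A B\<^esub> inv\<^bsub>tgrp T A B\<^esub> \<beta>\<rbrakk>
      \<Longrightarrow> snd (tact T A B \<beta>) ` ({\<alpha>} \<times> Ar (tpart T A B \<alpha>)) = {\<gamma>} \<times> Ar (tpart T A B \<gamma>)"
    and id_Ob: "A \<in> tcells0 T \<Longrightarrow> tid T A \<in> Ob (tpart T A A \<one>\<^bsub>tgrp T A A\<^esub>)"
    and comp_functor: "\<lbrakk>A \<in> tcells0 T; B \<in> tcells0 T; C \<in> tcells0 T;
        \<alpha> \<in> carrier (tgrp T A B); \<beta> \<in> carrier (tgrp T B C)\<rbrakk>
      \<Longrightarrow> is_functor (prod_cat (tpart T B C \<beta>) (tpart T A B \<alpha>))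
            (tpart T A C (tmult T A B C \<beta> \<alpha>)) (tcomp T A B C \<beta> \<alpha>)"
    and comp_assoc_Ob: "\<lbrakk>A \<in> tcells0 T; B \<in> tcells0 T; C \<in> tcells0 T; D \<in> tcells0 T;
        x \<in> Ob (thom T A B); y \<in> Ob (thom T B C); z \<in> Ob (thom T C D)\<rbrakk>
      \<Longrightarrow> tcomp0 T A C D z (tcomp0 T A B C y x) = tcomp0 T A B D (tcomp0 T B C D z y) x"
    and comp_assoc_Ar: "\<lbrakk>A \<in> tcells0 T; B \<in> tcells0 T; C \<in> tcells0 T; D \<in> tcells0 T;
        f \<in> Ar (thom T A B); g \<in> Ar (thom T B C); h \<in> Ar (thom T C D)\<rbrakk>
      \<Longrightarrow> tcomp1 T A C D h (tcomp1 T A B C g f) = tcomp1 T A B D (tcomp1 T B C D h g) f"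
    and comp_id_left_Ob: "\<lbrakk>A \<in> tcells0 T; B \<in> tcells0 T; x \<in> Ob (thom T A B)\<rbrakk>
      \<Longrightarrow> tcomp0 T A B B (\<one>\<^bsub>tgrp T B B\<^esub>, tid T B) x = x"
    and comp_id_right_Ob: "\<lbrakk>A \<in> tcells0 T; B \<in> tcells0 T; x \<in> Ob (thom T A B)\<rbrakk>
      \<Longrightarrow> tcomp0 T A A B x (\<one>\<^bsub>tgrp T A A\<^esub>, tid T A) = x"
    and comp_id_left_Ar: "\<lbrakk>A \<in> tcells0 T; B \<in> tcells0 T; f \<in> Ar (thom T A B)\<rbrakk>
      \<Longrightarrow> tcomp1 T A B B (idn (thom T B B) (\<one>\<^bsub>tgrp T B B\<^esub>, tid T B)) f = f"
    and comp_id_right_Ar: "\<lbrakk>A \<in> tcells0 T; B \<in> tcells0 T; f \<in> Ar (thom T A B)\<rbrakk>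
      \<Longrightarrow> tcomp1 T A A B f (idn (thom T A A) (\<one>\<^bsub>tgrp T A A\<^esub>, tid T A)) = f"
    and act_comp_Ob: "\<lbrakk>A \<in> tcells0 T; B \<in> tcells0 T; C \<in> tcells0 T; \<omega> \<in> carrier (tgrp T A C);
        x \<in> Ob (thom T A B); y \<in> Ob (thom T B C)\<rbrakk>
      \<Longrightarrow> fst (tact T A C \<omega>) (tcomp0 T A B C y x)
          = tcomp0 T A B C (fst (tact T B C (tpr1 T A B C \<omega>)) y) (fst (tact T A B (tpr2 T A B C \<omega>)) x)"
    and act_comp_Ar: "\<lbrakk>A \<in> tcells0 T; B \<in> tcells0 T; C \<in> tcells0 T; \<omega> \<in> carrier (tgrp T A C);
        f \<in> Ar (thom T A B); g \<in> Ar (thom T B C)\<rbrakk>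
      \<Longrightarrow> snd (tact T A C \<omega>) (tcomp1 T A B C g f)
          = tcomp1 T A B C (snd (tact T B C (tpr1 T A B C \<omega>)) g) (snd (tact T A B (tpr2 T A B C \<omega>)) f)"
    and act_id: "\<lbrakk>A \<in> tcells0 T; \<omega> \<in> carrier (tgrp T A A)\<rbrakk>
      \<Longrightarrow> fst (tact T A A \<omega>) (\<one>\<^bsub>tgrp T A A\<^esub>, tid T A) = (\<one>\<^bsub>tgrp T A A\<^esub>, tid T A)"

definition turaev_2category :: "('o, 'g, 'x, 'y) turaev_data \<Rightarrow> bool" where
  "turaev_2category T \<longleftrightarrow>
     transitive_system (tcells0 T) (tgrp T) (tmult T) (tpr1 T) (tpr2 T) \<and> turaev_homs T"

text \<open>Every 0-cell \<open>A\<close> is a formal disjoint union of parts \<open>part A \<alpha>\<close>, with \<open>\<alpha>\<close> in a group \<open>H A\<close>, and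
  \<open>E\<close> is the 2-category with 0-cells \<open>A\<^sub>e = part A e\<close>, hom-categories \<open>L(A, B)\<^sub>e\<close>, and the identities
  and compositions of \<open>T\<close>. Injectivity makes the hom-category between \<open>A\<^sub>e\<close> and \<open>B\<^sub>e\<close>
  well defined.\<close>

definition turaev_extension :: "('o, 'g, 'x, 'y) turaev_data \<Rightarrow> ('o \<Rightarrow> 'h monoid) \<Rightarrow> ('o \<Rightarrow> 'h \<Rightarrow> 'p)
    \<Rightarrow> ('p, 'x, 'y) two_cat \<Rightarrow> bool" where
  "turaev_extension T H part E \<longleftrightarrow> (let e_part = (\<lambda>A. part A \<one>\<^bsub>H A\<^esub>); e = (\<lambda>A B. \<one>\<^bsub>tgrp T A B\<^esub>) in
     two_category E
     \<and> inj_on e_part (tcells0 T) \<and> cells0 E = e_part ` tcells0 T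
     \<and> (\<forall>A\<in>tcells0 T. \<forall>B\<in>tcells0 T. same_cat (hom_cat E (e_part A) (e_part B)) (tpart T A B (e A B)))
     \<and> (\<forall>A\<in>tcells0 T. id1 E (e_part A) = tid T A)
     \<and> (\<forall>A\<in>tcells0 T. \<forall>B\<in>tcells0 T. \<forall>C\<in>tcells0 T.
          (\<forall>X\<in>Ob (tpart T A B (e A B)). \<forall>Y\<in>Ob (tpart T B C (e B C)).
             comp1 E Y X = fst (tcomp T A B C (e B C) (e A B)) (Y, X))
        \<and> (\<forall>f\<in>Ar (tpart T A B (e A B)). \<forall>g\<in>Ar (tpart T B C (e B C)).
             hcomp E g f = snd (tcomp T A B C (e B C) (e A B)) (g, f))))"


section \<open>The data \<open>Bimnd\<^sup>T(K)\<close>\<close>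

text \<open>A 0-cell \<open>(A, F, (\<lambda>\<^sub>\<alpha>)\<^sub>\<alpha>)\<close> is a pair \<open>(S, \<Lambda>)\<close> with \<open>\<Lambda> \<alpha> = \<lambda>\<^sub>\<alpha>\<close>.\<close>

type_synonym ('o, 'm, 'c) bimndT = "('o, 'm, 'c) monad_comonad \<times> ('c \<Rightarrow> 'c)"

definition part_at :: "('o, 'm, 'c) bimndT \<Rightarrow> 'c \<Rightarrow> ('o, 'm, 'c) bimnd" where
  "part_at F \<alpha> = (fst F, snd F \<alpha>)"

context
  fixes K :: "('o, 'm, 'c) two_cat" (structure)
begin

definition unit_part :: "('o, 'm, 'c) bimndT \<Rightarrow> ('o, 'm, 'c) bimnd" where
  "unit_part F = part_at F (id2 K (endo (fst F)))"

definition autT :: "('o, 'm, 'c) bimndT \<Rightarrow> 'c monoid" where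
  "autT F = Aut0 K (unit_part F)"

definition bimndT_cells0 :: "('o, 'm, 'c) bimndT set" where
  "bimndT_cells0 = {F. let S = fst F; \<Lambda> = snd F; G = autT F in
     is_bimonad K (unit_part F) \<and> \<Lambda> \<in> extensional (carrier G)
     \<and> (\<forall>\<alpha>\<in>carrier G. mnd_1cell K S S (endo S) (\<Lambda> \<alpha>) \<and> comnd_1cell K S S (endo S) (\<Lambda> \<alpha>))
     \<and> (\<forall>\<alpha>\<in>carrier G. \<forall>\<beta>\<in>carrier G.
          \<Lambda> (\<alpha> \<otimes>\<^bsub>G\<^esub> \<beta>) = (\<alpha> \<star> inv\<^bsub>G\<^esub> \<beta>) \<bullet> \<Lambda> \<one>\<^bsub>G\<^esub> \<bullet> (\<beta> \<star> inv\<^bsub>G\<^esub> \<alpha>))}"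

end

context
  fixes K :: "('o, 'm, 'c) two_cat" (structure)
    and jb :: "('o, 'm, 'c) bimnd \<Rightarrow> ('o, 'm, 'c) bimnd \<Rightarrow> 'c \<Rightarrow> 'c"
begin

text \<open>\<open>fus F F'\<close> is \<open>j\<^bsub>F,F'\<^esub>\<close>, so its inverse is \<open>fus F' F\<close>.\<close>

definition fus :: "('o, 'm, 'c) bimndT \<Rightarrow> ('o, 'm, 'c) bimndT \<Rightarrow> 'c \<Rightarrow> 'c" where
  "fus F F' = jb (unit_part K F) (unit_part K F')"

definition bimndT_grp :: "('o, 'm, 'c) bimndT \<Rightarrow> ('o, 'm, 'c) bimndT \<Rightarrow> ('c \<times> 'c) monoid" where
  "bimndT_grp F F' = (let G = autT K F; G' = autT K F' in
     if G \<cong> G' then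
       \<lparr> carrier = carrier G' \<times> carrier G,
         monoid.mult = (\<lambda>(\<alpha>, \<beta>) (\<gamma>, \<delta>).
           (\<alpha> \<otimes>\<^bsub>G'\<^esub> \<gamma>, \<delta> \<otimes>\<^bsub>G\<^esub> fus F' F (inv\<^bsub>G'\<^esub> \<gamma>) \<otimes>\<^bsub>G\<^esub> \<beta> \<otimes>\<^bsub>G\<^esub> fus F' F \<gamma>)),
         one = (\<one>\<^bsub>G'\<^esub>, \<one>\<^bsub>G\<^esub>) \<rparr>
     else
       \<lparr> carrier = {(\<one>\<^bsub>G'\<^esub>, \<one>\<^bsub>G\<^esub>)}, monoid.mult = (\<lambda>_ _. (\<one>\<^bsub>G'\<^esub>, \<one>\<^bsub>G\<^esub>)),
         one = (\<one>\<^bsub>G'\<^esub>, \<one>\<^bsub>G\<^esub>) \<rparr>)"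

text \<open>If the three groups are not mutually isomorphic, product and projections are constant.\<close>

definition bimndT_mult :: "('o, 'm, 'c) bimndT \<Rightarrow> ('o, 'm, 'c) bimndT \<Rightarrow> ('o, 'm, 'c) bimndT
    \<Rightarrow> 'c \<times> 'c \<Rightarrow> 'c \<times> 'c \<Rightarrow> 'c \<times> 'c" where
  "bimndT_mult F F' F'' = (\<lambda>(\<alpha>, \<beta>) (\<gamma>, \<delta>). let G = autT K F; G' = autT K F'; G'' = autT K F'' in
     if G \<cong> G' \<and> G' \<cong> G'' then
       (\<alpha> \<otimes>\<^bsub>G''\<^esub> fus F' F'' \<gamma>, \<delta> \<otimes>\<^bsub>G\<^esub> fus F' F (inv\<^bsub>G'\<^esub> \<gamma> \<otimes>\<^bsub>G'\<^esub> \<beta> \<otimes>\<^bsub>G'\<^esub> \<gamma>))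
     else \<one>\<^bsub>bimndT_grp F F''\<^esub>)"

definition bimndT_pr1 :: "('o, 'm, 'c) bimndT \<Rightarrow> ('o, 'm, 'c) bimndT \<Rightarrow> ('o, 'm, 'c) bimndT
    \<Rightarrow> 'c \<times> 'c \<Rightarrow> 'c \<times> 'c" where
  "bimndT_pr1 F F' F'' = (\<lambda>(\<alpha>, \<beta>).
     if autT K F \<cong> autT K F' \<and> autT K F' \<cong> autT K F'' then (\<alpha>, fus F F' \<beta>)
     else \<one>\<^bsub>bimndT_grp F' F''\<^esub>)"

definition bimndT_pr2 :: "('o, 'm, 'c) bimndT \<Rightarrow> ('o, 'm, 'c) bimndT \<Rightarrow> ('o, 'm, 'c) bimndT
    \<Rightarrow> 'c \<times> 'c \<Rightarrow> 'c \<times> 'c" where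
  "bimndT_pr2 F F' F'' = (\<lambda>(\<alpha>, \<beta>).
     if autT K F \<cong> autT K F' \<and> autT K F' \<cong> autT K F'' then (fus F'' F' \<alpha>, \<beta>)
     else \<one>\<^bsub>bimndT_grp F F'\<^esub>)"

definition bimndT_part :: "('o, 'm, 'c) bimndT \<Rightarrow> ('o, 'm, 'c) bimndT \<Rightarrow> 'c \<times> 'c
    \<Rightarrow> (('o, 'm, 'c) bimnd_1cell, ('o, 'm, 'c) bimnd_2cell) cat" where
  "bimndT_part F F' = (\<lambda>(\<alpha>, \<beta>).
     let C = bimnd_hom_cat K (part_at F \<beta>) (part_at F' \<alpha>) in
     if autT K F \<cong> autT K F' then C else C\<lparr> Ob := {}, Ar := {} \<rparr>)"

text \<open>\<open>psi_twist F F' \<omega> Y \<psi>\<close> is \<open>\<psi>\<^sup>\<omega>\<close> for \<open>Y\<close> from \<open>F\<close> to \<open>F'\<close> and \<open>\<omega>\<close> in \<open>G'\<close>, and \<open>phi_twist F F' \<sigma> Y \<phi>\<close>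
  is \<open>\<phi>\<^sup>\<sigma>\<close> for \<open>\<sigma>\<close> in \<open>G\<close>.\<close>

definition psi_twist ::
  "('o, 'm, 'c) bimndT \<Rightarrow> ('o, 'm, 'c) bimndT \<Rightarrow> 'c \<Rightarrow> 'm \<Rightarrow> 'c \<Rightarrow> 'c" where
  "psi_twist F F' \<omega> Y \<psi> = (Y \<triangleright> fus F' F (inv\<^bsub>autT K F'\<^esub> \<omega>)) \<bullet> \<psi> \<bullet> (\<omega> \<triangleleft> Y)"

definition phi_twist ::
  "('o, 'm, 'c) bimndT \<Rightarrow> ('o, 'm, 'c) bimndT \<Rightarrow> 'c \<Rightarrow> 'm \<Rightarrow> 'c \<Rightarrow> 'c" where
  "phi_twist F F' \<sigma> Y \<phi> = (fus F F' (inv\<^bsub>autT K F\<^esub> \<sigma>) \<triangleleft> Y) \<bullet> \<phi> \<bullet> (Y \<triangleright> \<sigma>)"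

definition bimndT_comp1 :: "('o, 'm, 'c) bimndT \<Rightarrow> ('o, 'm, 'c) bimndT \<Rightarrow> ('o, 'm, 'c) bimndT
    \<Rightarrow> 'c \<times> 'c \<Rightarrow> 'c \<times> 'c \<Rightarrow> ('o, 'm, 'c) bimnd_1cell \<Rightarrow> ('o, 'm, 'c) bimnd_1cell
    \<Rightarrow> ('o, 'm, 'c) bimnd_1cell" where
  "bimndT_comp1 F F' F'' = (\<lambda>(\<alpha>, \<beta>) (\<gamma>, \<delta>) (_, (X, \<psi>\<^sub>X, \<phi>\<^sub>X), _) (_, (Y, \<psi>\<^sub>Y, \<phi>\<^sub>Y), _).
     let G' = autT K F';
         \<psi>\<^sub>X' = (X \<triangleright> inv\<^bsub>G'\<^esub> \<gamma>) \<bullet> \<psi>\<^sub>X \<bullet> (fus F' F'' \<gamma> \<triangleleft> X);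
         \<psi>\<^sub>Y' = psi_twist F F' (inv\<^bsub>G'\<^esub> \<gamma> \<otimes>\<^bsub>G'\<^esub> \<beta> \<otimes>\<^bsub>G'\<^esub> \<gamma>) Y \<psi>\<^sub>Y;
         (\<alpha>', \<delta>') = bimndT_mult F F' F'' (\<alpha>, \<beta>) (\<gamma>, \<delta>)
     in (part_at F \<delta>', (X \<cdot> Y, (X \<triangleright> \<psi>\<^sub>Y') \<bullet> (\<psi>\<^sub>X' \<triangleleft> Y), (\<phi>\<^sub>X \<triangleleft> Y) \<bullet> (X \<triangleright> \<phi>\<^sub>Y)), part_at F'' \<alpha>'))"

definition bimndT_comp :: "('o, 'm, 'c) bimndT \<Rightarrow> ('o, 'm, 'c) bimndT \<Rightarrow> ('o, 'm, 'c) bimndT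
    \<Rightarrow> 'c \<times> 'c \<Rightarrow> 'c \<times> 'c
    \<Rightarrow> (('o, 'm, 'c) bimnd_1cell \<times> ('o, 'm, 'c) bimnd_1cell \<Rightarrow> ('o, 'm, 'c) bimnd_1cell)
      \<times> (('o, 'm, 'c) bimnd_2cell \<times> ('o, 'm, 'c) bimnd_2cell \<Rightarrow> ('o, 'm, 'c) bimnd_2cell)" where
  "bimndT_comp F F' F'' b a =
     (\<lambda>(x, y). bimndT_comp1 F F' F'' b a x y,
      \<lambda>((x, \<xi>, x'), (y, \<zeta>, y')).
        (bimndT_comp1 F F' F'' b a x y, \<xi> \<star> \<zeta>, bimndT_comp1 F F' F'' b a x' y'))"

text \<open>\<open>\<phi>\<^bsub>(\<alpha>,\<beta>)\<^esub>\<close> on an object of degree \<open>(\<gamma>, \<delta>)\<close>; the degree of the result is the conjugate of \<open>(\<gamma>, \<delta>)\<close>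
  by \<open>(\<alpha>, \<beta>)\<close>.\<close>

definition bimndT_act0 :: "('o, 'm, 'c) bimndT \<Rightarrow> ('o, 'm, 'c) bimndT \<Rightarrow> 'c \<times> 'c
    \<Rightarrow> 'c \<times> 'c \<Rightarrow> ('o, 'm, 'c) bimnd_1cell \<Rightarrow> ('o, 'm, 'c) bimnd_1cell" where
  "bimndT_act0 F F' = (\<lambda>(\<alpha>, \<beta>) (\<gamma>, \<delta>) (_, (Y, \<psi>, \<phi>), _).
     let G = autT K F; G' = autT K F'; GG = bimndT_grp F F';
         \<omega> = inv\<^bsub>G'\<^esub> \<gamma> \<otimes>\<^bsub>G'\<^esub> fus F F' \<beta> \<otimes>\<^bsub>G'\<^esub> \<gamma> \<otimes>\<^bsub>G'\<^esub> inv\<^bsub>G'\<^esub> \<alpha>;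
         \<sigma> = \<beta> \<otimes>\<^bsub>G\<^esub> fus F' F (inv\<^bsub>G'\<^esub> \<alpha>);
         (\<gamma>', \<delta>') = (\<alpha>, \<beta>) \<otimes>\<^bsub>GG\<^esub> (\<gamma>, \<delta>) \<otimes>\<^bsub>GG\<^esub> inv\<^bsub>GG\<^esub> (\<alpha>, \<beta>)
     in (part_at F \<delta>', (Y, psi_twist F F' \<omega> Y \<psi>, phi_twist F F' \<sigma> Y \<phi>), part_at F' \<gamma>'))"

definition bimndT_hom :: "('o, 'm, 'c) bimndT \<Rightarrow> ('o, 'm, 'c) bimndT
    \<Rightarrow> (('c \<times> 'c) \<times> ('o, 'm, 'c) bimnd_1cell, ('c \<times> 'c) \<times> ('o, 'm, 'c) bimnd_2cell) cat" where
  "bimndT_hom F F' = disj_union_cat (carrier (bimndT_grp F F')) (bimndT_part F F')"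

definition bimndT_act :: "('o, 'm, 'c) bimndT \<Rightarrow> ('o, 'm, 'c) bimndT \<Rightarrow> 'c \<times> 'c
    \<Rightarrow> (('c \<times> 'c) \<times> ('o, 'm, 'c) bimnd_1cell \<Rightarrow> ('c \<times> 'c) \<times> ('o, 'm, 'c) bimnd_1cell)
      \<times> (('c \<times> 'c) \<times> ('o, 'm, 'c) bimnd_2cell \<Rightarrow> ('c \<times> 'c) \<times> ('o, 'm, 'c) bimnd_2cell)" where
  "bimndT_act F F' a = (let GG = bimndT_grp F F'; conj = (\<lambda>c. a \<otimes>\<^bsub>GG\<^esub> c \<otimes>\<^bsub>GG\<^esub> inv\<^bsub>GG\<^esub> a) in
     (\<lambda>(c, y)\<in>Ob (bimndT_hom F F'). (conj c, bimndT_act0 F F' a c y),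
      \<lambda>(c, (y, \<zeta>, z))\<in>Ar (bimndT_hom F F').
        (conj c, (bimndT_act0 F F' a c y, \<zeta>, bimndT_act0 F F' a c z))))"

definition BimndT :: "('o, 'm, 'c) bimndT set \<Rightarrow>
    (('o, 'm, 'c) bimndT, 'c \<times> 'c, ('o, 'm, 'c) bimnd_1cell, ('o, 'm, 'c) bimnd_2cell) turaev_data" where
  "BimndT I =
     \<lparr> tcells0 = I,
       tgrp = bimndT_grp, tmult = bimndT_mult, tpr1 = bimndT_pr1, tpr2 = bimndT_pr2,
       tpart = bimndT_part, tact = bimndT_act,
       tid = (\<lambda>F. bimnd_id1 K (unit_part K F)), tcomp = bimndT_comp \<rparr>"

end

end

theory Submission
  imports Defs
begin

text \<open>
  Monads, comonads and a 2-cell \<open>\<lambda>\<close> on a common endo-1-cell form a 2-category even without the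
  bimonad axioms, and all the 1-cells \<open>(F, \<lambda>\<^sub>\<alpha>)\<close> are 0-cells of it. For \<open>\<sigma>, \<omega>\<close> in \<open>G(F)\<close> the
  identity of the base, with \<open>\<psi> = \<omega>\<close> and \<open>\<phi> = \<sigma>\<close>, is an invertible 1-cell
  \<open>F\<^sub>\<alpha> \<rightarrow> F\<^bsub>\<sigma>\<alpha>\<omega>\<^esub>\<close>, because the 0-automorphisms commute with all the structure 2-cells. Hence passing
  from \<open>(Y, \<psi>, \<phi>)\<close> to \<open>(Y, \<psi>\<^sup>\<omega>, \<phi>\<^sup>\<sigma>)\<close> is composition with such 1-cells on both sides: twisting is
  functorial and distributes over composition, the two 1-cells inserted in the middle cancelling.
  The composite of \<open>X\<close> and \<open>Y\<close> is the ordinary composite of two twists, and the groups act by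
  twists, so every axiom reduces to an equality of words in the groups \<open>G(F)\<close>, which have a normal
  form once the fusion maps are pushed to the letters.
\<close>

section \<open>Calculating in a strict 2-category\<close>

text \<open>The formulas for composition and action come from matching degrees. With fusion maps
  suppressed, a twist by (\<sigma>, \<omega>) moves degree (\<gamma>, \<delta>) to (\<sigma>^-1
  \<gamma> \<omega>, \<sigma>^-1 \<delta> \<omega>). For X of degree (\<alpha>, \<beta>) and Y of
  degree (\<gamma>, \<delta>) the source degree \<beta> of X and the target degree \<gamma> of Y
  differ in general; twisting X by \<omega> = \<gamma> and Y by \<omega> = \<gamma>^-1 \<beta>
  \<gamma> moves both to \<beta> \<gamma>, and the outer degrees become those of the transitive
  product. Likewise the parameters of the acting functors are those for which the twisted degree is
  the conjugate degree. What makes shifts possible is that \<lambda> commutes with \<omega> \<times>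
  \<omega>, an inverse-free form of the last condition on 0-automorphisms. Non-isomorphic groups are
  the other obstacle. Between them the hom-categories are empty, so laws about cells hold vacuously;
  laws about the groups have to be checked against constant products, and associativity,
  coassociativity and counitality are shown only over classes of 0-cells with mutually isomorphic
  groups.\<close>

context two_category
begin

lemma hom1_iff: "X \<in> hom1 K A B \<longleftrightarrow> X \<in> cells1 K \<and> src1 K X = A \<and> trg1 K X = B"
  by (simp add: hom1_def)

lemma hom2_iff: "\<zeta> \<in> hom2 K X Y \<longleftrightarrow> \<zeta> \<in> cells2 K \<and> src2 K \<zeta> = X \<and> trg2 K \<zeta> = Y"
  by (simp add: hom2_def)

lemma id1_typing:
  assumes "A \<in> cells0 K"
  shows "id1 K A \<in> cells1 K" "src1 K (id1 K A) = A" "trg1 K (id1 K A) = A"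
  using id1_hom1[OF assms] by (auto simp: hom1_iff)

lemma comp1_typing:
  assumes "X \<in> cells1 K" "Y \<in> cells1 K" "trg1 K X = src1 K Y"
  shows "Y \<cdot> X \<in> cells1 K" "src1 K (Y \<cdot> X) = src1 K X" "trg1 K (Y \<cdot> X) = trg1 K Y"
  using comp1_hom1[of X "src1 K X" "trg1 K X" Y "trg1 K Y"] assms by (auto simp: hom1_iff)

lemma comp1_assoc':
  assumes "X \<in> cells1 K" "Y \<in> cells1 K" "Z \<in> cells1 K" "trg1 K X = src1 K Y" "trg1 K Y = src1 K Z"
  shows "Z \<cdot> (Y \<cdot> X) = Z \<cdot> Y \<cdot> X"
  using comp1_assoc[of X "src1 K X" "trg1 K X" Y "trg1 K Y" Z "trg1 K Z"] assms
  by (auto simp: hom1_iff)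

lemma comp1_id1:
  assumes "X \<in> cells1 K"
  shows "trg1 K X = A \<Longrightarrow> id1 K A \<cdot> X = X" "src1 K X = A \<Longrightarrow> X \<cdot> id1 K A = X"
  using comp1_id_left[of X] comp1_id_right[of X] assms by (auto simp: hom1_iff)

lemma id2_typing:
  assumes "X \<in> cells1 K"
  shows "id2 K X \<in> cells2 K" "src2 K (id2 K X) = X" "trg2 K (id2 K X) = X"
  using id2_hom2[OF assms] by (auto simp: hom2_iff)

lemma vcomp_typing:
  assumes "\<zeta> \<in> cells2 K" "\<xi> \<in> cells2 K" "trg2 K \<zeta> = src2 K \<xi>"
  shows "\<xi> \<bullet> \<zeta> \<in> cells2 K" "src2 K (\<xi> \<bullet> \<zeta>) = src2 K \<zeta>" "trg2 K (\<xi> \<bullet> \<zeta>) = trg2 K \<xi>"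
  using vcomp_hom2[of \<zeta> "src2 K \<zeta>" "trg2 K \<zeta>" \<xi> "trg2 K \<xi>"] assms by (auto simp: hom2_iff)

lemma vcomp_assoc':
  assumes "\<zeta> \<in> cells2 K" "\<xi> \<in> cells2 K" "\<theta> \<in> cells2 K" "trg2 K \<zeta> = src2 K \<xi>" "trg2 K \<xi> = src2 K \<theta>"
  shows "\<theta> \<bullet> \<xi> \<bullet> \<zeta> = \<theta> \<bullet> (\<xi> \<bullet> \<zeta>)"
  using vcomp_assoc[of \<zeta> "src2 K \<zeta>" "trg2 K \<zeta>" \<xi> "trg2 K \<xi>" \<theta> "trg2 K \<theta>"] assms
  by (auto simp: hom2_iff)

lemma vcomp_id2:
  assumes "\<zeta> \<in> cells2 K"
  shows "trg2 K \<zeta> = X \<Longrightarrow> id2 K X \<bullet> \<zeta> = \<zeta>" "src2 K \<zeta> = X \<Longrightarrow> \<zeta> \<bullet> id2 K X = \<zeta>"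
  using vcomp_id_left[of \<zeta>] vcomp_id_right[of \<zeta>] assms by (auto simp: hom2_iff)

lemma hcomp_typing:
  assumes "\<zeta> \<in> cells2 K" "\<xi> \<in> cells2 K" "trg1 K (src2 K \<zeta>) = src1 K (src2 K \<xi>)"
  shows "\<xi> \<star> \<zeta> \<in> cells2 K" "src2 K (\<xi> \<star> \<zeta>) = src2 K \<xi> \<cdot> src2 K \<zeta>"
    "trg2 K (\<xi> \<star> \<zeta>) = trg2 K \<xi> \<cdot> trg2 K \<zeta>"
  using hcomp_hom2[of \<zeta> "src2 K \<zeta>" "trg2 K \<zeta>" \<xi> "src2 K \<xi>" "trg2 K \<xi>"] assms
  by (auto simp: hom2_iff)

lemma hcomp_assoc':
  assumes "\<zeta> \<in> cells2 K" "\<xi> \<in> cells2 K" "\<theta> \<in> cells2 K"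
    "trg1 K (src2 K \<zeta>) = src1 K (src2 K \<xi>)" "trg1 K (src2 K \<xi>) = src1 K (src2 K \<theta>)"
  shows "\<theta> \<star> (\<xi> \<star> \<zeta>) = \<theta> \<star> \<xi> \<star> \<zeta>"
  using hcomp_assoc[of \<zeta> "src2 K \<zeta>" "trg2 K \<zeta>" \<xi> "src2 K \<xi>" "trg2 K \<xi>" \<theta> "src2 K \<theta>" "trg2 K \<theta>"]
    assms by (auto simp: hom2_iff)

lemma hcomp_id2':
  assumes "X \<in> cells1 K" "Y \<in> cells1 K" "trg1 K X = src1 K Y"
  shows "id2 K Y \<star> id2 K X = id2 K (Y \<cdot> X)"
  using hcomp_id2[of X "src1 K X" "trg1 K X" Y "trg1 K Y"] assms by (auto simp: hom1_iff)

lemma hcomp_id2_id1: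
  assumes "\<zeta> \<in> cells2 K"
  shows "trg1 K (src2 K \<zeta>) = A \<Longrightarrow> id2 K (id1 K A) \<star> \<zeta> = \<zeta>"
    "src1 K (src2 K \<zeta>) = A \<Longrightarrow> \<zeta> \<star> id2 K (id1 K A) = \<zeta>"
  using hcomp_id_left[of "src2 K \<zeta>" "src1 K (src2 K \<zeta>)" A \<zeta> "trg2 K \<zeta>"]
    hcomp_id_right[of "src2 K \<zeta>" A "trg1 K (src2 K \<zeta>)" \<zeta> "trg2 K \<zeta>"] assms src2_cells1[OF assms]
  by (auto simp: hom1_iff hom2_iff)

lemma interchange':
  assumes "\<zeta> \<in> cells2 K" "\<zeta>' \<in> cells2 K" "\<xi> \<in> cells2 K" "\<xi>' \<in> cells2 K"
    "trg2 K \<zeta> = src2 K \<zeta>'" "trg2 K \<xi> = src2 K \<xi>'" "trg1 K (src2 K \<zeta>) = src1 K (src2 K \<xi>)"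
  shows "(\<xi>' \<star> \<zeta>') \<bullet> (\<xi> \<star> \<zeta>) = (\<xi>' \<bullet> \<xi>) \<star> (\<zeta>' \<bullet> \<zeta>)"
  using interchange[of \<zeta> "src2 K \<zeta>" "trg2 K \<zeta>" \<zeta>' "trg2 K \<zeta>'" \<xi> "src2 K \<xi>" "trg2 K \<xi>" \<xi>' "trg2 K \<xi>'"]
    assms by (auto simp: hom2_iff)

lemma hcomp_id2_id2:
  assumes "\<zeta> \<in> cells2 K" "X \<in> cells1 K" "Y \<in> cells1 K" "trg1 K X = src1 K (src2 K \<zeta>)"
    "trg1 K Y = src1 K X"
  shows "\<zeta> \<star> id2 K X \<star> id2 K Y = \<zeta> \<star> id2 K (X \<cdot> Y)"
  using hcomp_assoc'[of "id2 K Y" "id2 K X" \<zeta>] assms by (simp add: id2_typing hcomp_id2')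

lemma whisker_left_vcomp:
  assumes "\<zeta> \<in> cells2 K" "\<xi> \<in> cells2 K" "X \<in> cells1 K" "trg2 K \<zeta> = src2 K \<xi>"
    "trg1 K (src2 K \<zeta>) = src1 K X"
  shows "X \<triangleright> (\<xi> \<bullet> \<zeta>) = (X \<triangleright> \<xi>) \<bullet> (X \<triangleright> \<zeta>)"
  using interchange'[of \<zeta> \<xi> "id2 K X" "id2 K X"] assms by (simp add: id2_typing vcomp_id2)

lemma whisker_right_vcomp:
  assumes "\<zeta> \<in> cells2 K" "\<xi> \<in> cells2 K" "X \<in> cells1 K" "trg2 K \<zeta> = src2 K \<xi>"
    "trg1 K X = src1 K (src2 K \<zeta>)"
  shows "(\<xi> \<bullet> \<zeta>) \<triangleleft> X = (\<xi> \<triangleleft> X) \<bullet> (\<zeta> \<triangleleft> X)"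
  using interchange'[of "id2 K X" "id2 K X" \<zeta> \<xi>] assms by (simp add: id2_typing vcomp_id2)

text \<open>By interchange, both orders of pasting two cells that act on different factors equal
  \<xi> \<star> \<zeta>. The first equation has no preferred direction, so it is kept out of the
  rewrite rules and applied by hand.\<close>

lemma slide:
  assumes "\<zeta> \<in> cells2 K" "\<xi> \<in> cells2 K" "src2 K \<zeta> = X" "trg2 K \<zeta> = X'" "src2 K \<xi> = Y" "trg2 K \<xi> = Y'"
    "trg1 K X = src1 K Y"
  shows "(Y' \<triangleright> \<zeta>) \<bullet> (\<xi> \<triangleleft> X) = (\<xi> \<triangleleft> X') \<bullet> (Y \<triangleright> \<zeta>)"
    "(\<xi> \<triangleleft> X') \<bullet> (Y \<triangleright> \<zeta>) = \<xi> \<star> \<zeta>"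
proof -
  have c: "X \<in> cells1 K" "X' \<in> cells1 K" "Y \<in> cells1 K" "Y' \<in> cells1 K"
    using assms src2_cells1 trg2_cells1 by auto
  have t: "trg1 K X' = trg1 K X" "src1 K Y' = src1 K Y"
    using parallel_trg[of \<zeta>] parallel_src[of \<xi>] assms by auto
  show "(\<xi> \<triangleleft> X') \<bullet> (Y \<triangleright> \<zeta>) = \<xi> \<star> \<zeta>"
    using assms c t by (subst interchange') (auto simp: id2_typing vcomp_id2)
  moreover have "(Y' \<triangleright> \<zeta>) \<bullet> (\<xi> \<triangleleft> X) = \<xi> \<star> \<zeta>"
    using assms c t by (subst interchange') (auto simp: id2_typing vcomp_id2)
  ultimately show "(Y' \<triangleright> \<zeta>) \<bullet> (\<xi> \<triangleleft> X) = (\<xi> \<triangleleft> X') \<bullet> (Y \<triangleright> \<zeta>)" by simp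
qed

text \<open>Composites are nested to the right, so the left-hand side of an equation for
  \<open>a \<bullet> b\<close> does not occur as a subterm when something follows it. This form
  applies the equation at the head of a longer composite.\<close>

lemma vcomp_rest:
  assumes "a \<bullet> b = c" "a \<in> cells2 K" "b \<in> cells2 K" "d \<in> cells2 K" "trg2 K b = src2 K a"
    "trg2 K d = src2 K b"
  shows "a \<bullet> (b \<bullet> d) = c \<bullet> d"
  using vcomp_assoc'[of d b a] assms by simp

text \<open>Rewrite rules whose side conditions compute sources and targets, so that the simplifier need not guess
  intermediate cells. \<open>normal_form\<close> turns every pasting into a right-nested vertical composite of
  whiskered 2-cells \<open>(X \<triangleright> \<zeta>) \<triangleleft> Y\<close>.\<close>

lemmas typing = id1_typing comp1_typing comp1_id1 id2_typing vcomp_typing vcomp_id2 hcomp_typing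
  hcomp_id2' hcomp_id2_id1 comp1_assoc'
lemmas normal_form = typing vcomp_assoc' hcomp_assoc' hcomp_id2_id2 whisker_left_vcomp
  whisker_right_vcomp

section \<open>Composition of 1-cells over monads and comonads\<close>

text \<open>That 1-cells compose rests on the axioms of the 1-cells themselves; of the (co)monads
  between which they run only sources and targets enter.\<close>

definition typed_structure :: "('o, 'm, 'c) monad_comonad \<Rightarrow> bool" where
  "typed_structure S \<longleftrightarrow> base S \<in> cells0 K \<and> endo S \<in> hom1 K (base S) (base S)
     \<and> mu S \<in> hom2 K (endo S \<cdot> endo S) (endo S) \<and> eta S \<in> hom2 K (id1 K (base S)) (endo S)
     \<and> Delta S \<in> hom2 K (endo S) (endo S \<cdot> endo S) \<and> eps S \<in> hom2 K (endo S) (id1 K (base S))"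

lemma typed_structureD:
  assumes "typed_structure S"
  shows "base S \<in> cells0 K" "endo S \<in> cells1 K" "src1 K (endo S) = base S" "trg1 K (endo S) = base S"
    "mu S \<in> cells2 K" "src2 K (mu S) = endo S \<cdot> endo S" "trg2 K (mu S) = endo S"
    "eta S \<in> cells2 K" "src2 K (eta S) = id1 K (base S)" "trg2 K (eta S) = endo S"
    "Delta S \<in> cells2 K" "src2 K (Delta S) = endo S" "trg2 K (Delta S) = endo S \<cdot> endo S"
    "eps S \<in> cells2 K" "src2 K (eps S) = endo S" "trg2 K (eps S) = id1 K (base S)"
  using assms by (auto simp: typed_structure_def hom1_iff hom2_iff)

lemma mnd_1cellD:
  assumes "mnd_1cell K S S' X \<psi>"
  shows "X \<in> cells1 K" "src1 K X = base S" "trg1 K X = base S'"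
    "\<psi> \<in> cells2 K" "src2 K \<psi> = endo S' \<cdot> X" "trg2 K \<psi> = X \<cdot> endo S"
    "(X \<triangleright> mu S) \<bullet> (\<psi> \<triangleleft> endo S) \<bullet> (endo S' \<triangleright> \<psi>) = \<psi> \<bullet> (mu S' \<triangleleft> X)"
    "\<psi> \<bullet> (eta S' \<triangleleft> X) = X \<triangleright> eta S"
  using assms by (auto simp: mnd_1cell_def Let_def hom1_iff hom2_iff)

lemma comnd_1cellD:
  assumes "comnd_1cell K S S' X \<phi>"
  shows "X \<in> cells1 K" "src1 K X = base S" "trg1 K X = base S'"
    "\<phi> \<in> cells2 K" "src2 K \<phi> = X \<cdot> endo S" "trg2 K \<phi> = endo S' \<cdot> X"
    "(endo S' \<triangleright> \<phi>) \<bullet> (\<phi> \<triangleleft> endo S) \<bullet> (X \<triangleright> Delta S) = (Delta S' \<triangleleft> X) \<bullet> \<phi>"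
    "(eps S' \<triangleleft> X) \<bullet> \<phi> = X \<triangleright> eps S"
  using assms by (auto simp: comnd_1cell_def Let_def hom1_iff hom2_iff)

text \<open>The multiplication passes the pasting in two stages: the axiom of Y is applied under
  \<open>X \<triangleright> _\<close> and leaves \<open>mu S'\<close> in the middle, then the axiom
  of X is applied under \<open>_ \<triangleleft> Y\<close>. The unit meets X before Y.\<close>

lemma mnd_1cell_comp:
  assumes S: "typed_structure S" "typed_structure S'" "typed_structure S''"
    and X: "mnd_1cell K S' S'' X \<psi>" and Y: "mnd_1cell K S S' Y \<psi>'"
  shows "mnd_1cell K S S'' (X \<cdot> Y) ((X \<triangleright> \<psi>') \<bullet> (\<psi> \<triangleleft> Y))"
proof -
  let ?F = "endo S" and ?F' = "endo S'" and ?F'' = "endo S''"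
  note t = S[THEN typed_structureD(1)] S[THEN typed_structureD(2)] S[THEN typed_structureD(3)]
    S[THEN typed_structureD(4)] S[THEN typed_structureD(5)] S[THEN typed_structureD(6)]
    S[THEN typed_structureD(7)] S[THEN typed_structureD(8)] S[THEN typed_structureD(9)]
    S[THEN typed_structureD(10)] mnd_1cellD(1-6)[OF X] mnd_1cellD(1-6)[OF Y]
  note n = normal_form t
  \<comment> \<open>The one rearrangement beyond the normal form: \<psi> and \<psi>' act on
    different factors and change places, which brings the two copies of \<psi>' together, and
    likewise those of \<psi>.\<close>
  have s: "(\<psi> \<triangleleft> (Y \<cdot> ?F)) \<bullet> (((?F'' \<cdot> X) \<triangleright> \<psi>') \<bullet> ((?F'' \<triangleright> \<psi>) \<triangleleft> Y))
      = ((X \<cdot> ?F') \<triangleright> \<psi>') \<bullet> ((\<psi> \<triangleleft> (?F' \<cdot> Y)) \<bullet> ((?F'' \<triangleright> \<psi>) \<triangleleft> Y))"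
    by (subst vcomp_rest[OF slide(1)[of \<psi>' \<psi> "?F' \<cdot> Y" "Y \<cdot> ?F" "?F'' \<cdot> X" "X \<cdot> ?F'", symmetric]]) (simp_all add: n)
  let ?\<psi> = "(X \<triangleright> \<psi>') \<bullet> (\<psi> \<triangleleft> Y)"
  have "((X \<cdot> Y) \<triangleright> mu S) \<bullet> (?\<psi> \<triangleleft> ?F) \<bullet> (?F'' \<triangleright> ?\<psi>)
      = (X \<triangleright> ((Y \<triangleright> mu S) \<bullet> (\<psi>' \<triangleleft> ?F) \<bullet> (?F' \<triangleright> \<psi>'))) \<bullet> (((\<psi> \<triangleleft> ?F') \<bullet> (?F'' \<triangleright> \<psi>)) \<triangleleft> Y)"
    by (simp add: n s)
  also have "\<dots> = (X \<triangleright> (\<psi>' \<bullet> (mu S' \<triangleleft> Y))) \<bullet> (((\<psi> \<triangleleft> ?F') \<bullet> (?F'' \<triangleright> \<psi>)) \<triangleleft> Y)"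
    by (simp only: mnd_1cellD(7)[OF Y])
  also have "\<dots> = (X \<triangleright> \<psi>') \<bullet> (((X \<triangleright> mu S') \<bullet> (\<psi> \<triangleleft> ?F') \<bullet> (?F'' \<triangleright> \<psi>)) \<triangleleft> Y)"
    by (simp add: n)
  also have "\<dots> = (X \<triangleright> \<psi>') \<bullet> ((\<psi> \<bullet> (mu S'' \<triangleleft> X)) \<triangleleft> Y)"
    by (simp only: mnd_1cellD(7)[OF X])
  also have "\<dots> = ?\<psi> \<bullet> (mu S'' \<triangleleft> (X \<cdot> Y))"
    by (simp add: n)
  finally have 1: "((X \<cdot> Y) \<triangleright> mu S) \<bullet> (?\<psi> \<triangleleft> ?F) \<bullet> (?F'' \<triangleright> ?\<psi>) = ?\<psi> \<bullet> (mu S'' \<triangleleft> (X \<cdot> Y))" .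
  have "?\<psi> \<bullet> (eta S'' \<triangleleft> (X \<cdot> Y)) = (X \<triangleright> \<psi>') \<bullet> ((\<psi> \<bullet> (eta S'' \<triangleleft> X)) \<triangleleft> Y)"
    by (simp add: n)
  also have "\<dots> = (X \<triangleright> \<psi>') \<bullet> ((X \<triangleright> eta S') \<triangleleft> Y)"
    by (simp only: mnd_1cellD(8)[OF X])
  also have "\<dots> = X \<triangleright> (\<psi>' \<bullet> (eta S' \<triangleleft> Y))"
    by (simp add: n)
  also have "\<dots> = X \<triangleright> Y \<triangleright> eta S"
    by (simp only: mnd_1cellD(8)[OF Y])
  also have "\<dots> = (X \<cdot> Y) \<triangleright> eta S"
    by (simp add: n)
  finally have 2: "?\<psi> \<bullet> (eta S'' \<triangleleft> (X \<cdot> Y)) = (X \<cdot> Y) \<triangleright> eta S" .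
  show ?thesis
    unfolding mnd_1cell_def Let_def using 1 2 by (simp add: hom1_iff hom2_iff typing t)
qed

text \<open>Dual to \<open>mnd_1cell_comp\<close>: reversing the 2-cells exchanges \<psi> with
  \<phi> and multiplication with comultiplication. Again one exchange of independent cells is the
  crucial step.\<close>

lemma comnd_1cell_comp:
  assumes S: "typed_structure S" "typed_structure S'" "typed_structure S''"
    and X: "comnd_1cell K S' S'' X \<phi>" and Y: "comnd_1cell K S S' Y \<phi>'"
  shows "comnd_1cell K S S'' (X \<cdot> Y) ((\<phi> \<triangleleft> Y) \<bullet> (X \<triangleright> \<phi>'))"
proof -
  let ?F = "endo S" and ?F' = "endo S'" and ?F'' = "endo S''"
  note t = S[THEN typed_structureD(1)] S[THEN typed_structureD(2)] S[THEN typed_structureD(3)]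
    S[THEN typed_structureD(4)] S[THEN typed_structureD(11)] S[THEN typed_structureD(12)]
    S[THEN typed_structureD(13)] S[THEN typed_structureD(14)] S[THEN typed_structureD(15)]
    S[THEN typed_structureD(16)] comnd_1cellD(1-6)[OF X] comnd_1cellD(1-6)[OF Y]
  note n = normal_form t
  have s: "((?F'' \<cdot> X) \<triangleright> \<phi>') \<bullet> ((\<phi> \<triangleleft> (Y \<cdot> ?F)) \<bullet> (((X \<triangleright> \<phi>') \<triangleleft> ?F) \<bullet> ((X \<cdot> Y) \<triangleright> Delta S)))
      = (\<phi> \<triangleleft> (?F' \<cdot> Y)) \<bullet> (((X \<cdot> ?F') \<triangleright> \<phi>') \<bullet> (((X \<triangleright> \<phi>') \<triangleleft> ?F) \<bullet> ((X \<cdot> Y) \<triangleright> Delta S)))"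
    by (subst vcomp_rest[OF slide(1)[of \<phi>' \<phi> "Y \<cdot> ?F" "?F' \<cdot> Y" "X \<cdot> ?F'" "?F'' \<cdot> X"]]) (simp_all add: n)
  let ?\<phi> = "(\<phi> \<triangleleft> Y) \<bullet> (X \<triangleright> \<phi>')"
  have "(?F'' \<triangleright> ?\<phi>) \<bullet> (?\<phi> \<triangleleft> ?F) \<bullet> ((X \<cdot> Y) \<triangleright> Delta S)
      = (((?F'' \<triangleright> \<phi>) \<bullet> (\<phi> \<triangleleft> ?F')) \<triangleleft> Y) \<bullet> (X \<triangleright> ((?F' \<triangleright> \<phi>') \<bullet> (\<phi>' \<triangleleft> ?F) \<bullet> (Y \<triangleright> Delta S)))"
    by (simp add: n s)
  also have "\<dots> = (((?F'' \<triangleright> \<phi>) \<bullet> (\<phi> \<triangleleft> ?F')) \<triangleleft> Y) \<bullet> (X \<triangleright> ((Delta S' \<triangleleft> Y) \<bullet> \<phi>'))"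
    by (simp only: comnd_1cellD(7)[OF Y])
  also have "\<dots> = (((?F'' \<triangleright> \<phi>) \<bullet> (\<phi> \<triangleleft> ?F') \<bullet> (X \<triangleright> Delta S')) \<triangleleft> Y) \<bullet> (X \<triangleright> \<phi>')"
    by (simp add: n)
  also have "\<dots> = (((Delta S'' \<triangleleft> X) \<bullet> \<phi>) \<triangleleft> Y) \<bullet> (X \<triangleright> \<phi>')"
    by (simp only: comnd_1cellD(7)[OF X])
  also have "\<dots> = (Delta S'' \<triangleleft> (X \<cdot> Y)) \<bullet> ?\<phi>"
    by (simp add: n)
  finally have 1: "(?F'' \<triangleright> ?\<phi>) \<bullet> (?\<phi> \<triangleleft> ?F) \<bullet> ((X \<cdot> Y) \<triangleright> Delta S) = (Delta S'' \<triangleleft> (X \<cdot> Y)) \<bullet> ?\<phi>" .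
  have "(eps S'' \<triangleleft> (X \<cdot> Y)) \<bullet> ?\<phi> = (((eps S'' \<triangleleft> X) \<bullet> \<phi>) \<triangleleft> Y) \<bullet> (X \<triangleright> \<phi>')"
    by (simp add: n)
  also have "\<dots> = ((X \<triangleright> eps S') \<triangleleft> Y) \<bullet> (X \<triangleright> \<phi>')"
    by (simp only: comnd_1cellD(8)[OF X])
  also have "\<dots> = X \<triangleright> ((eps S' \<triangleleft> Y) \<bullet> \<phi>')"
    by (simp add: n)
  also have "\<dots> = X \<triangleright> Y \<triangleright> eps S"
    by (simp only: comnd_1cellD(8)[OF Y])
  also have "\<dots> = (X \<cdot> Y) \<triangleright> eps S"
    by (simp add: n)
  finally have 2: "(eps S'' \<triangleleft> (X \<cdot> Y)) \<bullet> ?\<phi> = (X \<cdot> Y) \<triangleright> eps S" .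
  show ?thesis
    unfolding comnd_1cell_def Let_def using 1 2 by (simp add: hom1_iff hom2_iff typing t)
qed

text \<open>The compatibility of Y, used under \<open>X \<triangleright> _\<close>, replaces l by l'
  and moves \<psi>' and \<phi>' to the two sides of it. Sliding these past \<phi> and \<psi> then
  frees the left-hand side of the compatibility of X, which turns l' into l''.\<close>

lemma bimnd_compatibility_comp:
  assumes S: "typed_structure S" "typed_structure S'" "typed_structure S''"
    and l: "l \<in> hom2 K (endo S \<cdot> endo S) (endo S \<cdot> endo S)"
      "l' \<in> hom2 K (endo S' \<cdot> endo S') (endo S' \<cdot> endo S')"
      "l'' \<in> hom2 K (endo S'' \<cdot> endo S'') (endo S'' \<cdot> endo S'')"
    and X: "mnd_1cell K S' S'' X \<psi>" "comnd_1cell K S' S'' X \<phi>"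
      "(\<phi> \<triangleleft> endo S') \<bullet> (X \<triangleright> l') \<bullet> (\<psi> \<triangleleft> endo S') = (endo S'' \<triangleright> \<psi>) \<bullet> (l'' \<triangleleft> X) \<bullet> (endo S'' \<triangleright> \<phi>)"
    and Y: "mnd_1cell K S S' Y \<psi>'" "comnd_1cell K S S' Y \<phi>'"
      "(\<phi>' \<triangleleft> endo S) \<bullet> (Y \<triangleright> l) \<bullet> (\<psi>' \<triangleleft> endo S) = (endo S' \<triangleright> \<psi>') \<bullet> (l' \<triangleleft> Y) \<bullet> (endo S' \<triangleright> \<phi>')"
  shows "(((\<phi> \<triangleleft> Y) \<bullet> (X \<triangleright> \<phi>')) \<triangleleft> endo S) \<bullet> ((X \<cdot> Y) \<triangleright> l) \<bullet> (((X \<triangleright> \<psi>') \<bullet> (\<psi> \<triangleleft> Y)) \<triangleleft> endo S)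
    = (endo S'' \<triangleright> ((X \<triangleright> \<psi>') \<bullet> (\<psi> \<triangleleft> Y))) \<bullet> (l'' \<triangleleft> (X \<cdot> Y)) \<bullet> (endo S'' \<triangleright> ((\<phi> \<triangleleft> Y) \<bullet> (X \<triangleright> \<phi>')))"
proof -
  let ?F = "endo S" and ?F' = "endo S'" and ?F'' = "endo S''"
  note t = S[THEN typed_structureD(1)] S[THEN typed_structureD(2)] S[THEN typed_structureD(3)]
    S[THEN typed_structureD(4)] mnd_1cellD(1-6)[OF X(1)] mnd_1cellD(1-6)[OF Y(1)]
    comnd_1cellD(4-6)[OF X(2)] comnd_1cellD(4-6)[OF Y(2)]
    l[unfolded hom2_iff]
  note n = normal_form t
  \<comment> \<open>The two cells stand at the head of a longer composite; \<open>r\<close> is its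
    remainder.\<close>
  have s1: "(\<phi> \<triangleleft> (Y \<cdot> ?F)) \<bullet> (((X \<cdot> ?F') \<triangleright> \<psi>') \<bullet> r) = ((?F'' \<cdot> X) \<triangleright> \<psi>') \<bullet> ((\<phi> \<triangleleft> (?F' \<cdot> Y)) \<bullet> r)"
    if "r \<in> cells2 K" "trg2 K r = X \<cdot> ?F' \<cdot> ?F' \<cdot> Y" for r
    using that by (subst vcomp_rest[OF slide(1)[of \<psi>' \<phi> "?F' \<cdot> Y" "Y \<cdot> ?F" "X \<cdot> ?F'" "?F'' \<cdot> X", symmetric]]) (simp_all add: n)
  have s2: "((X \<cdot> ?F') \<triangleright> \<phi>') \<bullet> (\<psi> \<triangleleft> (Y \<cdot> ?F)) = (\<psi> \<triangleleft> (?F' \<cdot> Y)) \<bullet> ((?F'' \<cdot> X) \<triangleright> \<phi>')"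
    by (rule slide(1)) (simp_all add: n)
  have "(((\<phi> \<triangleleft> Y) \<bullet> (X \<triangleright> \<phi>')) \<triangleleft> ?F) \<bullet> ((X \<cdot> Y) \<triangleright> l) \<bullet> (((X \<triangleright> \<psi>') \<bullet> (\<psi> \<triangleleft> Y)) \<triangleleft> ?F)
      = (\<phi> \<triangleleft> (Y \<cdot> ?F)) \<bullet> (X \<triangleright> ((\<phi>' \<triangleleft> ?F) \<bullet> (Y \<triangleright> l) \<bullet> (\<psi>' \<triangleleft> ?F))) \<bullet> (\<psi> \<triangleleft> (Y \<cdot> ?F))"
    by (simp add: n)
  also have "\<dots> = (\<phi> \<triangleleft> (Y \<cdot> ?F)) \<bullet> (X \<triangleright> ((?F' \<triangleright> \<psi>') \<bullet> (l' \<triangleleft> Y) \<bullet> (?F' \<triangleright> \<phi>'))) \<bullet> (\<psi> \<triangleleft> (Y \<cdot> ?F))"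
    by (simp only: Y(3))
  also have "\<dots> = ((?F'' \<cdot> X) \<triangleright> \<psi>') \<bullet> (((\<phi> \<triangleleft> ?F') \<bullet> (X \<triangleright> l') \<bullet> (\<psi> \<triangleleft> ?F')) \<triangleleft> Y) \<bullet> ((?F'' \<cdot> X) \<triangleright> \<phi>')"
    by (simp add: n s1 s2)
  also have "\<dots> = ((?F'' \<cdot> X) \<triangleright> \<psi>') \<bullet> (((?F'' \<triangleright> \<psi>) \<bullet> (l'' \<triangleleft> X) \<bullet> (?F'' \<triangleright> \<phi>)) \<triangleleft> Y) \<bullet> ((?F'' \<cdot> X) \<triangleright> \<phi>')"
    by (simp only: X(3))
  also have "\<dots> = (?F'' \<triangleright> ((X \<triangleright> \<psi>') \<bullet> (\<psi> \<triangleleft> Y))) \<bullet> (l'' \<triangleleft> (X \<cdot> Y)) \<bullet> (?F'' \<triangleright> ((\<phi> \<triangleleft> Y) \<bullet> (X \<triangleright> \<phi>')))"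
    by (simp add: n)
  finally show ?thesis .
qed

text \<open>\<open>\<xi> \<star> \<zeta>\<close> is kept whole instead of being split into
  whiskerings: interchange brings \<zeta> against \<psi>' first and then \<xi> against \<psi>, so
  that each 2-cell condition is applied exactly once.\<close>

lemma mnd_2cell_hcomp:
  assumes S: "typed_structure S" "typed_structure S'" "typed_structure S''"
    and t2: "mnd_1cell K S' S'' X \<psi>" "mnd_1cell K S' S'' X2 \<psi>2" "mnd_1cell K S S' Y \<psi>'" "mnd_1cell K S S' Y2 \<psi>2'"
    and z: "\<xi> \<in> hom2 K X X2" "\<zeta> \<in> hom2 K Y Y2"
    and X: "(\<xi> \<triangleleft> endo S') \<bullet> \<psi> = \<psi>2 \<bullet> (endo S'' \<triangleright> \<xi>)"
    and Y: "(\<zeta> \<triangleleft> endo S) \<bullet> \<psi>' = \<psi>2' \<bullet> (endo S' \<triangleright> \<zeta>)"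
  shows "((\<xi> \<star> \<zeta>) \<triangleleft> endo S) \<bullet> ((X \<triangleright> \<psi>') \<bullet> (\<psi> \<triangleleft> Y)) = ((X2 \<triangleright> \<psi>2') \<bullet> (\<psi>2 \<triangleleft> Y2)) \<bullet> (endo S'' \<triangleright> (\<xi> \<star> \<zeta>))"
proof -
  let ?F = "endo S" and ?F' = "endo S'" and ?F'' = "endo S''"
  note t = S[THEN typed_structureD(1)] S[THEN typed_structureD(2)] S[THEN typed_structureD(3)]
    S[THEN typed_structureD(4)] t2[THEN mnd_1cellD(1)] t2[THEN mnd_1cellD(2)] t2[THEN mnd_1cellD(3)]
    t2[THEN mnd_1cellD(4)] t2[THEN mnd_1cellD(5)] t2[THEN mnd_1cellD(6)] z[unfolded hom2_iff]
  note n = typing t hcomp_assoc'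
  have "((\<xi> \<star> \<zeta>) \<triangleleft> ?F) \<bullet> ((X \<triangleright> \<psi>') \<bullet> (\<psi> \<triangleleft> Y)) = ((\<xi> \<star> (\<zeta> \<triangleleft> ?F)) \<bullet> (X \<triangleright> \<psi>')) \<bullet> (\<psi> \<triangleleft> Y)"
    by (simp add: n vcomp_assoc')
  also have "(\<xi> \<star> (\<zeta> \<triangleleft> ?F)) \<bullet> (X \<triangleright> \<psi>') = \<xi> \<star> ((\<zeta> \<triangleleft> ?F) \<bullet> \<psi>')"
    by (subst interchange') (simp_all add: n)
  also have "\<dots> = \<xi> \<star> (\<psi>2' \<bullet> (?F' \<triangleright> \<zeta>))"
    by (simp only: Y)
  also have "\<dots> = (X2 \<triangleright> \<psi>2') \<bullet> (\<xi> \<star> (?F' \<triangleright> \<zeta>))"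
    by (subst interchange') (simp_all add: n)
  also have "\<dots> \<bullet> (\<psi> \<triangleleft> Y) = (X2 \<triangleright> \<psi>2') \<bullet> (((\<xi> \<triangleleft> ?F') \<star> \<zeta>) \<bullet> (\<psi> \<triangleleft> Y))"
    by (simp add: n vcomp_assoc')
  also have "((\<xi> \<triangleleft> ?F') \<star> \<zeta>) \<bullet> (\<psi> \<triangleleft> Y) = ((\<xi> \<triangleleft> ?F') \<bullet> \<psi>) \<star> \<zeta>"
    by (subst interchange') (simp_all add: n)
  also have "\<dots> = (\<psi>2 \<bullet> (?F'' \<triangleright> \<xi>)) \<star> \<zeta>"
    by (simp only: X)
  also have "\<dots> = (\<psi>2 \<triangleleft> Y2) \<bullet> ((?F'' \<triangleright> \<xi>) \<star> \<zeta>)"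
    by (subst interchange') (simp_all add: n)
  also have "(X2 \<triangleright> \<psi>2') \<bullet> \<dots> = ((X2 \<triangleright> \<psi>2') \<bullet> (\<psi>2 \<triangleleft> Y2)) \<bullet> (?F'' \<triangleright> (\<xi> \<star> \<zeta>))"
    by (simp add: n vcomp_assoc')
  finally show ?thesis .
qed

lemma comnd_2cell_hcomp:
  assumes S: "typed_structure S" "typed_structure S'" "typed_structure S''"
    and t2: "comnd_1cell K S' S'' X \<phi>" "comnd_1cell K S' S'' X2 \<phi>2" "comnd_1cell K S S' Y \<phi>'" "comnd_1cell K S S' Y2 \<phi>2'"
    and z: "\<xi> \<in> hom2 K X X2" "\<zeta> \<in> hom2 K Y Y2"
    and X: "(endo S'' \<triangleright> \<xi>) \<bullet> \<phi> = \<phi>2 \<bullet> (\<xi> \<triangleleft> endo S')"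
    and Y: "(endo S' \<triangleright> \<zeta>) \<bullet> \<phi>' = \<phi>2' \<bullet> (\<zeta> \<triangleleft> endo S)"
  shows "(endo S'' \<triangleright> (\<xi> \<star> \<zeta>)) \<bullet> ((\<phi> \<triangleleft> Y) \<bullet> (X \<triangleright> \<phi>')) = ((\<phi>2 \<triangleleft> Y2) \<bullet> (X2 \<triangleright> \<phi>2')) \<bullet> ((\<xi> \<star> \<zeta>) \<triangleleft> endo S)"
proof -
  let ?F = "endo S" and ?F' = "endo S'" and ?F'' = "endo S''"
  note t = S[THEN typed_structureD(1)] S[THEN typed_structureD(2)] S[THEN typed_structureD(3)]
    S[THEN typed_structureD(4)] t2[THEN comnd_1cellD(1)] t2[THEN comnd_1cellD(2)] t2[THEN comnd_1cellD(3)]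
    t2[THEN comnd_1cellD(4)] t2[THEN comnd_1cellD(5)] t2[THEN comnd_1cellD(6)] z[unfolded hom2_iff]
  note n = typing t hcomp_assoc'
  have "(?F'' \<triangleright> (\<xi> \<star> \<zeta>)) \<bullet> ((\<phi> \<triangleleft> Y) \<bullet> (X \<triangleright> \<phi>')) = (((?F'' \<triangleright> \<xi>) \<star> \<zeta>) \<bullet> (\<phi> \<triangleleft> Y)) \<bullet> (X \<triangleright> \<phi>')"
    by (simp add: n vcomp_assoc')
  also have "((?F'' \<triangleright> \<xi>) \<star> \<zeta>) \<bullet> (\<phi> \<triangleleft> Y) = ((?F'' \<triangleright> \<xi>) \<bullet> \<phi>) \<star> \<zeta>"
    by (subst interchange') (simp_all add: n)
  also have "\<dots> = (\<phi>2 \<bullet> (\<xi> \<triangleleft> ?F')) \<star> \<zeta>"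
    by (simp only: X)
  also have "\<dots> = (\<phi>2 \<triangleleft> Y2) \<bullet> ((\<xi> \<triangleleft> ?F') \<star> \<zeta>)"
    by (subst interchange') (simp_all add: n)
  also have "\<dots> \<bullet> (X \<triangleright> \<phi>') = (\<phi>2 \<triangleleft> Y2) \<bullet> ((\<xi> \<star> (?F' \<triangleright> \<zeta>)) \<bullet> (X \<triangleright> \<phi>'))"
    by (simp add: n vcomp_assoc')
  also have "(\<xi> \<star> (?F' \<triangleright> \<zeta>)) \<bullet> (X \<triangleright> \<phi>') = \<xi> \<star> ((?F' \<triangleright> \<zeta>) \<bullet> \<phi>')"
    by (subst interchange') (simp_all add: n)
  also have "\<dots> = \<xi> \<star> (\<phi>2' \<bullet> (\<zeta> \<triangleleft> ?F))"
    by (simp only: Y)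
  also have "\<dots> = (X2 \<triangleright> \<phi>2') \<bullet> (\<xi> \<star> (\<zeta> \<triangleleft> ?F))"
    by (subst interchange') (simp_all add: n)
  also have "(\<phi>2 \<triangleleft> Y2) \<bullet> \<dots> = ((\<phi>2 \<triangleleft> Y2) \<bullet> (X2 \<triangleright> \<phi>2')) \<bullet> ((\<xi> \<star> \<zeta>) \<triangleleft> ?F)"
    by (simp add: n vcomp_assoc')
  finally show ?thesis .
qed

end

section \<open>The 2-category of bimonads\<close>

lemma bimnd_1cells_iff:
  "(Q, (X, \<psi>, \<phi>), Q') \<in> bimnd_1cells K P P' \<longleftrightarrow> Q = P \<and> Q' = P'
     \<and> mnd_1cell K (fst P) (fst P') X \<psi> \<and> comnd_1cell K (fst P) (fst P') X \<phi>
     \<and> (\<phi> \<triangleleft>\<^bsub>K\<^esub> endo (fst P)) \<bullet>\<^bsub>K\<^esub> (X \<triangleright>\<^bsub>K\<^esub> snd P) \<bullet>\<^bsub>K\<^esub> (\<psi> \<triangleleft>\<^bsub>K\<^esub> endo (fst P))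
       = (endo (fst P') \<triangleright>\<^bsub>K\<^esub> \<psi>) \<bullet>\<^bsub>K\<^esub> (snd P' \<triangleleft>\<^bsub>K\<^esub> X) \<bullet>\<^bsub>K\<^esub> (endo (fst P') \<triangleright>\<^bsub>K\<^esub> \<phi>)"
  by (auto simp: bimnd_1cells_def Let_def)

lemma bimnd_1cells_cases:
  assumes "x \<in> bimnd_1cells K P P'"
  obtains X \<psi> \<phi> where "x = (P, (X, \<psi>, \<phi>), P')"
  using assms by (auto simp: bimnd_1cells_def)

lemma bimnd_2cells_iff:
  "((Q, (X, \<psi>, \<phi>), Q'), \<zeta>, (R, (Y, \<psi>', \<phi>'), R')) \<in> bimnd_2cells K P P' \<longleftrightarrow>
     (Q, (X, \<psi>, \<phi>), Q') \<in> bimnd_1cells K P P' \<and> (R, (Y, \<psi>', \<phi>'), R') \<in> bimnd_1cells K P P'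
     \<and> \<zeta> \<in> hom2 K X Y
     \<and> (\<zeta> \<triangleleft>\<^bsub>K\<^esub> endo (fst P)) \<bullet>\<^bsub>K\<^esub> \<psi> = \<psi>' \<bullet>\<^bsub>K\<^esub> (endo (fst P') \<triangleright>\<^bsub>K\<^esub> \<zeta>)
     \<and> (endo (fst P') \<triangleright>\<^bsub>K\<^esub> \<zeta>) \<bullet>\<^bsub>K\<^esub> \<phi> = \<phi>' \<bullet>\<^bsub>K\<^esub> (\<zeta> \<triangleleft>\<^bsub>K\<^esub> endo (fst P))"
  by (simp add: bimnd_2cells_def Let_def bimnd_1cells_iff) blast

lemma bimnd_2cells_cases:
  assumes "z \<in> bimnd_2cells K P P'"
  obtains X \<psi> \<phi> \<zeta> Y \<psi>' \<phi>' where "z = ((P, (X, \<psi>, \<phi>), P'), \<zeta>, (P, (Y, \<psi>', \<phi>'), P'))"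
    "(P, (X, \<psi>, \<phi>), P') \<in> bimnd_1cells K P P'" "(P, (Y, \<psi>', \<phi>'), P') \<in> bimnd_1cells K P P'"
  using assms by (auto simp: bimnd_2cells_def Let_def)

lemma bimnd_2cells_ends:
  assumes "z \<in> bimnd_2cells K P P'"
  shows "fst z \<in> bimnd_1cells K P P'" "snd (snd z) \<in> bimnd_1cells K P P'"
  using assms by (auto elim!: bimnd_2cells_cases)

lemma bimnd_1cells_ends:
  assumes "x \<in> bimnd_1cells K P P'"
  shows "fst x = P" "snd (snd x) = P'"
  using assms by (auto elim!: bimnd_1cells_cases)

definition bimnd_hcomp :: "('o, 'm, 'c) two_cat \<Rightarrow> ('o, 'm, 'c) bimnd_2cell
    \<Rightarrow> ('o, 'm, 'c) bimnd_2cell \<Rightarrow> ('o, 'm, 'c) bimnd_2cell" where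
  "bimnd_hcomp K = (\<lambda>(x', \<xi>, y') (x, \<zeta>, y). (bimnd_comp1 K x' x, \<xi> \<star>\<^bsub>K\<^esub> \<zeta>, bimnd_comp1 K y' y))"

text \<open>Leaving the set of 0-cells free isolates what the 2-category laws rest on, namely the
  typing condition \<open>bimnd_data\<close> on each 0-cell.\<close>

definition Bimnd_on :: "('o, 'm, 'c) two_cat \<Rightarrow> ('o, 'm, 'c) bimnd set
    \<Rightarrow> (('o, 'm, 'c) bimnd, ('o, 'm, 'c) bimnd_1cell, ('o, 'm, 'c) bimnd_2cell) two_cat" where
  "Bimnd_on K J = (Bimnd K)\<lparr> cells0 := J,
     cells1 := (\<Union>P\<in>J. \<Union>P'\<in>J. bimnd_1cells K P P'),
     cells2 := (\<Union>P\<in>J. \<Union>P'\<in>J. bimnd_2cells K P P') \<rparr>"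

lemma Bimnd_on_simps:
  "cells0 (Bimnd_on K J) = J"
  "cells1 (Bimnd_on K J) = (\<Union>P\<in>J. \<Union>P'\<in>J. bimnd_1cells K P P')"
  "cells2 (Bimnd_on K J) = (\<Union>P\<in>J. \<Union>P'\<in>J. bimnd_2cells K P P')"
  "src1 (Bimnd_on K J) = fst" "trg1 (Bimnd_on K J) = (\<lambda>x. snd (snd x))"
  "src2 (Bimnd_on K J) = fst" "trg2 (Bimnd_on K J) = (\<lambda>z. snd (snd z))"
  "id1 (Bimnd_on K J) = bimnd_id1 K" "id2 (Bimnd_on K J) = bimnd_id2 K"
  "comp1 (Bimnd_on K J) = bimnd_comp1 K" "vcomp (Bimnd_on K J) = bimnd_vcomp K"
  "hcomp (Bimnd_on K J) = bimnd_hcomp K"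
  by (simp_all add: Bimnd_on_def Bimnd_def bimnd_hcomp_def)

lemma Bimnd_eq_Bimnd_on: "Bimnd K = Bimnd_on K (Collect (is_bimonad K))"
  by (simp add: Bimnd_on_def Bimnd_def)

text \<open>A 1-cell records its two end points, hence belongs to \<open>bimnd_1cells\<close> for a
  single pair of 0-cells.\<close>

lemma hom1_Bimnd_on_iff:
  "x \<in> hom1 (Bimnd_on K J) P P' \<longleftrightarrow> P \<in> J \<and> P' \<in> J \<and> x \<in> bimnd_1cells K P P'"
proof
  assume "x \<in> hom1 (Bimnd_on K J) P P'"
  then obtain Q Q' where Q: "Q \<in> J" "Q' \<in> J" "x \<in> bimnd_1cells K Q Q'" "fst x = P" "snd (snd x) = P'"
    by (auto simp only: hom1_def Bimnd_on_simps mem_Collect_eq UN_iff)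
  then show "P \<in> J \<and> P' \<in> J \<and> x \<in> bimnd_1cells K P P'"
    using bimnd_1cells_ends[OF Q(3)] by simp
next
  assume *: "P \<in> J \<and> P' \<in> J \<and> x \<in> bimnd_1cells K P P'"
  then show "x \<in> hom1 (Bimnd_on K J) P P'"
    using bimnd_1cells_ends[of x K P P'] by (auto simp only: hom1_def Bimnd_on_simps mem_Collect_eq UN_iff)
qed

lemma hom2_Bimnd_on_iff:
  "z \<in> hom2 (Bimnd_on K J) x y \<longleftrightarrow> (\<exists>P\<in>J. \<exists>P'\<in>J. z \<in> bimnd_2cells K P P') \<and> fst z = x \<and> snd (snd z) = y"
  by (simp only: hom2_def Bimnd_on_simps mem_Collect_eq UN_iff)

lemma sub_two_cat_simps:
  "cells0 (sub_two_cat K J R) = J"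
  "cells1 (sub_two_cat K J R) = {X \<in> cells1 K. src1 K X \<in> J \<and> trg1 K X \<in> J \<and> R (src1 K X) (trg1 K X)}"
  "cells2 (sub_two_cat K J R) = {\<zeta> \<in> cells2 K. src2 K \<zeta> \<in> cells1 (sub_two_cat K J R) \<and> trg2 K \<zeta> \<in> cells1 (sub_two_cat K J R)}"
  "src1 (sub_two_cat K J R) = src1 K" "trg1 (sub_two_cat K J R) = trg1 K"
  "src2 (sub_two_cat K J R) = src2 K" "trg2 (sub_two_cat K J R) = trg2 K"
  "id1 (sub_two_cat K J R) = id1 K" "id2 (sub_two_cat K J R) = id2 K"
  "comp1 (sub_two_cat K J R) = comp1 K" "vcomp (sub_two_cat K J R) = vcomp K" "hcomp (sub_two_cat K J R) = hcomp K"
  by (simp_all add: sub_two_cat_def Let_def)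

context two_category
begin

text \<open>The 0-cells \<open>(F, \<lambda>\<^sub>\<alpha>)\<close> need not be bimonads; only typing conditions are imposed.\<close>

definition bimnd_data :: "('o, 'm, 'c) bimnd \<Rightarrow> bool" where
  "bimnd_data P \<longleftrightarrow> typed_structure (fst P)
     \<and> snd P \<in> hom2 K (endo (fst P) \<cdot> endo (fst P)) (endo (fst P) \<cdot> endo (fst P))"

lemma bimnd_1cellsD:
  assumes "(P, (X, \<psi>, \<phi>), P') \<in> bimnd_1cells K P P'"
  shows "X \<in> cells1 K" "src1 K X = base (fst P)" "trg1 K X = base (fst P')"
    "\<psi> \<in> cells2 K" "src2 K \<psi> = endo (fst P') \<cdot> X" "trg2 K \<psi> = X \<cdot> endo (fst P)"
    "\<phi> \<in> cells2 K" "src2 K \<phi> = X \<cdot> endo (fst P)" "trg2 K \<phi> = endo (fst P') \<cdot> X"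
  using assms mnd_1cellD[of "fst P" "fst P'" X \<psi>] comnd_1cellD[of "fst P" "fst P'" X \<phi>]
  by (auto simp: bimnd_1cells_iff)

lemma bimnd_dataD:
  assumes "bimnd_data P"
  shows "base (fst P) \<in> cells0 K" "endo (fst P) \<in> cells1 K" "src1 K (endo (fst P)) = base (fst P)"
    "trg1 K (endo (fst P)) = base (fst P)"
    "snd P \<in> cells2 K" "src2 K (snd P) = endo (fst P) \<cdot> endo (fst P)"
    "trg2 K (snd P) = endo (fst P) \<cdot> endo (fst P)"
  using assms typed_structureD[of "fst P"] by (auto simp: bimnd_data_def hom2_iff)

section \<open>Closure of the bimonad cells under identities and compositions\<close>

lemma bimnd_comp1_closed:
  assumes "bimnd_data P" "bimnd_data P'" "bimnd_data P''"
    and x: "x \<in> bimnd_1cells K P' P''" and y: "y \<in> bimnd_1cells K P P'"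
  shows "bimnd_comp1 K x y \<in> bimnd_1cells K P P''"
proof -
  obtain X \<psi> \<phi> Y \<psi>' \<phi>' where e: "x = (P', (X, \<psi>, \<phi>), P'')" "y = (P, (Y, \<psi>', \<phi>'), P')"
    using x y by (elim bimnd_1cells_cases)
  have S: "typed_structure (fst P)" "typed_structure (fst P')" "typed_structure (fst P'')"
    using assms(1-3) by (simp_all add: bimnd_data_def)
  note l = assms(1-3)[unfolded bimnd_data_def, THEN conjunct2]
  have X: "mnd_1cell K (fst P') (fst P'') X \<psi>" "comnd_1cell K (fst P') (fst P'') X \<phi>"
    "(\<phi> \<triangleleft> endo (fst P')) \<bullet> (X \<triangleright> snd P') \<bullet> (\<psi> \<triangleleft> endo (fst P'))
      = (endo (fst P'') \<triangleright> \<psi>) \<bullet> (snd P'' \<triangleleft> X) \<bullet> (endo (fst P'') \<triangleright> \<phi>)"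
    using x unfolding e bimnd_1cells_iff by blast+
  have Y: "mnd_1cell K (fst P) (fst P') Y \<psi>'" "comnd_1cell K (fst P) (fst P') Y \<phi>'"
    "(\<phi>' \<triangleleft> endo (fst P)) \<bullet> (Y \<triangleright> snd P) \<bullet> (\<psi>' \<triangleleft> endo (fst P))
      = (endo (fst P') \<triangleright> \<psi>') \<bullet> (snd P' \<triangleleft> Y) \<bullet> (endo (fst P') \<triangleright> \<phi>')"
    using y unfolding e bimnd_1cells_iff by blast+
  note mnd_1cell_comp[OF S X(1) Y(1)] comnd_1cell_comp[OF S X(2) Y(2)]
    bimnd_compatibility_comp[OF S l X Y]
  then show ?thesis
    unfolding e bimnd_comp1_def bimnd_1cells_iff prod.case by blast
qed

lemma bimnd_comp1_assoc:
  assumes "bimnd_data P" "bimnd_data P'" "bimnd_data P''" "bimnd_data P'''"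
    and x: "x \<in> bimnd_1cells K P P'" and y: "y \<in> bimnd_1cells K P' P''"
    and z: "z \<in> bimnd_1cells K P'' P'''"
  shows "bimnd_comp1 K z (bimnd_comp1 K y x) = bimnd_comp1 K (bimnd_comp1 K z y) x"
proof -
  obtain X \<psi> \<phi> Y \<psi>' \<phi>' Z \<psi>'' \<phi>''
    where e: "x = (P, (X, \<psi>, \<phi>), P')" "y = (P', (Y, \<psi>', \<phi>'), P'')" "z = (P'', (Z, \<psi>'', \<phi>''), P''')"
    using x y z by (elim bimnd_1cells_cases)
  note t = assms(1-4)[THEN bimnd_dataD(2)] assms(1-4)[THEN bimnd_dataD(3)]
    assms(1-4)[THEN bimnd_dataD(4)]
    bimnd_1cellsD[OF x[unfolded e]] bimnd_1cellsD[OF y[unfolded e]] bimnd_1cellsD[OF z[unfolded e]]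
  show ?thesis
    unfolding e bimnd_comp1_def by (simp add: normal_form t)
qed

lemma bimnd_id1_closed:
  assumes "bimnd_data P"
  shows "bimnd_id1 K P \<in> bimnd_1cells K P P"
proof -
  have "typed_structure (fst P)" using assms by (simp add: bimnd_data_def)
  note t = bimnd_dataD[OF assms] typed_structureD[OF this]
  show ?thesis
    unfolding bimnd_id1_def
    by (simp add: bimnd_1cells_iff mnd_1cell_def comnd_1cell_def hom1_iff hom2_iff normal_form t)
qed

lemma bimnd_comp1_id1:
  assumes "bimnd_data P" "bimnd_data P'" and x: "x \<in> bimnd_1cells K P P'"
  shows "bimnd_comp1 K (bimnd_id1 K P') x = x" "bimnd_comp1 K x (bimnd_id1 K P) = x"
proof -
  obtain X \<psi> \<phi> where e: "x = (P, (X, \<psi>, \<phi>), P')"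
    using x by (elim bimnd_1cells_cases)
  note t = bimnd_dataD[OF assms(1)] bimnd_dataD[OF assms(2)] bimnd_1cellsD[OF x[unfolded e]]
  show "bimnd_comp1 K (bimnd_id1 K P') x = x" "bimnd_comp1 K x (bimnd_id1 K P) = x"
    unfolding e bimnd_comp1_def bimnd_id1_def by (simp_all add: normal_form t)
qed

lemma bimnd_id2_closed:
  assumes "bimnd_data P" "bimnd_data P'" and x: "x \<in> bimnd_1cells K P P'"
  shows "bimnd_id2 K x \<in> bimnd_2cells K P P'"
proof -
  obtain X \<psi> \<phi> where e: "x = (P, (X, \<psi>, \<phi>), P')"
    using x by (elim bimnd_1cells_cases)
  note t = bimnd_dataD[OF assms(1)] bimnd_dataD[OF assms(2)] bimnd_1cellsD[OF x[unfolded e]]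
  show ?thesis
    using x unfolding e bimnd_id2_def by (simp add: bimnd_2cells_iff hom2_iff normal_form t)
qed

lemma bimnd_vcomp_closed:
  assumes "bimnd_data P" "bimnd_data P'" "w \<in> bimnd_2cells K P P'" "z \<in> bimnd_2cells K P P'"
    "snd (snd w) = fst z"
  shows "bimnd_vcomp K z w \<in> bimnd_2cells K P P'"
proof -
  obtain X \<psi> \<phi> \<zeta> Y \<psi>' \<phi>' where e: "w = ((P, (X, \<psi>, \<phi>), P'), \<zeta>, (P, (Y, \<psi>', \<phi>'), P'))"
    and w: "(P, (X, \<psi>, \<phi>), P') \<in> bimnd_1cells K P P'" "(P, (Y, \<psi>', \<phi>'), P') \<in> bimnd_1cells K P P'"
    using assms(3) by (elim bimnd_2cells_cases)
  obtain \<xi> Z \<psi>'' \<phi>'' where f: "z = ((P, (Y, \<psi>', \<phi>'), P'), \<xi>, (P, (Z, \<psi>'', \<phi>''), P'))"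
    and z: "(P, (Z, \<psi>'', \<phi>''), P') \<in> bimnd_1cells K P P'"
    using assms(4,5) e by (elim bimnd_2cells_cases) auto
  let ?F = "endo (fst P)" and ?F' = "endo (fst P')"
  have z1: "(\<xi> \<triangleleft> ?F) \<bullet> \<psi>' = \<psi>'' \<bullet> (?F' \<triangleright> \<xi>)" "(?F' \<triangleright> \<xi>) \<bullet> \<phi>' = \<phi>'' \<bullet> (\<xi> \<triangleleft> ?F)"
    "\<xi> \<in> cells2 K" "src2 K \<xi> = Y" "trg2 K \<xi> = Z"
    and w1: "(\<zeta> \<triangleleft> ?F) \<bullet> \<psi> = \<psi>' \<bullet> (?F' \<triangleright> \<zeta>)" "(?F' \<triangleright> \<zeta>) \<bullet> \<phi> = \<phi>' \<bullet> (\<zeta> \<triangleleft> ?F)"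
    "\<zeta> \<in> cells2 K" "src2 K \<zeta> = X" "trg2 K \<zeta> = Y"
    using assms(3,4) unfolding e f bimnd_2cells_iff hom2_iff by blast+
  note t = bimnd_dataD[OF assms(1)] bimnd_dataD[OF assms(2)]
    bimnd_1cellsD[OF w(1)] bimnd_1cellsD[OF w(2)] bimnd_1cellsD[OF z] z1(3-5) w1(3-5)
  note n = normal_form t
  have "((\<xi> \<bullet> \<zeta>) \<triangleleft> ?F) \<bullet> \<psi> = (\<xi> \<triangleleft> ?F) \<bullet> ((\<zeta> \<triangleleft> ?F) \<bullet> \<psi>)"
    by (simp add: n)
  also have "\<dots> = ((\<xi> \<triangleleft> ?F) \<bullet> \<psi>') \<bullet> (?F' \<triangleright> \<zeta>)"
    unfolding w1 by (simp add: n)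
  also have "\<dots> = \<psi>'' \<bullet> (?F' \<triangleright> (\<xi> \<bullet> \<zeta>))"
    unfolding z1 by (simp add: n)
  finally have 1: "((\<xi> \<bullet> \<zeta>) \<triangleleft> ?F) \<bullet> \<psi> = \<psi>'' \<bullet> (?F' \<triangleright> (\<xi> \<bullet> \<zeta>))" .
  have "(?F' \<triangleright> (\<xi> \<bullet> \<zeta>)) \<bullet> \<phi> = (?F' \<triangleright> \<xi>) \<bullet> ((?F' \<triangleright> \<zeta>) \<bullet> \<phi>)"
    by (simp add: n)
  also have "\<dots> = ((?F' \<triangleright> \<xi>) \<bullet> \<phi>') \<bullet> (\<zeta> \<triangleleft> ?F)"
    unfolding w1 by (simp add: n)
  also have "\<dots> = \<phi>'' \<bullet> ((\<xi> \<bullet> \<zeta>) \<triangleleft> ?F)"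
    unfolding z1 by (simp add: n)
  finally show ?thesis
    unfolding e f bimnd_vcomp_def using 1 w(1) z by (simp add: bimnd_2cells_iff hom2_iff n)
qed

lemma bimnd_hcomp_closed:
  assumes D: "bimnd_data P" "bimnd_data P'" "bimnd_data P''"
    and z: "z \<in> bimnd_2cells K P' P''" and w: "w \<in> bimnd_2cells K P P'"
  shows "bimnd_hcomp K z w \<in> bimnd_2cells K P P''"
proof -
  obtain X \<psi> \<phi> \<xi> X2 \<psi>2 \<phi>2 where e: "z = ((P', (X, \<psi>, \<phi>), P''), \<xi>, (P', (X2, \<psi>2, \<phi>2), P''))"
    and x: "(P', (X, \<psi>, \<phi>), P'') \<in> bimnd_1cells K P' P''" "(P', (X2, \<psi>2, \<phi>2), P'') \<in> bimnd_1cells K P' P''"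
    using z by (elim bimnd_2cells_cases)
  obtain Y \<psi>' \<phi>' \<zeta> Y2 \<psi>2' \<phi>2' where f: "w = ((P, (Y, \<psi>', \<phi>'), P'), \<zeta>, (P, (Y2, \<psi>2', \<phi>2'), P'))"
    and y: "(P, (Y, \<psi>', \<phi>'), P') \<in> bimnd_1cells K P P'" "(P, (Y2, \<psi>2', \<phi>2'), P') \<in> bimnd_1cells K P P'"
    using w by (elim bimnd_2cells_cases)
  have S: "typed_structure (fst P)" "typed_structure (fst P')" "typed_structure (fst P'')"
    using D by (simp_all add: bimnd_data_def)
  have xy: "bimnd_comp1 K (P', (X, \<psi>, \<phi>), P'') (P, (Y, \<psi>', \<phi>'), P') \<in> bimnd_1cells K P P''"
    "bimnd_comp1 K (P', (X2, \<psi>2, \<phi>2), P'') (P, (Y2, \<psi>2', \<phi>2'), P') \<in> bimnd_1cells K P P''"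
    by (rule bimnd_comp1_closed[OF D]; fact x y)+
  have m: "mnd_1cell K (fst P') (fst P'') X \<psi>" "mnd_1cell K (fst P') (fst P'') X2 \<psi>2"
    "mnd_1cell K (fst P) (fst P') Y \<psi>'" "mnd_1cell K (fst P) (fst P') Y2 \<psi>2'"
    and c: "comnd_1cell K (fst P') (fst P'') X \<phi>" "comnd_1cell K (fst P') (fst P'') X2 \<phi>2"
    "comnd_1cell K (fst P) (fst P') Y \<phi>'" "comnd_1cell K (fst P) (fst P') Y2 \<phi>2'"
    using x y unfolding bimnd_1cells_iff by blast+
  have h: "\<xi> \<in> hom2 K X X2" "\<zeta> \<in> hom2 K Y Y2"
    and z': "(\<xi> \<triangleleft> endo (fst P')) \<bullet> \<psi> = \<psi>2 \<bullet> (endo (fst P'') \<triangleright> \<xi>)"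
      "(endo (fst P'') \<triangleright> \<xi>) \<bullet> \<phi> = \<phi>2 \<bullet> (\<xi> \<triangleleft> endo (fst P'))"
    and w': "(\<zeta> \<triangleleft> endo (fst P)) \<bullet> \<psi>' = \<psi>2' \<bullet> (endo (fst P') \<triangleright> \<zeta>)"
      "(endo (fst P') \<triangleright> \<zeta>) \<bullet> \<phi>' = \<phi>2' \<bullet> (\<zeta> \<triangleleft> endo (fst P))"
    using z w unfolding e f bimnd_2cells_iff by blast+
  have "\<xi> \<star> \<zeta> \<in> hom2 K (X \<cdot> Y) (X2 \<cdot> Y2)"
    using bimnd_1cellsD(2)[OF x(1)] bimnd_1cellsD(3)[OF y(1)] by (simp add: hcomp_hom2 h)
  with xy mnd_2cell_hcomp[OF S m h z'(1) w'(1)] comnd_2cell_hcomp[OF S c h z'(2) w'(2)]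
  show ?thesis
    unfolding e f bimnd_hcomp_def bimnd_comp1_def prod.case bimnd_2cells_iff by blast
qed

section \<open>Underlying cells and the laws of a 2-category\<close>

lemma bimnd_1cells_typing:
  assumes "x \<in> bimnd_1cells K P P'"
  shows "fst (fst (snd x)) \<in> cells1 K" "src1 K (fst (fst (snd x))) = base (fst P)"
    "trg1 K (fst (fst (snd x))) = base (fst P')"
  using assms bimnd_1cellsD(1-3) by (metis bimnd_1cells_cases fst_conv snd_conv)+

lemma bimnd_2cells_typing:
  assumes "z \<in> bimnd_2cells K P P'"
  shows "fst (snd z) \<in> cells2 K" "src2 K (fst (snd z)) = fst (fst (snd (fst z)))"
    "trg2 K (fst (snd z)) = fst (fst (snd (snd (snd z))))"
proof -
  obtain X \<psi> \<phi> \<zeta> Y \<psi>' \<phi>' where e: "z = ((P, (X, \<psi>, \<phi>), P'), \<zeta>, (P, (Y, \<psi>', \<phi>'), P'))"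
    using assms by (elim bimnd_2cells_cases)
  have "\<zeta> \<in> hom2 K X Y"
    using assms unfolding e bimnd_2cells_iff by blast
  then show "fst (snd z) \<in> cells2 K" "src2 K (fst (snd z)) = fst (fst (snd (fst z)))"
    "trg2 K (fst (snd z)) = fst (fst (snd (snd (snd z))))"
    unfolding e by (simp_all add: hom2_iff)
qed

text \<open>A 2-cell consists of an underlying 2-cell of K and its two end 1-cells. Comparing these
  parts separately reduces this law, and the ones that follow, to laws of K and of
  \<open>bimnd_comp1\<close>.\<close>

lemma bimnd_vcomp_assoc:
  assumes "u \<in> bimnd_2cells K P P'" "v \<in> bimnd_2cells K P P'" "w \<in> bimnd_2cells K P P'"
    and "snd (snd u) = fst v" "snd (snd v) = fst w"
  shows "bimnd_vcomp K w (bimnd_vcomp K v u) = bimnd_vcomp K (bimnd_vcomp K w v) u"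
  using assms(4,5) vcomp_assoc'[of "fst (snd u)" "fst (snd v)" "fst (snd w)"]
    bimnd_2cells_typing[OF assms(1)] bimnd_2cells_typing[OF assms(2)] bimnd_2cells_typing[OF assms(3)]
  by (simp add: bimnd_vcomp_def split_beta)

lemma bimnd_vcomp_id2:
  assumes "z \<in> bimnd_2cells K P P'"
  shows "bimnd_vcomp K (bimnd_id2 K (snd (snd z))) z = z" "bimnd_vcomp K z (bimnd_id2 K (fst z)) = z"
  using bimnd_2cells_typing[OF assms]
  by (simp_all add: bimnd_vcomp_def bimnd_id2_def split_beta vcomp_id2)

lemma bimnd_hcomp_assoc:
  assumes D: "bimnd_data P" "bimnd_data P'" "bimnd_data P''" "bimnd_data P'''"
    and u: "u \<in> bimnd_2cells K P P'" and v: "v \<in> bimnd_2cells K P' P''" and w: "w \<in> bimnd_2cells K P'' P'''"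
  shows "bimnd_hcomp K w (bimnd_hcomp K v u) = bimnd_hcomp K (bimnd_hcomp K w v) u"
proof -
  note c = bimnd_comp1_assoc[OF D bimnd_2cells_ends(1)[OF u] bimnd_2cells_ends(1)[OF v] bimnd_2cells_ends(1)[OF w]]
    bimnd_comp1_assoc[OF D bimnd_2cells_ends(2)[OF u] bimnd_2cells_ends(2)[OF v] bimnd_2cells_ends(2)[OF w]]
  note t = bimnd_2cells_typing[OF u] bimnd_2cells_typing[OF v] bimnd_2cells_typing[OF w]
    bimnd_1cells_typing[OF bimnd_2cells_ends(1)[OF u]] bimnd_1cells_typing[OF bimnd_2cells_ends(1)[OF v]]
    bimnd_1cells_typing[OF bimnd_2cells_ends(1)[OF w]]
  from c show ?thesis
    by (simp add: bimnd_hcomp_def split_beta hcomp_assoc' t)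
qed

lemma bimnd_hcomp_id2_id1:
  assumes D: "bimnd_data P" "bimnd_data P'" and z: "z \<in> bimnd_2cells K P P'"
  shows "bimnd_hcomp K (bimnd_id2 K (bimnd_id1 K P')) z = z"
    "bimnd_hcomp K z (bimnd_id2 K (bimnd_id1 K P)) = z"
proof -
  note c = bimnd_comp1_id1[OF D bimnd_2cells_ends(1)[OF z]] bimnd_comp1_id1[OF D bimnd_2cells_ends(2)[OF z]]
  note t = bimnd_2cells_typing[OF z] bimnd_1cells_typing[OF bimnd_2cells_ends(1)[OF z]]
  have "fst (fst (snd (bimnd_id1 K P))) = id1 K (base (fst P))" for P
    by (simp add: bimnd_id1_def)
  with c t show "bimnd_hcomp K (bimnd_id2 K (bimnd_id1 K P')) z = z"
    "bimnd_hcomp K z (bimnd_id2 K (bimnd_id1 K P)) = z"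
    by (simp_all add: bimnd_hcomp_def bimnd_id2_def split_beta hcomp_id2_id1)
qed

lemma bimnd_hcomp_id2:
  assumes "x \<in> bimnd_1cells K P' P''" "y \<in> bimnd_1cells K P P'"
  shows "bimnd_hcomp K (bimnd_id2 K x) (bimnd_id2 K y) = bimnd_id2 K (bimnd_comp1 K x y)"
  using bimnd_1cells_typing[OF assms(1)] bimnd_1cells_typing[OF assms(2)]
  by (simp add: bimnd_hcomp_def bimnd_id2_def bimnd_comp1_def split_beta hcomp_id2')

lemma bimnd_interchange:
  assumes w: "w \<in> bimnd_2cells K P P'" "w' \<in> bimnd_2cells K P P'"
    and z: "z \<in> bimnd_2cells K P' P''" "z' \<in> bimnd_2cells K P' P''"
    and e: "snd (snd w) = fst w'" "snd (snd z) = fst z'"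
  shows "bimnd_hcomp K (bimnd_vcomp K z' z) (bimnd_vcomp K w' w)
    = bimnd_vcomp K (bimnd_hcomp K z' w') (bimnd_hcomp K z w)"
proof -
  note t = bimnd_2cells_typing[OF w(1)] bimnd_2cells_typing[OF w(2)] bimnd_2cells_typing[OF z(1)]
    bimnd_2cells_typing[OF z(2)] bimnd_1cells_typing[OF bimnd_2cells_ends(1)[OF w(1)]]
    bimnd_1cells_typing[OF bimnd_2cells_ends(1)[OF z(1)]]
  show ?thesis
    by (simp add: bimnd_hcomp_def bimnd_vcomp_def split_beta interchange' t e)
qed

lemma bimnd_hcomp_ends:
  "fst (bimnd_hcomp K z w) = bimnd_comp1 K (fst z) (fst w)"
  "snd (snd (bimnd_hcomp K z w)) = bimnd_comp1 K (snd (snd z)) (snd (snd w))"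
  by (simp_all add: bimnd_hcomp_def split_beta)

lemma bimnd_vcomp_ends:
  "fst (bimnd_vcomp K z w) = fst w" "snd (snd (bimnd_vcomp K z w)) = snd (snd z)"
  by (simp_all add: bimnd_vcomp_def split_beta)

lemma bimnd_2cells_unique:
  assumes "z \<in> bimnd_2cells K P P'"
  shows "fst (fst z) = P" "snd (snd (fst z)) = P'" "fst (snd (snd z)) = P" "snd (snd (snd (snd z))) = P'"
  using assms by (auto elim!: bimnd_2cells_cases)

lemma two_category_Bimnd_on:
  assumes J: "\<And>P. P \<in> J \<Longrightarrow> bimnd_data P"
  shows "two_category (Bimnd_on K J)"
proof -
  let ?L = "Bimnd_on K J"
  have h1: "\<exists>P\<in>J. \<exists>P'\<in>J. x \<in> bimnd_1cells K P P' \<and> fst x = P \<and> snd (snd x) = P'" if "x \<in> cells1 ?L" for x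
    using that bimnd_1cells_ends unfolding Bimnd_on_simps UN_iff by metis
  have h2: "\<exists>P\<in>J. \<exists>P'\<in>J. z \<in> bimnd_2cells K P P'" if "z \<in> cells2 ?L" for z
    using that unfolding Bimnd_on_simps UN_iff .
  \<comment> \<open>A 2-cell determines its pair of 0-cells through its end 1-cells. Hence
    composable 2-cells, for which the union over J yields the pairs separately, turn out to share
    the 0-cells that they should share.\<close>
  have h2': "\<exists>P\<in>J. \<exists>P'\<in>J. z \<in> bimnd_2cells K P P' \<and> fst x = P \<and> snd (snd x) = P' \<and> fst z = x \<and> snd (snd z) = y"
    if "z \<in> hom2 ?L x y" for z x y
    using that bimnd_2cells_unique unfolding hom2_Bimnd_on_iff by metis
  show ?thesis
  proof
    fix X assume "X \<in> cells1 ?L"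
    then show "src1 ?L X \<in> cells0 ?L" "trg1 ?L X \<in> cells0 ?L"
      using h1[of X] by (auto simp: Bimnd_on_simps)
  next
    fix z assume "z \<in> cells2 ?L"
    then obtain P P' where z: "P \<in> J" "P' \<in> J" "z \<in> bimnd_2cells K P P'" using h2 by blast
    then show "src2 ?L z \<in> cells1 ?L" "trg2 ?L z \<in> cells1 ?L"
      using bimnd_2cells_ends[OF z(3)] unfolding Bimnd_on_simps by blast+
    show "src1 ?L (src2 ?L z) = src1 ?L (trg2 ?L z)" "trg1 ?L (src2 ?L z) = trg1 ?L (trg2 ?L z)"
      using bimnd_2cells_unique[OF z(3)] by (simp_all add: Bimnd_on_simps)
  next
    fix A assume "A \<in> cells0 ?L"
    then show "id1 ?L A \<in> hom1 ?L A A"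
      by (simp add: hom1_Bimnd_on_iff Bimnd_on_simps bimnd_id1_closed J)
  next
    fix X Y A B C assume "X \<in> hom1 ?L A B" "Y \<in> hom1 ?L B C"
    then show "comp1 ?L Y X \<in> hom1 ?L A C"
      unfolding hom1_Bimnd_on_iff Bimnd_on_simps using bimnd_comp1_closed[of A B C Y X] J by blast
  next
    fix X Y Z A B C D assume "X \<in> hom1 ?L A B" "Y \<in> hom1 ?L B C" "Z \<in> hom1 ?L C D"
    then show "comp1 ?L Z (comp1 ?L Y X) = comp1 ?L (comp1 ?L Z Y) X"
      unfolding hom1_Bimnd_on_iff Bimnd_on_simps using bimnd_comp1_assoc[of A B C D X Y Z] J by blast
  next
    fix X A B assume "X \<in> hom1 ?L A B"
    then show "comp1 ?L (id1 ?L B) X = X" "comp1 ?L X (id1 ?L A) = X"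
      unfolding hom1_Bimnd_on_iff Bimnd_on_simps using bimnd_comp1_id1[of A B X] J by blast+
  next
    fix X assume "X \<in> cells1 ?L"
    then obtain P P' where "P \<in> J" "P' \<in> J" "X \<in> bimnd_1cells K P P'" using h1 by blast
    then have "bimnd_id2 K X \<in> bimnd_2cells K P P'"
      using bimnd_id2_closed J by blast
    then show "id2 ?L X \<in> hom2 ?L X X"
      using \<open>P \<in> J\<close> \<open>P' \<in> J\<close> unfolding hom2_Bimnd_on_iff Bimnd_on_simps
      by (auto simp: bimnd_id2_def)
  next
    fix z w X Y Z assume zw: "z \<in> hom2 ?L X Y" "w \<in> hom2 ?L Y Z"
    obtain P P' where z: "P \<in> J" "P' \<in> J" "z \<in> bimnd_2cells K P P'" "fst Y = P" "snd (snd Y) = P'"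
      "fst z = X" "snd (snd z) = Y"
      using h2'[OF zw(1)] bimnd_2cells_unique by metis
    then have w: "w \<in> bimnd_2cells K P P'" "fst w = Y" "snd (snd w) = Z"
      using h2'[OF zw(2)] by auto
    have "bimnd_vcomp K w z \<in> bimnd_2cells K P P'"
      by (rule bimnd_vcomp_closed) (use z w J in auto)
    then show "vcomp ?L w z \<in> hom2 ?L X Z"
      using z w unfolding hom2_Bimnd_on_iff Bimnd_on_simps bimnd_vcomp_ends by blast
    fix v W assume "v \<in> hom2 ?L Z W"
    moreover have "fst Z = P" "snd (snd Z) = P'"
      using bimnd_2cells_unique[OF w(1)] w by auto
    ultimately have v: "v \<in> bimnd_2cells K P P'" "fst v = Z"
      using h2'[of v Z W] by auto
    show "vcomp ?L v (vcomp ?L w z) = vcomp ?L (vcomp ?L v w) z"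
      unfolding Bimnd_on_simps by (rule bimnd_vcomp_assoc) (use z w v in auto)
  next
    fix z X Y assume "z \<in> hom2 ?L X Y"
    then obtain P P' where "z \<in> bimnd_2cells K P P'" "fst z = X" "snd (snd z) = Y"
      using h2' by metis
    then show "vcomp ?L (id2 ?L Y) z = z" "vcomp ?L z (id2 ?L X) = z"
      using bimnd_vcomp_id2[of z P P'] by (auto simp: Bimnd_on_simps)
  next
    fix z w X X' Y Y' assume zw: "z \<in> hom2 ?L X X'" "w \<in> hom2 ?L Y Y'" "trg1 ?L X = src1 ?L Y"
    obtain P P' where z: "P \<in> J" "P' \<in> J" "z \<in> bimnd_2cells K P P'" "snd (snd X) = P'"
      "fst z = X" "snd (snd z) = X'"
      using h2'[OF zw(1)] by metis
    moreover have "snd (snd X) = fst Y" using zw(3) by (simp add: Bimnd_on_simps)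
    ultimately obtain P'' where w: "P'' \<in> J" "w \<in> bimnd_2cells K P' P''" "snd (snd Y) = P''"
      "fst w = Y" "snd (snd w) = Y'"
      using h2'[OF zw(2)] by metis
    have "bimnd_hcomp K w z \<in> bimnd_2cells K P P''"
      by (rule bimnd_hcomp_closed[where P'=P']) (use z w J in auto)
    then show "hcomp ?L w z \<in> hom2 ?L (comp1 ?L Y X) (comp1 ?L Y' X')"
      using z w unfolding hom2_Bimnd_on_iff Bimnd_on_simps bimnd_hcomp_ends by blast
    fix v Z Z' assume v: "v \<in> hom2 ?L Z Z'" "trg1 ?L Y = src1 ?L Z"
    moreover have "P'' = fst Z" using v(2) w(3) by (simp add: Bimnd_on_simps)
    ultimately obtain P4 where v: "P4 \<in> J" "v \<in> bimnd_2cells K P'' P4"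
      using h2'[OF v(1)] by metis
    show "hcomp ?L v (hcomp ?L w z) = hcomp ?L (hcomp ?L v w) z"
      unfolding Bimnd_on_simps
      by (rule bimnd_hcomp_assoc[of P P' P'' P4]) (use z w v J in auto)
  next
    fix X Y A B z assume "X \<in> hom1 ?L A B" "z \<in> hom2 ?L X Y"
    then have "A \<in> J" "B \<in> J" "z \<in> bimnd_2cells K A B"
      using h2'[of z X Y] bimnd_1cells_ends[of X K A B] by (auto simp: hom1_Bimnd_on_iff)
    then show "hcomp ?L (id2 ?L (id1 ?L B)) z = z" "hcomp ?L z (id2 ?L (id1 ?L A)) = z"
      using bimnd_hcomp_id2_id1[of A B z] J by (auto simp: Bimnd_on_simps)
  next
    fix X Y A B C assume "X \<in> hom1 ?L A B" "Y \<in> hom1 ?L B C"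
    then show "hcomp ?L (id2 ?L Y) (id2 ?L X) = id2 ?L (comp1 ?L Y X)"
      unfolding hom1_Bimnd_on_iff Bimnd_on_simps using bimnd_hcomp_id2[of Y B C X A] by blast
  next
    fix z z' w w' X X' X'' Y Y' Y''
    assume zw: "z \<in> hom2 ?L X X'" "z' \<in> hom2 ?L X' X''" "w \<in> hom2 ?L Y Y'" "w' \<in> hom2 ?L Y' Y''"
      "trg1 ?L X = src1 ?L Y"
    obtain P P' where z: "P \<in> J" "P' \<in> J" "z \<in> bimnd_2cells K P P'" "snd (snd X) = P'"
      "fst z = X" "snd (snd z) = X'"
      using h2'[OF zw(1)] by metis
    have "fst X' = P" "snd (snd X') = P'"
      using bimnd_2cells_unique[OF z(3)] z by auto
    then have z': "z' \<in> bimnd_2cells K P P'" "fst z' = X'"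
      using h2'[OF zw(2)] by auto
    have "P' = fst Y" using zw(5) z by (simp add: Bimnd_on_simps)
    then obtain P'' where w: "P'' \<in> J" "w \<in> bimnd_2cells K P' P''" "fst w = Y" "snd (snd w) = Y'"
      using h2'[OF zw(3)] by metis
    have "fst Y' = P'" "snd (snd Y') = P''"
      using bimnd_2cells_unique[OF w(2)] w by auto
    then have w': "w' \<in> bimnd_2cells K P' P''" "fst w' = Y'"
      using h2'[OF zw(4)] by auto
    show "hcomp ?L (vcomp ?L w' w) (vcomp ?L z' z) = vcomp ?L (hcomp ?L w' z') (hcomp ?L w z)"
      unfolding Bimnd_on_simps
      by (rule bimnd_interchange) (use z z' w w' in auto)
  qed
qed

lemma bimnd_data_bimonad:
  assumes "is_bimonad K P"
  shows "bimnd_data P"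
  using assms unfolding is_bimonad_def bimnd_data_def typed_structure_def Let_def
    is_monad_def is_comonad_def mnd_1cell_def by blast

lemma two_category_Bimnd: "two_category (Bimnd K)"
  unfolding Bimnd_eq_Bimnd_on by (rule two_category_Bimnd_on) (simp add: bimnd_data_bimonad)

text \<open>Reflexivity of R keeps the identity 1-cells and transitivity keeps the composites;
  hom-categories are kept entirely or dropped entirely, so every equation is inherited from
  K.\<close>

lemma two_category_sub_two_cat:
  assumes J: "J \<subseteq> cells0 K" and refl: "\<And>A. A \<in> J \<Longrightarrow> R A A"
    and trans: "\<And>A B C. A \<in> J \<Longrightarrow> B \<in> J \<Longrightarrow> C \<in> J \<Longrightarrow> R A B \<Longrightarrow> R B C \<Longrightarrow> R A C"
  shows "two_category (sub_two_cat K J R)"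
proof -
  let ?L = "sub_two_cat K J R"
  note e = sub_two_cat_simps[of K J R]
  have h1: "X \<in> hom1 ?L A B \<longleftrightarrow> X \<in> hom1 K A B \<and> A \<in> J \<and> B \<in> J \<and> R A B" for X A B
    by (auto simp: hom1_def e)
  have h2: "z \<in> hom2 ?L X Y \<longleftrightarrow> z \<in> hom2 K X Y \<and> X \<in> cells1 ?L \<and> Y \<in> cells1 ?L" for z X Y
    by (auto simp: hom2_def e(3,6,7))
  have c1: "X \<in> cells1 ?L \<longleftrightarrow> X \<in> cells1 K \<and> src1 K X \<in> J \<and> trg1 K X \<in> J \<and> R (src1 K X) (trg1 K X)" for X
    by (simp add: e)
  have cc: "Y \<cdot> X \<in> cells1 ?L" if "X \<in> cells1 ?L" "Y \<in> cells1 ?L" "trg1 K X = src1 K Y" for X Y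
    using that trans[of "src1 K X" "src1 K Y" "trg1 K Y"] by (simp add: c1 comp1_typing)
  show ?thesis
  proof (unfold_locales, goal_cases)
    case 1 then show ?case by (simp add: e) next
    case 2 then show ?case by (simp add: e) next
    case 3 then show ?case by (simp add: e(3,6)) next
    case 4 then show ?case by (simp add: e(3,7)) next
    case 5 then show ?case by (simp add: e parallel_src) next
    case 6 then show ?case by (simp add: e parallel_trg) next
    case 7 then show ?case using J by (auto simp: h1 e refl id1_hom1) next
    case (8 X A B Y C) then show ?case using trans comp1_hom1 unfolding h1 e by blast next
    case 9 then show ?case unfolding h1 e using comp1_assoc by blast next
    case 10 then show ?case unfolding h1 e using comp1_id_left by blast next
    case 11 then show ?case unfolding h1 e using comp1_id_right by blast next
    case 12 then show ?case unfolding h2 e(9) using id2_hom2 c1 by blast next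
    case 13 then show ?case unfolding h2 e(11) using vcomp_hom2 by blast next
    case 14 then show ?case unfolding h2 e(11) using vcomp_assoc by blast next
    case 15 then show ?case unfolding h2 e(9,11) using vcomp_id_left by blast next
    case 16 then show ?case unfolding h2 e(9,11) using vcomp_id_right by blast next
    \<comment> \<open>The composability condition is given for the sources of the 2-cells only;
      their targets must be composable as well for \<open>Y' \<cdot> X'\<close> to be a retained
      1-cell.\<close>
    case (17 z X X' w Y Y')
    then have "trg1 K X' = src1 K Y'"
      using parallel_src[of w] parallel_trg[of z] unfolding h2 e(4,5) hom2_iff by auto
    with 17 show ?case unfolding h2 e(4,5,10,12) using hcomp_hom2 cc by blast next
    case 18 then show ?case unfolding h2 e(4,5,12) using hcomp_assoc by blast next
    case 19 then show ?case unfolding h1 h2 e(8,9,12) using hcomp_id_left by blast next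
    case 20 then show ?case unfolding h1 h2 e(8,9,12) using hcomp_id_right by blast next
    case 21 then show ?case unfolding h1 h2 e(9,10,12) using hcomp_id2 by blast next
    case 22 then show ?case unfolding h1 h2 e(4,5,11,12) using interchange by blast
  qed
qed

end

section \<open>The automorphism group of a category, and disjoint unions of categories\<close>

lemma endofunctorsD:
  assumes "F \<in> endofunctors C"
  shows "x \<in> Ob C \<Longrightarrow> fst F x \<in> Ob C" "f \<in> Ar C \<Longrightarrow> snd F f \<in> Ar C"
    "fst F \<in> extensional (Ob C)" "snd F \<in> extensional (Ar C)"
  using assms by (auto simp: endofunctors_def is_functor_def)

lemma endofunctors_comp:
  assumes C: "category C" and F: "F \<in> endofunctors C" and H: "H \<in> endofunctors C"
  shows "functor_comp C F H \<in> endofunctors C"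
proof -
  interpret category C by fact
  have F': "is_functor C C F" and H': "is_functor C C H"
    using F H by (simp_all add: endofunctors_def)
  have "is_functor C C (functor_comp C F H)"
    unfolding is_functor_def
  proof (intro conjI ballI impI)
    fix f g assume "f \<in> Ar C" "g \<in> Ar C" "cd C f = dm C g"
    then show "snd (functor_comp C F H) (cmp C g f)
      = cmp C (snd (functor_comp C F H) g) (snd (functor_comp C F H) f)"
      using F' H' endofunctorsD(2)[OF H] cmp_Ar[of f g]
      by (simp add: functor_comp_def compose_def is_functor_def)
  next
    fix f assume "f \<in> Ar C"
    then show "dm C (snd (functor_comp C F H) f) = fst (functor_comp C F H) (dm C f)"
      "cd C (snd (functor_comp C F H) f) = fst (functor_comp C F H) (cd C f)"
      using F' H' endofunctorsD(2)[OF H] dm_Ob cd_Ob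
      by (simp_all add: functor_comp_def compose_def is_functor_def)
  next
    fix x assume "x \<in> Ob C"
    then show "snd (functor_comp C F H) (idn C x) = idn C (fst (functor_comp C F H) x)"
      using F' H' endofunctorsD(1)[OF H] idn_Ar
      by (simp add: functor_comp_def compose_def is_functor_def)
  qed (use endofunctorsD[OF F] endofunctorsD[OF H] in \<open>auto simp: functor_comp_def compose_def\<close>)
  then show ?thesis
    by (simp add: endofunctors_def functor_comp_def compose_def)
qed

lemma functor_id_endofunctor:
  assumes "category C" shows "functor_id C \<in> endofunctors C"
proof -
  interpret category C by fact
  show ?thesis
    using dm_Ob cd_Ob idn_Ar cmp_Ar unfolding endofunctors_def is_functor_def functor_id_def by simp
qed

text \<open>\<open>compose\<close> restricts to the objects and arrows of C, so rebracketing is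
  sound as soon as the innermost functor maps these sets into themselves.\<close>

lemma functor_comp_assoc:
  assumes "L \<in> endofunctors C"
  shows "functor_comp C (functor_comp C F H) L = functor_comp C F (functor_comp C H L)"
proof -
  have "fst L \<in> Ob C \<rightarrow> Ob C" "snd L \<in> Ar C \<rightarrow> Ar C"
    using endofunctorsD[OF assms] by auto
  then show ?thesis
    by (simp add: functor_comp_def compose_assoc)
qed

text \<open>This is where extensionality matters: composing with the identity resets a map outside
  its domain, and only an extensional map is unchanged by that.\<close>

lemma functor_comp_id:
  assumes "F \<in> endofunctors C"
  shows "functor_comp C (functor_id C) F = F" "functor_comp C F (functor_id C) = F"
proof -
  have F: "fst F \<in> Ob C \<rightarrow> Ob C" "snd F \<in> Ar C \<rightarrow> Ar C"
    using endofunctorsD[OF assms] by auto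
  then show "functor_comp C (functor_id C) F = F" "functor_comp C F (functor_id C) = F"
    using endofunctorsD(3,4)[OF assms]
    by (simp_all add: functor_comp_def functor_id_def Id_compose compose_Id)
qed

lemma group_Aut_cat:
  assumes C: "category C"
  shows "group (Aut_cat C)"
proof (rule groupI)
  fix F H assume FH: "F \<in> carrier (Aut_cat C)" "H \<in> carrier (Aut_cat C)"
  then obtain F' H' where e: "F \<in> endofunctors C" "H \<in> endofunctors C" "F' \<in> endofunctors C" "H' \<in> endofunctors C"
    and i: "functor_comp C F F' = functor_id C" "functor_comp C F' F = functor_id C"
      "functor_comp C H H' = functor_id C" "functor_comp C H' H = functor_id C"
    by (auto simp: Aut_cat_def)
  have c: "functor_comp C M N \<in> endofunctors C" if "M \<in> endofunctors C" "N \<in> endofunctors C" for M N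
    using endofunctors_comp[OF C] that by blast
  have "functor_comp C (functor_comp C F H) (functor_comp C H' F')
      = functor_comp C F (functor_comp C (functor_comp C H H') F')"
    by (simp add: functor_comp_assoc e c)
  also have "\<dots> = functor_id C"
    by (simp add: i functor_comp_id e)
  finally have 1: "functor_comp C (functor_comp C F H) (functor_comp C H' F') = functor_id C" .
  have "functor_comp C (functor_comp C H' F') (functor_comp C F H)
      = functor_comp C H' (functor_comp C (functor_comp C F' F) H)"
    by (simp add: functor_comp_assoc e c)
  also have "\<dots> = functor_id C"
    by (simp add: i functor_comp_id e)
  finally show "F \<otimes>\<^bsub>Aut_cat C\<^esub> H \<in> carrier (Aut_cat C)"
    using 1 c[OF e(1,2)] c[OF e(4,3)] unfolding Aut_cat_def by (auto intro!: bexI[of _ "functor_comp C H' F'"])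
next
  show "\<one>\<^bsub>Aut_cat C\<^esub> \<in> carrier (Aut_cat C)"
    using functor_id_endofunctor[OF C] functor_comp_id[of "functor_id C" C] by (auto simp: Aut_cat_def)
next
  fix F assume "F \<in> carrier (Aut_cat C)"
  then show "\<exists>H\<in>carrier (Aut_cat C). H \<otimes>\<^bsub>Aut_cat C\<^esub> F = \<one>\<^bsub>Aut_cat C\<^esub>"
    by (auto simp: Aut_cat_def)
qed (auto simp: Aut_cat_def functor_comp_assoc functor_comp_id)

text \<open>Composition reads the tag of the first arrow only; composable arrows have equal tags,
  because the tag is part of domain and codomain.\<close>

lemma category_disj_union:
  assumes "\<And>a. a \<in> J \<Longrightarrow> category (C a)"
  shows "category (disj_union_cat J C)"
  by unfold_locales
    (auto simp: disj_union_cat_def category.dm_Ob[OF assms] category.cd_Ob[OF assms]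
      category.idn_Ar[OF assms] category.dm_idn[OF assms] category.cd_idn[OF assms]
      category.cmp_Ar[OF assms] category.dm_cmp[OF assms] category.cd_cmp[OF assms]
      category.idn_left[OF assms] category.idn_right[OF assms] category.cmp_assoc[OF assms])

section \<open>0-automorphism groups of bimonads\<close>

lemma (in group) inv_cancel:
  assumes "x \<in> carrier G" "y \<in> carrier G"
  shows "x \<otimes> (inv x \<otimes> y) = y" "inv x \<otimes> (x \<otimes> y) = y"
  using assms by (simp_all add: m_assoc[symmetric])

context two_category
begin

text \<open>Composing the last condition of \<open>Aut0\<close> with
  \<open>\<alpha> \<triangleleft> F\<close> on one side and
  \<open>F \<triangleright> \<alpha>\<close> on the other removes the inverse and says that
  \<lambda> commutes with \<open>\<alpha> \<star> \<alpha>\<close>. In this form all conditions are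
  intertwining relations, from which closure under products and inverses is visible.\<close>

lemma Aut0_carrier_iff:
  assumes P: "is_bimonad K P"
  defines "F \<equiv> endo (fst P)"
  shows "\<alpha> \<in> carrier (Aut0 K P) \<longleftrightarrow> \<alpha> \<in> hom2 K F F
    \<and> (\<exists>\<alpha>'\<in>hom2 K F F. \<alpha> \<bullet> \<alpha>' = id2 K F \<and> \<alpha>' \<bullet> \<alpha> = id2 K F)
    \<and> \<alpha> \<bullet> mu (fst P) = mu (fst P) \<bullet> (\<alpha> \<star> \<alpha>) \<and> \<alpha> \<bullet> eta (fst P) = eta (fst P)
    \<and> Delta (fst P) \<bullet> \<alpha> = (\<alpha> \<star> \<alpha>) \<bullet> Delta (fst P) \<and> eps (fst P) \<bullet> \<alpha> = eps (fst P)
    \<and> snd P \<bullet> (\<alpha> \<star> \<alpha>) = (\<alpha> \<star> \<alpha>) \<bullet> snd P"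
proof -
  note t = bimnd_dataD[OF bimnd_data_bimonad[OF P], folded F_def]
  have "(\<alpha>' \<triangleleft> F) \<bullet> snd P \<bullet> (\<alpha> \<triangleleft> F) = (F \<triangleright> \<alpha>) \<bullet> snd P \<bullet> (F \<triangleright> \<alpha>')
      \<longleftrightarrow> snd P \<bullet> (\<alpha> \<star> \<alpha>) = (\<alpha> \<star> \<alpha>) \<bullet> snd P"
    if a: "\<alpha> \<in> hom2 K F F" "\<alpha>' \<in> hom2 K F F" and i: "\<alpha> \<bullet> \<alpha>' = id2 K F" "\<alpha>' \<bullet> \<alpha> = id2 K F" for \<alpha>'
  proof -
    note n = typing t a[unfolded hom2_iff] vcomp_assoc'
    have s: "(\<alpha> \<triangleleft> F) \<bullet> (F \<triangleright> \<alpha>) = \<alpha> \<star> \<alpha>" "(F \<triangleright> \<alpha>) \<bullet> (\<alpha> \<triangleleft> F) = \<alpha> \<star> \<alpha>"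
      by (subst interchange'; simp add: n)+
    have c: "(\<alpha>' \<triangleleft> F) \<bullet> (\<alpha> \<triangleleft> F) = id2 K (F \<cdot> F)" "(\<alpha> \<triangleleft> F) \<bullet> (\<alpha>' \<triangleleft> F) = id2 K (F \<cdot> F)"
      "(F \<triangleright> \<alpha>') \<bullet> (F \<triangleright> \<alpha>) = id2 K (F \<cdot> F)" "(F \<triangleright> \<alpha>) \<bullet> (F \<triangleright> \<alpha>') = id2 K (F \<cdot> F)"
      by (subst interchange'; simp add: n i)+
    show ?thesis
    proof
      assume e: "(\<alpha>' \<triangleleft> F) \<bullet> snd P \<bullet> (\<alpha> \<triangleleft> F) = (F \<triangleright> \<alpha>) \<bullet> snd P \<bullet> (F \<triangleright> \<alpha>')"
      \<comment> \<open>Inserting \<open>\<alpha> \<bullet> \<alpha>'\<close> on the left exposes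
        the hypothesis, and the factor \<open>F \<triangleright> \<alpha>'\<close> that it produces
        cancels against \<open>F \<triangleright> \<alpha>\<close>.\<close>
      have "snd P \<bullet> (\<alpha> \<star> \<alpha>) = ((\<alpha> \<triangleleft> F) \<bullet> (\<alpha>' \<triangleleft> F)) \<bullet> snd P \<bullet> ((\<alpha> \<triangleleft> F) \<bullet> (F \<triangleright> \<alpha>))"
        unfolding s c by (simp add: n)
      also have "\<dots> = (\<alpha> \<triangleleft> F) \<bullet> ((\<alpha>' \<triangleleft> F) \<bullet> snd P \<bullet> (\<alpha> \<triangleleft> F)) \<bullet> (F \<triangleright> \<alpha>)"
        by (simp add: n)
      also have "\<dots> = ((\<alpha> \<triangleleft> F) \<bullet> (F \<triangleright> \<alpha>)) \<bullet> (snd P \<bullet> ((F \<triangleright> \<alpha>') \<bullet> (F \<triangleright> \<alpha>)))"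
        unfolding e by (simp add: n)
      also have "\<dots> = (\<alpha> \<star> \<alpha>) \<bullet> snd P"
        unfolding s c by (simp add: n)
      finally show "snd P \<bullet> (\<alpha> \<star> \<alpha>) = (\<alpha> \<star> \<alpha>) \<bullet> snd P" .
    next
      assume e: "snd P \<bullet> (\<alpha> \<star> \<alpha>) = (\<alpha> \<star> \<alpha>) \<bullet> snd P"
      have "(\<alpha>' \<triangleleft> F) \<bullet> snd P \<bullet> (\<alpha> \<triangleleft> F) = (\<alpha>' \<triangleleft> F) \<bullet> (snd P \<bullet> ((\<alpha> \<triangleleft> F) \<bullet> ((F \<triangleright> \<alpha>) \<bullet> (F \<triangleright> \<alpha>'))))"
        unfolding c by (simp add: n)
      also have "\<dots> = (\<alpha>' \<triangleleft> F) \<bullet> ((snd P \<bullet> (\<alpha> \<star> \<alpha>)) \<bullet> (F \<triangleright> \<alpha>'))"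
        unfolding s(1)[symmetric] by (simp add: n)
      also have "\<dots> = ((\<alpha>' \<triangleleft> F) \<bullet> (\<alpha> \<triangleleft> F)) \<bullet> (F \<triangleright> \<alpha>) \<bullet> snd P \<bullet> (F \<triangleright> \<alpha>')"
        unfolding e unfolding s(1)[symmetric] by (simp add: n)
      also have "\<dots> = (F \<triangleright> \<alpha>) \<bullet> snd P \<bullet> (F \<triangleright> \<alpha>')"
        unfolding c by (simp add: n)
      finally show "(\<alpha>' \<triangleleft> F) \<bullet> snd P \<bullet> (\<alpha> \<triangleleft> F) = (F \<triangleright> \<alpha>) \<bullet> snd P \<bullet> (F \<triangleright> \<alpha>')" .
    qed
  qed
  then show ?thesis
    unfolding Aut0_def Let_def F_def[symmetric] by simp blast
qed

text \<open>Over the identity 1-cell all whiskerings with X disappear, and the axioms of a monad or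
  comonad 1-cell become the statements that \<alpha> respects multiplication and unit, or
  comultiplication and counit.\<close>

lemma Aut0_1cells:
  assumes P: "is_bimonad K P" and \<alpha>: "\<alpha> \<in> carrier (Aut0 K P)"
  shows "mnd_1cell K (fst P) (fst P) (id1 K (base (fst P))) \<alpha>"
    "comnd_1cell K (fst P) (fst P) (id1 K (base (fst P))) \<alpha>"
proof -
  have "typed_structure (fst P)"
    using bimnd_data_bimonad[OF P] by (simp add: bimnd_data_def)
  note t = typed_structureD[OF this]
  have h: "\<alpha> \<in> cells2 K" "src2 K \<alpha> = endo (fst P)" "trg2 K \<alpha> = endo (fst P)"
    "\<alpha> \<bullet> mu (fst P) = mu (fst P) \<bullet> (\<alpha> \<star> \<alpha>)" "\<alpha> \<bullet> eta (fst P) = eta (fst P)"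
    "Delta (fst P) \<bullet> \<alpha> = (\<alpha> \<star> \<alpha>) \<bullet> Delta (fst P)" "eps (fst P) \<bullet> \<alpha> = eps (fst P)"
    using \<alpha> unfolding Aut0_carrier_iff[OF P] hom2_iff by blast+
  show "mnd_1cell K (fst P) (fst P) (id1 K (base (fst P))) \<alpha>"
    by (simp add: mnd_1cell_def hom1_iff hom2_iff typing t h vcomp_assoc' slide(2))
  show "comnd_1cell K (fst P) (fst P) (id1 K (base (fst P))) \<alpha>"
    using slide[of \<alpha> \<alpha> "endo (fst P)" "endo (fst P)" "endo (fst P)" "endo (fst P)"]
    by (simp add: comnd_1cell_def hom1_iff hom2_iff typing t h)
qed

lemma Aut0_simps: "\<one>\<^bsub>Aut0 K P\<^esub> = id2 K (endo (fst P))" "\<alpha> \<otimes>\<^bsub>Aut0 K P\<^esub> \<beta> = \<alpha> \<bullet> \<beta>"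
  by (simp_all add: Aut0_def Let_def)

lemma typed_bimonad:
  assumes "is_bimonad K P" shows "typed_structure (fst P)"
  using bimnd_data_bimonad[OF assms] by (simp add: bimnd_data_def)

lemma group_Aut0:
  assumes P: "is_bimonad K P"
  shows "group (Aut0 K P)"
proof -
  define F where "F = endo (fst P)"
  note t = bimnd_dataD[OF bimnd_data_bimonad[OF P], folded F_def]
    typed_structureD[OF typed_bimonad[OF P], folded F_def]
  note iff = Aut0_carrier_iff[OF P, folded F_def]
  note n = typing t vcomp_assoc' interchange'
  \<comment> \<open>By interchange, squaring horizontally is multiplicative; each closure condition
    then follows by passing \<beta> and \<alpha> through one after the other.\<close>
  have sq: "(\<alpha> \<star> \<alpha>) \<bullet> (\<beta> \<star> \<beta>) = (\<alpha> \<bullet> \<beta>) \<star> (\<alpha> \<bullet> \<beta>)" if "\<alpha> \<in> hom2 K F F" "\<beta> \<in> hom2 K F F" for \<alpha> \<beta>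
    using that by (simp add: n hom2_iff)
  show ?thesis
  proof (rule groupI)
    fix \<alpha> \<beta> assume "\<alpha> \<in> carrier (Aut0 K P)" "\<beta> \<in> carrier (Aut0 K P)"
    then obtain \<alpha>' \<beta>' where a: "\<alpha> \<in> hom2 K F F" "\<beta> \<in> hom2 K F F" "\<alpha>' \<in> hom2 K F F" "\<beta>' \<in> hom2 K F F"
      and i: "\<alpha> \<bullet> \<alpha>' = id2 K F" "\<alpha>' \<bullet> \<alpha> = id2 K F" "\<beta> \<bullet> \<beta>' = id2 K F" "\<beta>' \<bullet> \<beta> = id2 K F"
      and \<alpha>: "\<alpha> \<bullet> mu (fst P) = mu (fst P) \<bullet> (\<alpha> \<star> \<alpha>)" "\<alpha> \<bullet> eta (fst P) = eta (fst P)"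
        "Delta (fst P) \<bullet> \<alpha> = (\<alpha> \<star> \<alpha>) \<bullet> Delta (fst P)" "eps (fst P) \<bullet> \<alpha> = eps (fst P)"
        "snd P \<bullet> (\<alpha> \<star> \<alpha>) = (\<alpha> \<star> \<alpha>) \<bullet> snd P"
      and \<beta>: "\<beta> \<bullet> mu (fst P) = mu (fst P) \<bullet> (\<beta> \<star> \<beta>)" "\<beta> \<bullet> eta (fst P) = eta (fst P)"
        "Delta (fst P) \<bullet> \<beta> = (\<beta> \<star> \<beta>) \<bullet> Delta (fst P)" "eps (fst P) \<bullet> \<beta> = eps (fst P)"
        "snd P \<bullet> (\<beta> \<star> \<beta>) = (\<beta> \<star> \<beta>) \<bullet> snd P"
      unfolding iff by blast
    note ta = a[unfolded hom2_iff]
    note m = typing t ta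
    have 1: "(\<alpha> \<bullet> \<beta>) \<bullet> (\<beta>' \<bullet> \<alpha>') = id2 K F" "(\<beta>' \<bullet> \<alpha>') \<bullet> (\<alpha> \<bullet> \<beta>) = id2 K F"
      by (simp_all add: m vcomp_assoc' vcomp_rest[OF i(3)] vcomp_rest[OF i(2)] i)
    have 2: "\<alpha> \<bullet> \<beta> \<bullet> mu (fst P) = mu (fst P) \<bullet> ((\<alpha> \<bullet> \<beta>) \<star> (\<alpha> \<bullet> \<beta>))"
      unfolding sq[OF a(1,2), symmetric]
      by (simp add: m vcomp_assoc' \<beta> vcomp_rest[OF \<alpha>(1)])
    have 3: "\<alpha> \<bullet> \<beta> \<bullet> eta (fst P) = eta (fst P)" "eps (fst P) \<bullet> (\<alpha> \<bullet> \<beta>) = eps (fst P)"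
      by (simp_all add: m vcomp_assoc' \<alpha> \<beta> vcomp_rest[OF \<alpha>(4)])
    have 4: "Delta (fst P) \<bullet> (\<alpha> \<bullet> \<beta>) = ((\<alpha> \<bullet> \<beta>) \<star> (\<alpha> \<bullet> \<beta>)) \<bullet> Delta (fst P)"
      unfolding sq[OF a(1,2), symmetric]
      by (simp add: m vcomp_assoc' \<beta> vcomp_rest[OF \<alpha>(3)])
    have 5: "snd P \<bullet> ((\<alpha> \<bullet> \<beta>) \<star> (\<alpha> \<bullet> \<beta>)) = ((\<alpha> \<bullet> \<beta>) \<star> (\<alpha> \<bullet> \<beta>)) \<bullet> snd P"
      unfolding sq[OF a(1,2), symmetric]
      by (simp add: m vcomp_assoc' \<beta> vcomp_rest[OF \<alpha>(5)])
    show "\<alpha> \<otimes>\<^bsub>Aut0 K P\<^esub> \<beta> \<in> carrier (Aut0 K P)"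
      unfolding iff Aut0_simps using 1 2 3 4 5 a vcomp_hom2 by blast
  next
    show "\<one>\<^bsub>Aut0 K P\<^esub> \<in> carrier (Aut0 K P)"
      unfolding iff Aut0_simps F_def[symmetric] by (auto simp: hom2_iff n)
  next
    fix \<alpha> \<beta> \<gamma> assume "\<alpha> \<in> carrier (Aut0 K P)" "\<beta> \<in> carrier (Aut0 K P)" "\<gamma> \<in> carrier (Aut0 K P)"
    then show "\<alpha> \<otimes>\<^bsub>Aut0 K P\<^esub> \<beta> \<otimes>\<^bsub>Aut0 K P\<^esub> \<gamma> = \<alpha> \<otimes>\<^bsub>Aut0 K P\<^esub> (\<beta> \<otimes>\<^bsub>Aut0 K P\<^esub> \<gamma>)"
      by (simp add: iff Aut0_simps hom2_iff n)
  next
    fix \<alpha> assume "\<alpha> \<in> carrier (Aut0 K P)"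
    then show "\<one>\<^bsub>Aut0 K P\<^esub> \<otimes>\<^bsub>Aut0 K P\<^esub> \<alpha> = \<alpha>"
      by (simp add: iff Aut0_simps hom2_iff n F_def[symmetric])
  next
    fix \<alpha> assume "\<alpha> \<in> carrier (Aut0 K P)"
    then obtain \<alpha>' where a: "\<alpha> \<in> hom2 K F F" "\<alpha>' \<in> hom2 K F F"
      and i: "\<alpha> \<bullet> \<alpha>' = id2 K F" "\<alpha>' \<bullet> \<alpha> = id2 K F"
      and \<alpha>: "\<alpha> \<bullet> mu (fst P) = mu (fst P) \<bullet> (\<alpha> \<star> \<alpha>)" "\<alpha> \<bullet> eta (fst P) = eta (fst P)"
        "Delta (fst P) \<bullet> \<alpha> = (\<alpha> \<star> \<alpha>) \<bullet> Delta (fst P)" "eps (fst P) \<bullet> \<alpha> = eps (fst P)"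
        "snd P \<bullet> (\<alpha> \<star> \<alpha>) = (\<alpha> \<star> \<alpha>) \<bullet> snd P"
      unfolding iff by blast
    note ta = a[unfolded hom2_iff]
    note m = typing t ta
    have s: "(\<alpha> \<star> \<alpha>) \<bullet> (\<alpha>' \<star> \<alpha>') = id2 K (F \<cdot> F)" "(\<alpha>' \<star> \<alpha>') \<bullet> (\<alpha> \<star> \<alpha>) = id2 K (F \<cdot> F)"
      by (simp_all add: m interchange' i)
    \<comment> \<open>An intertwining relation for invertible cells passes to their inverses. It
      serves three times below, for multiplication, comultiplication and \<lambda>.\<close>
    have c: "g \<bullet> b' = a' \<bullet> g"
      if "a \<bullet> g = g \<bullet> b" "b \<bullet> b' = id2 K Y" "a' \<bullet> a = id2 K X" "g \<in> hom2 K Y X"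
        "a \<in> hom2 K X X" "a' \<in> hom2 K X X" "b \<in> hom2 K Y Y" "b' \<in> hom2 K Y Y" for a b a' b' g X Y
    proof -
      note h = that(4-8)[unfolded hom2_iff]
      have "g \<bullet> b' = (a' \<bullet> a) \<bullet> (g \<bullet> b')" using that(3) h by (simp add: typing)
      also have "\<dots> = a' \<bullet> ((a \<bullet> g) \<bullet> b')" using h by (simp add: typing vcomp_assoc')
      also have "\<dots> = a' \<bullet> g" unfolding that(1) using h that(2) by (simp add: typing vcomp_assoc')
      finally show ?thesis .
    qed
    have h: "\<alpha> \<star> \<alpha> \<in> hom2 K (F \<cdot> F) (F \<cdot> F)" "\<alpha>' \<star> \<alpha>' \<in> hom2 K (F \<cdot> F) (F \<cdot> F)"
      "mu (fst P) \<in> hom2 K (F \<cdot> F) F" "Delta (fst P) \<in> hom2 K F (F \<cdot> F)" "snd P \<in> hom2 K (F \<cdot> F) (F \<cdot> F)"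
      by (simp_all add: hom2_iff m)
    have "mu (fst P) \<bullet> (\<alpha>' \<star> \<alpha>') = \<alpha>' \<bullet> mu (fst P)"
      by (rule c[OF \<alpha>(1) s(1) i(2)]) (fact a h)+
    moreover have "(\<alpha>' \<star> \<alpha>') \<bullet> Delta (fst P) = Delta (fst P) \<bullet> \<alpha>'"
      by (rule c[OF \<alpha>(3)[symmetric] i(1) s(2), symmetric]) (fact a h)+
    moreover have "snd P \<bullet> (\<alpha>' \<star> \<alpha>') = (\<alpha>' \<star> \<alpha>') \<bullet> snd P"
      by (rule c[OF \<alpha>(5)[symmetric] s]) (fact a h)+
    moreover have "\<alpha>' \<bullet> (\<alpha> \<bullet> eta (fst P)) = eta (fst P)" "eps (fst P) \<bullet> \<alpha> \<bullet> \<alpha>' = eps (fst P)"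
      by (simp_all add: m i vcomp_assoc' vcomp_rest[OF i(2)])
    ultimately have "\<alpha>' \<in> carrier (Aut0 K P)"
      unfolding iff using a i \<alpha>(2,4) by simp blast
    then show "\<exists>\<beta>\<in>carrier (Aut0 K P). \<beta> \<otimes>\<^bsub>Aut0 K P\<^esub> \<alpha> = \<one>\<^bsub>Aut0 K P\<^esub>"
      unfolding Aut0_simps F_def[symmetric] using i by blast
  qed
qed

text \<open>Obtained by cancelling in the relation of \<lambda> with
  \<open>\<alpha> \<star> \<alpha>\<close>. The two sides are the 2-cells that the composite of (id,
  \<alpha>), (F, \<lambda>) and (id, \<alpha>^-1) carries as a comonad 1-cell and as a monad 1-cell;
  their equality lets a single \<lambda>_\<alpha> be both.\<close>

lemma lambda_conj_swap:
  assumes P: "is_bimonad K P" and \<alpha>: "\<alpha> \<in> carrier (Aut0 K P)"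
  defines "E \<equiv> endo (fst P)" and "\<alpha>' \<equiv> inv\<^bsub>Aut0 K P\<^esub> \<alpha>"
  shows "(\<alpha> \<triangleleft> E) \<bullet> snd P \<bullet> (E \<triangleright> \<alpha>') = (E \<triangleright> \<alpha>') \<bullet> snd P \<bullet> (\<alpha> \<triangleleft> E)"
proof -
  interpret group "Aut0 K P" by (rule group_Aut0[OF P])
  have \<alpha>': "\<alpha>' \<in> carrier (Aut0 K P)" unfolding \<alpha>'_def using \<alpha> by simp
  have i: "\<alpha> \<bullet> \<alpha>' = id2 K E" "\<alpha>' \<bullet> \<alpha> = id2 K E"
    using r_inv[OF \<alpha>] l_inv[OF \<alpha>] by (simp_all add: Aut0_simps \<alpha>'_def E_def)
  have h: "\<alpha> \<in> cells2 K" "src2 K \<alpha> = E" "trg2 K \<alpha> = E" "\<alpha>' \<in> cells2 K" "src2 K \<alpha>' = E" "trg2 K \<alpha>' = E"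
    and l: "snd P \<bullet> (\<alpha> \<star> \<alpha>) = (\<alpha> \<star> \<alpha>) \<bullet> snd P"
    using \<alpha> \<alpha>' unfolding Aut0_carrier_iff[OF P] hom2_iff E_def by blast+
  note t = bimnd_dataD[OF bimnd_data_bimonad[OF P], folded E_def] h
  note n = typing t vcomp_assoc'
  have s: "(E \<triangleright> \<alpha>') \<bullet> (\<alpha> \<star> \<alpha>) = \<alpha> \<triangleleft> E" "(\<alpha> \<star> \<alpha>) \<bullet> (E \<triangleright> \<alpha>') = \<alpha> \<triangleleft> E"
    by (simp_all add: interchange' n i)
  have "(\<alpha> \<triangleleft> E) \<bullet> snd P \<bullet> (E \<triangleright> \<alpha>') = (E \<triangleright> \<alpha>') \<bullet> (((\<alpha> \<star> \<alpha>) \<bullet> snd P) \<bullet> (E \<triangleright> \<alpha>'))"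
    unfolding s(1)[symmetric] by (simp add: n)
  also have "\<dots> = (E \<triangleright> \<alpha>') \<bullet> (snd P \<bullet> ((\<alpha> \<star> \<alpha>) \<bullet> (E \<triangleright> \<alpha>')))"
    unfolding l[symmetric] by (simp add: n)
  also have "\<dots> = (E \<triangleright> \<alpha>') \<bullet> snd P \<bullet> (\<alpha> \<triangleleft> E)"
    unfolding s(2) by (simp add: n)
  finally show ?thesis .
qed

text \<open>The family is forced: \<beta> = e in the defining equation of a 0-cell gives
  \<lambda>_\<alpha> = (\<alpha> F) \<lambda> (F \<alpha>^-1). It remains to see that this family
  satisfies the equation for all \<beta>, so that every bimonad is the part F_e of some
  0-cell.\<close>

lemma bimonad_is_unit_part:
  assumes P: "is_bimonad K P"
  shows "\<exists>F\<in>bimndT_cells0 K. unit_part K F = P"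
proof -
  let ?G = "Aut0 K P"
  define S where "S = fst P"
  define E where "E = endo S"
  define l where "l = snd P"
  \<comment> \<open>Restricted to the carrier because the family of a 0-cell is required to be
    extensional.\<close>
  define \<Lambda> where "\<Lambda> = (\<lambda>\<alpha>\<in>carrier ?G. (\<alpha> \<triangleleft> E) \<bullet> l \<bullet> (E \<triangleright> inv\<^bsub>?G\<^esub> \<alpha>))"
  interpret group ?G by (rule group_Aut0[OF P])
  have S: "typed_structure S" using typed_bimonad[OF P] by (simp add: S_def)
  note t = typed_structureD[OF S, folded E_def] bimnd_dataD[OF bimnd_data_bimonad[OF P], folded S_def, folded E_def l_def]
  have a: "\<alpha> \<in> cells2 K" "src2 K \<alpha> = E" "trg2 K \<alpha> = E" if "\<alpha> \<in> carrier ?G" for \<alpha>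
    using that unfolding Aut0_carrier_iff[OF P] hom2_iff E_def S_def by blast+
  have one: "\<one>\<^bsub>?G\<^esub> = id2 K E" by (simp add: Aut0_simps E_def S_def)
  have \<Lambda>1: "\<Lambda> (id2 K E) = l"
    using one_closed inv_one by (simp add: \<Lambda>_def one typing t)
  have u: "unit_part K (S, \<Lambda>) = P"
    by (simp add: unit_part_def part_at_def E_def[symmetric] \<Lambda>1) (simp add: S_def l_def)
  then have G: "autT K (S, \<Lambda>) = ?G" by (simp add: autT_def)
  have L: "mnd_1cell K S S E l" "comnd_1cell K S S E l"
    using P unfolding is_bimonad_def Let_def S_def E_def l_def by blast+
  have "mnd_1cell K S S E (\<Lambda> \<alpha>)" "comnd_1cell K S S E (\<Lambda> \<alpha>)" if \<alpha>: "\<alpha> \<in> carrier ?G" for \<alpha>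
  proof -
    have \<alpha>': "inv\<^bsub>?G\<^esub> \<alpha> \<in> carrier ?G" using \<alpha> by simp
    note c = Aut0_1cells[OF P \<alpha>, folded S_def] Aut0_1cells[OF P \<alpha>', folded S_def]
    note n = typing t a[OF \<alpha>] a[OF \<alpha>'] vcomp_assoc'
    have e: "\<Lambda> \<alpha> = (\<alpha> \<triangleleft> E) \<bullet> l \<bullet> (E \<triangleright> inv\<^bsub>?G\<^esub> \<alpha>)" using \<alpha> by (simp add: \<Lambda>_def)
    \<comment> \<open>Composing monad 1-cells yields the factors in this order;
      \<open>lambda_conj_swap\<close> then rewrites it to the order of \<open>\<Lambda>\<close>,
      which the comonad composite has from the start.\<close>
    have "mnd_1cell K S S E ((E \<triangleright> inv\<^bsub>?G\<^esub> \<alpha>) \<bullet> l \<bullet> (\<alpha> \<triangleleft> E))"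
      using mnd_1cell_comp[OF S S S c(1) mnd_1cell_comp[OF S S S L(1) c(3)]] by (simp add: n)
    then show "mnd_1cell K S S E (\<Lambda> \<alpha>)"
      unfolding e using lambda_conj_swap[OF P \<alpha>, folded S_def, folded E_def l_def] by simp
    show "comnd_1cell K S S E (\<Lambda> \<alpha>)"
      unfolding e using comnd_1cell_comp[OF S S S c(2) comnd_1cell_comp[OF S S S L(2) c(4)]] by (simp add: n)
  qed
  moreover have "\<Lambda> (\<alpha> \<otimes>\<^bsub>?G\<^esub> \<beta>) = (\<alpha> \<star> inv\<^bsub>?G\<^esub> \<beta>) \<bullet> \<Lambda> \<one>\<^bsub>?G\<^esub> \<bullet> (\<beta> \<star> inv\<^bsub>?G\<^esub> \<alpha>)"
    if \<alpha>: "\<alpha> \<in> carrier ?G" and \<beta>: "\<beta> \<in> carrier ?G" for \<alpha> \<beta>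
  proof -
    define \<alpha>' \<beta>' where "\<alpha>' = inv\<^bsub>?G\<^esub> \<alpha>" and "\<beta>' = inv\<^bsub>?G\<^esub> \<beta>"
    have c: "\<alpha>' \<in> carrier ?G" "\<beta>' \<in> carrier ?G" using \<alpha> \<beta> by (simp_all add: \<alpha>'_def \<beta>'_def)
    note n = t a[OF \<alpha>] a[OF \<beta>] a[OF c(1)] a[OF c(2)]
    have s: "(\<alpha> \<triangleleft> E) \<bullet> (E \<triangleright> \<beta>') = \<alpha> \<star> \<beta>'" "(\<beta> \<triangleleft> E) \<bullet> (E \<triangleright> \<alpha>') = \<beta> \<star> \<alpha>'"
      by (simp_all add: interchange' typing n)
    have "\<Lambda> (\<alpha> \<otimes>\<^bsub>?G\<^esub> \<beta>) = ((\<alpha> \<otimes>\<^bsub>?G\<^esub> \<beta>) \<triangleleft> E) \<bullet> l \<bullet> (E \<triangleright> (\<beta>' \<otimes>\<^bsub>?G\<^esub> \<alpha>'))"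
      using \<alpha> \<beta> m_closed[OF \<alpha> \<beta>] by (simp add: \<Lambda>_def inv_mult_group \<alpha>'_def \<beta>'_def)
    also have "\<dots> = (\<alpha> \<triangleleft> E) \<bullet> ((\<beta> \<triangleleft> E) \<bullet> l \<bullet> (E \<triangleright> \<beta>')) \<bullet> (E \<triangleright> \<alpha>')"
      by (simp add: Aut0_simps normal_form n)
    \<comment> \<open>After the swap \<beta>' stands next to \<alpha> and \<beta> next to \<alpha>',
      so that they combine to \<alpha> \<star> \<beta>' and \<beta> \<star> \<alpha>'.\<close>
    also have "(\<beta> \<triangleleft> E) \<bullet> l \<bullet> (E \<triangleright> \<beta>') = (E \<triangleright> \<beta>') \<bullet> l \<bullet> (\<beta> \<triangleleft> E)"
      using lambda_conj_swap[OF P \<beta>, folded S_def, folded E_def l_def \<beta>'_def] .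
    also have "(\<alpha> \<triangleleft> E) \<bullet> \<dots> \<bullet> (E \<triangleright> \<alpha>') = ((\<alpha> \<triangleleft> E) \<bullet> (E \<triangleright> \<beta>')) \<bullet> l \<bullet> ((\<beta> \<triangleleft> E) \<bullet> (E \<triangleright> \<alpha>'))"
      by (simp add: normal_form n)
    finally show ?thesis
      unfolding s by (simp add: \<alpha>'_def \<beta>'_def one \<Lambda>1)
  qed
  ultimately have "(S, \<Lambda>) \<in> bimndT_cells0 K"
    using P by (simp add: bimndT_cells0_def Let_def u G E_def[symmetric]) (simp add: \<Lambda>_def)
  with u show ?thesis by blast
qed

end

text \<open>Since cells record their end points, selecting the cells of \<open>Bimnd K\<close> by
  source and target returns exactly \<open>bimnd_hom_cat\<close>; if R fails there is nothing to
  select.\<close>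

lemma hom_cat_sub_Bimnd:
  assumes P: "P \<in> J" "P' \<in> J" and J: "J \<subseteq> Collect (is_bimonad K)"
  shows "hom_cat (sub_two_cat (Bimnd K) J R) P P' =
    (let C = bimnd_hom_cat K P P' in if R P P' then C else C\<lparr> Ob := {}, Ar := {} \<rparr>)"
proof -
  have b: "is_bimonad K P" "is_bimonad K P'" using P J by auto
  have h: "hom1 (sub_two_cat (Bimnd K) J R) P P' = (if R P P' then bimnd_1cells K P P' else {})"
  proof -
    have "X \<in> hom1 (sub_two_cat (Bimnd K) J R) P P' \<longleftrightarrow> X \<in> hom1 (Bimnd K) P P' \<and> R P P'" for X
      using P by (auto simp: hom1_def sub_two_cat_simps)
    then show ?thesis
      using b unfolding Bimnd_eq_Bimnd_on hom1_Bimnd_on_iff by auto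
  qed
  have "{z \<in> cells2 (sub_two_cat (Bimnd K) J R). fst z \<in> hom1 (sub_two_cat (Bimnd K) J R) P P'
      \<and> snd (snd z) \<in> hom1 (sub_two_cat (Bimnd K) J R) P P'} = (if R P P' then bimnd_2cells K P P' else {})" (is "?A = ?B")
  proof (intro equalityI subsetI)
    fix z assume z: "z \<in> ?A"
    then have R: "R P P'" and e: "fst z \<in> bimnd_1cells K P P'" by (auto simp: h split: if_splits)
    from z have "z \<in> cells2 (Bimnd K)" by (simp add: sub_two_cat_simps)
    then obtain Q Q' where Q: "z \<in> bimnd_2cells K Q Q'"
      unfolding Bimnd_eq_Bimnd_on Bimnd_on_simps by blast
    have "Q = P" "Q' = P'"
      using bimnd_1cells_ends[OF bimnd_2cells_ends(1)[OF Q]] bimnd_1cells_ends[OF e] by auto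
    with Q R show "z \<in> ?B" by simp
  next
    fix z assume "z \<in> ?B"
    then have R: "R P P'" and z: "z \<in> bimnd_2cells K P P'" by (auto split: if_splits)
    note e = bimnd_2cells_ends[OF z]
    have "z \<in> cells2 (Bimnd K)"
      using b z unfolding Bimnd_eq_Bimnd_on Bimnd_on_simps by blast
    moreover have h': "fst z \<in> hom1 (sub_two_cat (Bimnd K) J R) P P'" "snd (snd z) \<in> hom1 (sub_two_cat (Bimnd K) J R) P P'"
      using e R by (simp_all add: h)
    moreover have "src2 (Bimnd K) = fst" "trg2 (Bimnd K) = (\<lambda>z. snd (snd z))"
      by (simp_all add: Bimnd_def)
    ultimately show "z \<in> ?A"
      unfolding sub_two_cat_simps(3) by (simp add: hom1_def)
  qed
  then show ?thesis
    using h by (simp add: hom_cat_def bimnd_hom_cat_def Let_def sub_two_cat_simps Bimnd_def)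
qed

section \<open>The transitive system of groups\<close>

locale fused_two_category = two_category K for K :: "('o, 'm, 'c) two_cat" (structure) +
  fixes j :: "('o, 'm, 'c) bimnd \<Rightarrow> ('o, 'm, 'c) bimnd \<Rightarrow> 'c \<Rightarrow> 'c"
  assumes fusion: "fusion_maps K j"
begin

abbreviation T where "T \<equiv> bimndT_cells0 K"
abbreviation GF where "GF F \<equiv> autT K F"
abbreviation grp where "grp \<equiv> bimndT_grp K j"
abbreviation fs where "fs \<equiv> fus K j"
abbreviation multT where "multT \<equiv> bimndT_mult K j"
abbreviation comp1T where "comp1T \<equiv> bimndT_comp1 K j"
abbreviation compT where "compT \<equiv> bimndT_comp K j"
abbreviation actT where "actT \<equiv> bimndT_act K j"
abbreviation homT where "homT \<equiv> bimndT_hom K j"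
abbreviation partT where "partT \<equiv> bimndT_part K"
abbreviation prT1 where "prT1 \<equiv> bimndT_pr1 K j"
abbreviation prT2 where "prT2 \<equiv> bimndT_pr2 K j"

lemma is_bimonad_unit_part: "F \<in> T \<Longrightarrow> is_bimonad K (unit_part K F)"
  by (simp add: bimndT_cells0_def Let_def)

lemma group_autT: "F \<in> T \<Longrightarrow> group (GF F)"
  unfolding autT_def by (rule group_Aut0[OF is_bimonad_unit_part])

lemma fus_hom:
  assumes "F \<in> T" "F' \<in> T" "GF F \<cong> GF F'"
  shows "fs F F' \<in> hom (GF F) (GF F')"
  using fusion is_bimonad_unit_part[OF assms(1)] is_bimonad_unit_part[OF assms(2)] assms(3)
  unfolding fusion_maps_def fus_def autT_def iso_def by blast

lemma fus_self: "F \<in> T \<Longrightarrow> x \<in> carrier (GF F) \<Longrightarrow> fs F F x = x"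
  using fusion is_bimonad_unit_part unfolding fusion_maps_def fus_def autT_def by blast

lemma fus_fus:
  assumes "F \<in> T" "F' \<in> T" "F'' \<in> T" "GF F \<cong> GF F'" "GF F' \<cong> GF F''" "x \<in> carrier (GF F)"
  shows "fs F' F'' (fs F F' x) = fs F F'' x"
proof -
  have "is_bimonad K (unit_part K F) \<and> is_bimonad K (unit_part K F') \<and> is_bimonad K (unit_part K F'')
      \<and> Aut0 K (unit_part K F) \<cong> Aut0 K (unit_part K F') \<and> Aut0 K (unit_part K F') \<cong> Aut0 K (unit_part K F'')"
    using is_bimonad_unit_part assms unfolding autT_def by blast
  then show ?thesis
    using fusion assms(6) unfolding fusion_maps_def fus_def autT_def by metis
qed

lemma autT_iso_sym: "F \<in> T \<Longrightarrow> GF F \<cong> GF F' \<Longrightarrow> GF F' \<cong> GF F"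
  using group.iso_sym[OF group_autT] .

text \<open>Normal form for words in one group: products nest to the right and inverses stand at the
  letters. The last two rules cancel a letter against a neighbouring inverse inside a longer
  word.\<close>

lemma autT_simps:
  assumes "F \<in> T"
  shows "\<one>\<^bsub>GF F\<^esub> \<in> carrier (GF F)"
    "x \<in> carrier (GF F) \<Longrightarrow> inv\<^bsub>GF F\<^esub> x \<in> carrier (GF F)"
    "x \<in> carrier (GF F) \<Longrightarrow> y \<in> carrier (GF F) \<Longrightarrow> x \<otimes>\<^bsub>GF F\<^esub> y \<in> carrier (GF F)"
    "x \<in> carrier (GF F) \<Longrightarrow> y \<in> carrier (GF F) \<Longrightarrow> z \<in> carrier (GF F)
      \<Longrightarrow> x \<otimes>\<^bsub>GF F\<^esub> y \<otimes>\<^bsub>GF F\<^esub> z = x \<otimes>\<^bsub>GF F\<^esub> (y \<otimes>\<^bsub>GF F\<^esub> z)"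
    "x \<in> carrier (GF F) \<Longrightarrow> y \<in> carrier (GF F)
      \<Longrightarrow> inv\<^bsub>GF F\<^esub> (x \<otimes>\<^bsub>GF F\<^esub> y) = inv\<^bsub>GF F\<^esub> y \<otimes>\<^bsub>GF F\<^esub> inv\<^bsub>GF F\<^esub> x"
    "x \<in> carrier (GF F) \<Longrightarrow> inv\<^bsub>GF F\<^esub> (inv\<^bsub>GF F\<^esub> x) = x" "inv\<^bsub>GF F\<^esub> \<one>\<^bsub>GF F\<^esub> = \<one>\<^bsub>GF F\<^esub>"
    "x \<in> carrier (GF F) \<Longrightarrow> \<one>\<^bsub>GF F\<^esub> \<otimes>\<^bsub>GF F\<^esub> x = x" "x \<in> carrier (GF F) \<Longrightarrow> x \<otimes>\<^bsub>GF F\<^esub> \<one>\<^bsub>GF F\<^esub> = x"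
    "x \<in> carrier (GF F) \<Longrightarrow> inv\<^bsub>GF F\<^esub> x \<otimes>\<^bsub>GF F\<^esub> x = \<one>\<^bsub>GF F\<^esub>"
    "x \<in> carrier (GF F) \<Longrightarrow> x \<otimes>\<^bsub>GF F\<^esub> inv\<^bsub>GF F\<^esub> x = \<one>\<^bsub>GF F\<^esub>"
    "x \<in> carrier (GF F) \<Longrightarrow> y \<in> carrier (GF F) \<Longrightarrow> x \<otimes>\<^bsub>GF F\<^esub> (inv\<^bsub>GF F\<^esub> x \<otimes>\<^bsub>GF F\<^esub> y) = y"
    "x \<in> carrier (GF F) \<Longrightarrow> y \<in> carrier (GF F) \<Longrightarrow> inv\<^bsub>GF F\<^esub> x \<otimes>\<^bsub>GF F\<^esub> (x \<otimes>\<^bsub>GF F\<^esub> y) = y"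
  using assms by (simp_all add: group_autT group.is_monoid monoid.one_closed monoid.m_closed monoid.m_assoc
      monoid.l_one monoid.r_one group.inv_closed group.inv_mult_group group.inv_inv monoid.inv_one group.l_inv
      group.r_inv group.inv_cancel)

lemma group_hom_fus:
  assumes "F \<in> T" "F' \<in> T" "GF F \<cong> GF F'"
  shows "group_hom (GF F) (GF F') (fs F F')"
  using group_autT assms fus_hom by (simp add: group_hom_def group_hom_axioms_def)

lemma fus_simps:
  assumes "F \<in> T" "F' \<in> T" "GF F \<cong> GF F'"
  shows "x \<in> carrier (GF F) \<Longrightarrow> fs F F' x \<in> carrier (GF F')"
    "x \<in> carrier (GF F) \<Longrightarrow> y \<in> carrier (GF F) \<Longrightarrow> fs F F' (x \<otimes>\<^bsub>GF F\<^esub> y) = fs F F' x \<otimes>\<^bsub>GF F'\<^esub> fs F F' y"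
    "x \<in> carrier (GF F) \<Longrightarrow> fs F F' (inv\<^bsub>GF F\<^esub> x) = inv\<^bsub>GF F'\<^esub> fs F F' x"
    "fs F F' \<one>\<^bsub>GF F\<^esub> = \<one>\<^bsub>GF F'\<^esub>"
  using group_hom_fus[OF assms]
  by (simp_all add: group_hom.hom_closed group_hom.hom_mult group_hom.hom_inv group_hom.hom_one)

text \<open>A chain of fusion maps collapses to one by \<open>fus_fus\<close>; a round trip ends in
  a map from a group to itself, which \<open>fus_self\<close> removes.\<close>

lemmas word_simps = autT_simps fus_simps fus_fus fus_self

lemma grp_iso:
  assumes "GF F \<cong> GF F'"
  shows "carrier (grp F F') = carrier (GF F') \<times> carrier (GF F)"
    "(\<alpha>, \<beta>) \<otimes>\<^bsub>grp F F'\<^esub> (\<gamma>, \<delta>) = (\<alpha> \<otimes>\<^bsub>GF F'\<^esub> \<gamma>,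
       \<delta> \<otimes>\<^bsub>GF F\<^esub> fs F' F (inv\<^bsub>GF F'\<^esub> \<gamma>) \<otimes>\<^bsub>GF F\<^esub> \<beta> \<otimes>\<^bsub>GF F\<^esub> fs F' F \<gamma>)"
  using assms by (simp_all add: bimndT_grp_def Let_def)

lemma grp_one: "\<one>\<^bsub>grp F F'\<^esub> = (\<one>\<^bsub>GF F'\<^esub>, \<one>\<^bsub>GF F\<^esub>)"
  by (simp add: bimndT_grp_def Let_def)

lemma grp_non_iso:
  assumes "\<not> GF F \<cong> GF F'"
  shows "carrier (grp F F') = {\<one>\<^bsub>grp F F'\<^esub>}" "x \<otimes>\<^bsub>grp F F'\<^esub> y = \<one>\<^bsub>grp F F'\<^esub>"
  using assms by (simp_all add: bimndT_grp_def Let_def)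

text \<open>With the two groups identified by the fusion map, (\<alpha>, \<beta>) \<mapsto>
  (\<alpha>, \<alpha> \<beta>^-1) turns the product into the componentwise one. The proof checks the
  axioms directly as equalities of words.\<close>

lemma group_grp:
  assumes F: "F \<in> T" "F' \<in> T"
  shows "group (grp F F')"
proof (cases "GF F \<cong> GF F'")
  case True
  note i = True autT_iso_sym[OF F(1) True]
  show ?thesis
  proof (rule groupI)
    fix x assume "x \<in> carrier (grp F F')"
    then obtain \<alpha> \<beta> where x: "x = (\<alpha>, \<beta>)" "\<alpha> \<in> carrier (GF F')" "\<beta> \<in> carrier (GF F)"
      by (auto simp: grp_iso i)
    \<comment> \<open>For y = (x, u) the second component of the product is \<beta> \<alpha>^-1 u
      \<alpha>, and setting it to the unit gives u = \<alpha> \<beta>^-1 \<alpha>^-1.\<close>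
    show "\<exists>y\<in>carrier (grp F F'). y \<otimes>\<^bsub>grp F F'\<^esub> x = \<one>\<^bsub>grp F F'\<^esub>"
      by (rule bexI[of _ "(inv\<^bsub>GF F'\<^esub> \<alpha>, fs F' F \<alpha> \<otimes>\<^bsub>GF F\<^esub> inv\<^bsub>GF F\<^esub> \<beta> \<otimes>\<^bsub>GF F\<^esub> fs F' F (inv\<^bsub>GF F'\<^esub> \<alpha>))"])
        (use x in \<open>simp_all add: grp_iso grp_one i F word_simps\<close>)
  qed (auto simp: grp_iso grp_one i F word_simps)
next
  case False
  then show ?thesis by (intro groupI) (auto simp: grp_non_iso)
qed

lemma grp_inv:
  assumes F: "F \<in> T" "F' \<in> T" and i: "GF F \<cong> GF F'" and "\<alpha> \<in> carrier (GF F')" "\<beta> \<in> carrier (GF F)"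
  shows "inv\<^bsub>grp F F'\<^esub> (\<alpha>, \<beta>) = (inv\<^bsub>GF F'\<^esub> \<alpha>, fs F' F \<alpha> \<otimes>\<^bsub>GF F\<^esub> inv\<^bsub>GF F\<^esub> \<beta> \<otimes>\<^bsub>GF F\<^esub> fs F' F (inv\<^bsub>GF F'\<^esub> \<alpha>))"
  by (rule group.inv_equality[OF group_grp[OF F]])
    (use assms autT_iso_sym[OF F(1) i] in \<open>simp_all add: grp_iso grp_one word_simps\<close>)

section \<open>Transitive product and projections\<close>

lemma mult_iso:
  assumes "GF F \<cong> GF F'" "GF F' \<cong> GF F''"
  shows "multT F F' F'' (\<alpha>, \<beta>) (\<gamma>, \<delta>) =
    (\<alpha> \<otimes>\<^bsub>GF F''\<^esub> fs F' F'' \<gamma>, \<delta> \<otimes>\<^bsub>GF F\<^esub> fs F' F (inv\<^bsub>GF F'\<^esub> \<gamma> \<otimes>\<^bsub>GF F'\<^esub> \<beta> \<otimes>\<^bsub>GF F'\<^esub> \<gamma>))"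
  using assms by (simp add: bimndT_mult_def Let_def)

lemma mult_non_iso:
  assumes "\<not> (GF F \<cong> GF F' \<and> GF F' \<cong> GF F'')"
  shows "multT F F' F'' x y = \<one>\<^bsub>grp F F''\<^esub>"
  using assms by (auto simp: bimndT_mult_def Let_def split_beta)

lemma pr_iso:
  assumes "GF F \<cong> GF F'" "GF F' \<cong> GF F''"
  shows "prT1 F F' F'' (\<alpha>, \<beta>) = (\<alpha>, fs F F' \<beta>)" "prT2 F F' F'' (\<alpha>, \<beta>) = (fs F'' F' \<alpha>, \<beta>)"
  using assms by (simp_all add: bimndT_pr1_def bimndT_pr2_def)

lemma pr_non_iso:
  assumes "\<not> (GF F \<cong> GF F' \<and> GF F' \<cong> GF F'')"
  shows "prT1 F F' F'' x = \<one>\<^bsub>grp F' F''\<^esub>" "prT2 F F' F'' x = \<one>\<^bsub>grp F F'\<^esub>"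
  using assms by (auto simp: bimndT_pr1_def bimndT_pr2_def split_beta)

lemma grp_one_closed: "F \<in> T \<Longrightarrow> F' \<in> T \<Longrightarrow> \<one>\<^bsub>grp F F'\<^esub> \<in> carrier (grp F F')"
  using group.is_monoid[OF group_grp] monoid.one_closed by blast

lemma mult_closed:
  assumes F: "F \<in> T" "F' \<in> T" "F'' \<in> T" and x: "x \<in> carrier (grp F F')" "y \<in> carrier (grp F' F'')"
  shows "multT F F' F'' y x \<in> carrier (grp F F'')"
proof (cases "GF F \<cong> GF F' \<and> GF F' \<cong> GF F''")
  case True
  then have i: "GF F \<cong> GF F'" "GF F' \<cong> GF F''" "GF F \<cong> GF F''" "GF F' \<cong> GF F"
    using iso_trans autT_iso_sym F by blast+
  show ?thesis
    using x by (auto simp: grp_iso mult_iso i F word_simps)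
qed (simp add: mult_non_iso grp_one_closed F)

text \<open>If the three groups are mutually isomorphic, each axiom is an equality of words.
  Otherwise the product and the projections are constantly the unit; then both sides of the
  conjugation law are the unit, and in the unit laws the group G_{A,B} is itself trivial.\<close>

lemma graded_groups_bimndT:
  assumes I: "I \<subseteq> T"
  shows "graded_groups I grp (multT) (prT1) (prT2)"
proof (rule graded_groups.intro)
  fix A B assume "A \<in> I" "B \<in> I"
  then have F: "A \<in> T" "B \<in> T" using I by auto
  show "group (grp A B)"
    by (rule group_grp) fact+
  show "multT A B B \<one>\<^bsub>grp B B\<^esub> \<alpha> = \<alpha>" if "\<alpha> \<in> carrier (grp A B)" for \<alpha>
  proof (cases "GF A \<cong> GF B")
    case True
    then show ?thesis
      using that F autT_iso_sym[OF F(1) True] by (auto simp: grp_iso grp_one mult_iso word_simps)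
  qed (use that in \<open>simp add: mult_non_iso grp_non_iso\<close>)
  show "multT A A B \<alpha> \<one>\<^bsub>grp A A\<^esub> = \<alpha>" if "\<alpha> \<in> carrier (grp A B)" for \<alpha>
  proof (cases "GF A \<cong> GF B")
    case True
    then show ?thesis
      using that F autT_iso_sym[OF F(1) True] by (auto simp: grp_iso grp_one mult_iso word_simps)
  qed (use that in \<open>simp add: mult_non_iso grp_non_iso\<close>)
next
  fix A \<alpha> \<beta> assume "A \<in> I" and that: "\<alpha> \<in> carrier (grp A A)" "\<beta> \<in> carrier (grp A A)"
  then have F: "A \<in> T" using I by auto
  show "multT A A A \<beta> \<alpha> = \<beta> \<otimes>\<^bsub>grp A A\<^esub> \<alpha>"
    using that F by (auto simp: mult_iso grp_iso word_simps)
next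
  fix A B C assume "A \<in> I" "B \<in> I" "C \<in> I"
  then have F: "A \<in> T" "B \<in> T" "C \<in> T" using I by auto
  interpret AB: group "grp A B" by (rule group_grp) fact+
  interpret AC: group "grp A C" by (rule group_grp) fact+
  interpret BC: group "grp B C" by (rule group_grp) fact+
  have i: "GF A \<cong> GF B" "GF B \<cong> GF A" "GF B \<cong> GF C" "GF C \<cong> GF B" "GF A \<cong> GF C" "GF C \<cong> GF A"
    if "GF A \<cong> GF B \<and> GF B \<cong> GF C"
    using that iso_trans autT_iso_sym F by blast+
  show "multT A B C \<beta> \<alpha> \<in> carrier (grp A C)"
    if "\<alpha> \<in> carrier (grp A B)" "\<beta> \<in> carrier (grp B C)" for \<alpha> \<beta>
    using mult_closed F that by blast
  show "multT A B C \<one>\<^bsub>grp B C\<^esub> \<one>\<^bsub>grp A B\<^esub> = \<one>\<^bsub>grp A C\<^esub>"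
  proof (cases "GF A \<cong> GF B \<and> GF B \<cong> GF C")
    case True
    note i = i[OF True]
    show ?thesis by (simp add: mult_iso grp_one i F word_simps)
  qed (simp add: mult_non_iso)
  show "prT1 A B C \<in> hom (grp A C) (grp B C)"
  proof (cases "GF A \<cong> GF B \<and> GF B \<cong> GF C")
    case True
    note i = i[OF True]
    show ?thesis
      by (auto simp: hom_def pr_iso grp_iso i F word_simps)
  qed (simp add: hom_def pr_non_iso)
  show "prT2 A B C \<in> hom (grp A C) (grp A B)"
  proof (cases "GF A \<cong> GF B \<and> GF B \<cong> GF C")
    case True
    note i = i[OF True]
    show ?thesis
      by (auto simp: hom_def pr_iso grp_iso i F word_simps)
  qed (simp add: hom_def pr_non_iso)
  show "\<omega> \<otimes>\<^bsub>grp A C\<^esub> multT A B C \<beta> \<alpha> \<otimes>\<^bsub>grp A C\<^esub> inv\<^bsub>grp A C\<^esub> \<omega>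
    = multT A B C (prT1 A B C \<omega> \<otimes>\<^bsub>grp B C\<^esub> \<beta>)
       (\<alpha> \<otimes>\<^bsub>grp A B\<^esub> inv\<^bsub>grp A B\<^esub> prT2 A B C \<omega>)"
    if "\<alpha> \<in> carrier (grp A B)" "\<beta> \<in> carrier (grp B C)" "\<omega> \<in> carrier (grp A C)" for \<alpha> \<beta> \<omega>
  proof (cases "GF A \<cong> GF B \<and> GF B \<cong> GF C")
    case True
    note i = i[OF True]
    show ?thesis
      using that by (auto simp: pr_iso grp_iso mult_iso grp_inv i F word_simps)
  qed (use that in \<open>simp add: mult_non_iso\<close>)
qed

text \<open>Under the hypothesis of mutual isomorphy the constant branches of product and
  projections never occur, and each of the remaining axioms is an equality of words.\<close>

lemma transitive_system_bimndT:
  assumes I: "I \<subseteq> T" and iso: "\<And>F F'. F \<in> I \<Longrightarrow> F' \<in> I \<Longrightarrow> GF F \<cong> GF F'"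
  shows "transitive_system I grp (multT) (prT1) (prT2)"
proof (intro transitive_system.intro graded_groups_bimndT[OF I] transitive_system_axioms.intro)
  fix A B C D assume J: "A \<in> I" "B \<in> I" "C \<in> I" "D \<in> I"
  then have F: "A \<in> T" "B \<in> T" "C \<in> T" "D \<in> T" using I by auto
  note i = J[THEN iso[OF J(1)]] J[THEN iso[OF J(2)]] J[THEN iso[OF J(3)]] J[THEN iso[OF J(4)]]
  show "multT A C D \<gamma> (multT A B C \<beta> \<alpha>) = multT A B D (multT B C D \<gamma> \<beta>) \<alpha>"
    if "\<alpha> \<in> carrier (grp A B)" "\<beta> \<in> carrier (grp B C)" "\<gamma> \<in> carrier (grp C D)" for \<alpha> \<beta> \<gamma>
    using that by (auto simp: grp_iso mult_iso i F word_simps)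
  show "(prT1 B C D (prT1 A B D \<omega>), prT2 B C D (prT1 A B D \<omega>), prT2 A B D \<omega>)
    = (prT1 A C D \<omega>, prT1 A B C (prT2 A C D \<omega>), prT2 A B C (prT2 A C D \<omega>))"
    if "\<omega> \<in> carrier (grp A D)" for \<omega>
    using that by (auto simp: grp_iso pr_iso i F word_simps)
next
  fix A B C \<omega> assume J: "A \<in> I" "B \<in> I" "C \<in> I" and w: "\<omega> \<in> carrier (grp A C)"
  then have F: "A \<in> T" "B \<in> T" "C \<in> T" using I by auto
  note i = J[THEN iso[OF J(1)]] J[THEN iso[OF J(2)]] J[THEN iso[OF J(3)]]
  show "multT A B C (prT1 A B C \<omega>) \<one>\<^bsub>grp A B\<^esub> = \<omega>"
    "multT A B C \<one>\<^bsub>grp B C\<^esub> (prT2 A B C \<omega>) = \<omega>"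
    using w by (auto simp: grp_iso mult_iso pr_iso grp_one i F word_simps)
qed

section \<open>Shifts and twists\<close>

lemma part_at_simps: "fst (part_at F \<alpha>) = fst F" "snd (part_at F \<alpha>) = snd F \<alpha>"
  by (simp_all add: part_at_def)

lemma autT_mult: "\<alpha> \<otimes>\<^bsub>GF F\<^esub> \<beta> = \<alpha> \<bullet> \<beta>"
  by (simp add: autT_def Aut0_simps)

lemma autT_one: "\<one>\<^bsub>GF F\<^esub> = id2 K (endo (fst F))"
  by (simp add: autT_def Aut0_simps unit_part_def part_at_simps)

lemma unit_part_eq: "unit_part K F = part_at F \<one>\<^bsub>GF F\<^esub>"
  by (simp add: unit_part_def autT_one)

lemma autTD:
  assumes F: "F \<in> T" and x: "\<alpha> \<in> carrier (GF F)"
  defines "E \<equiv> endo (fst F)"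
  shows "\<alpha> \<in> cells2 K" "src2 K \<alpha> = E" "trg2 K \<alpha> = E"
    "\<alpha> \<bullet> mu (fst F) = mu (fst F) \<bullet> (\<alpha> \<star> \<alpha>)" "\<alpha> \<bullet> eta (fst F) = eta (fst F)"
    "Delta (fst F) \<bullet> \<alpha> = (\<alpha> \<star> \<alpha>) \<bullet> Delta (fst F)" "eps (fst F) \<bullet> \<alpha> = eps (fst F)"
    "snd F \<one>\<^bsub>GF F\<^esub> \<bullet> (\<alpha> \<star> \<alpha>) = (\<alpha> \<star> \<alpha>) \<bullet> snd F \<one>\<^bsub>GF F\<^esub>"
  using x Aut0_carrier_iff[OF is_bimonad_unit_part[OF F], of \<alpha>]
  unfolding autT_def[symmetric] by (simp_all add: unit_part_eq part_at_simps hom2_iff E_def)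

lemma autT_inv:
  assumes F: "F \<in> T" and x: "\<alpha> \<in> carrier (GF F)"
  shows "\<alpha> \<bullet> inv\<^bsub>GF F\<^esub> \<alpha> = id2 K (endo (fst F))" "inv\<^bsub>GF F\<^esub> \<alpha> \<bullet> \<alpha> = id2 K (endo (fst F))"
  using autT_simps(10,11)[OF F x] unfolding autT_mult autT_one by simp_all

lemma typed_cell0: "F \<in> T \<Longrightarrow> typed_structure (fst F)"
  using typed_bimonad[OF is_bimonad_unit_part] by (simp add: unit_part_def part_at_simps)

lemma cell0_1cells:
  assumes "F \<in> T" "\<alpha> \<in> carrier (GF F)"
  shows "mnd_1cell K (fst F) (fst F) (endo (fst F)) (snd F \<alpha>)"
    "comnd_1cell K (fst F) (fst F) (endo (fst F)) (snd F \<alpha>)"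
  using assms unfolding bimndT_cells0_def Let_def by blast+

lemma data_part_at:
  assumes F: "F \<in> T" and x: "\<alpha> \<in> carrier (GF F)"
  shows "bimnd_data (part_at F \<alpha>)"
  using typed_cell0[OF F] mnd_1cellD(4-6)[OF cell0_1cells(1)[OF F x]]
  by (simp add: bimnd_data_def part_at_simps hom2_iff)

text \<open>The defining equation of the family at \<beta> = e. It expresses every
  \<lambda>_\<alpha> through \<lambda>_e, and hence the whole family through the bimonad.\<close>

lemma lambda_eq:
  assumes F: "F \<in> T" and x: "\<alpha> \<in> carrier (GF F)"
  shows "snd F \<alpha> = (\<alpha> \<triangleleft> endo (fst F)) \<bullet> snd F \<one>\<^bsub>GF F\<^esub> \<bullet> (endo (fst F) \<triangleright> inv\<^bsub>GF F\<^esub> \<alpha>)"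
proof -
  have "\<one>\<^bsub>GF F\<^esub> \<in> carrier (GF F)" using autT_simps[OF F] by simp
  then have "snd F (\<alpha> \<otimes>\<^bsub>GF F\<^esub> \<one>\<^bsub>GF F\<^esub>) = (\<alpha> \<star> inv\<^bsub>GF F\<^esub> \<one>\<^bsub>GF F\<^esub>) \<bullet> snd F \<one>\<^bsub>GF F\<^esub> \<bullet> (\<one>\<^bsub>GF F\<^esub> \<star> inv\<^bsub>GF F\<^esub> \<alpha>)"
    using F x unfolding bimndT_cells0_def Let_def by blast
  then show ?thesis unfolding autT_simps(7)[OF F] autT_simps(9)[OF F x] by (simp only: autT_one)
qed

text \<open>This is the bimonad compatibility of a shift. Expanding \<lambda> of \<sigma> \<alpha>
  \<omega> by \<open>lambda_eq\<close>, the inner \<sigma>^-1 cancels, the two copies of \<omega> on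
  the left form \<omega> \<star> \<omega>, and this passes through \<lambda>_e and absorbs
  \<omega>^-1 on its other side.\<close>

lemma lambda_shift:
  assumes F: "F \<in> T" and a: "\<alpha> \<in> carrier (GF F)" "\<sigma> \<in> carrier (GF F)" "\<omega> \<in> carrier (GF F)"
  shows "(\<sigma> \<triangleleft> endo (fst F)) \<bullet> snd F \<alpha> \<bullet> (\<omega> \<triangleleft> endo (fst F))
    = (endo (fst F) \<triangleright> \<omega>) \<bullet> snd F (\<sigma> \<otimes>\<^bsub>GF F\<^esub> \<alpha> \<otimes>\<^bsub>GF F\<^esub> \<omega>) \<bullet> (endo (fst F) \<triangleright> \<sigma>)"
proof -
  define E where "E = endo (fst F)"
  define l where "l = snd F \<one>\<^bsub>GF F\<^esub>"
  define inv' where "inv' = (\<lambda>x. inv\<^bsub>GF F\<^esub> x)"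
  have c: "\<sigma> \<otimes>\<^bsub>GF F\<^esub> \<alpha> \<otimes>\<^bsub>GF F\<^esub> \<omega> \<in> carrier (GF F)" "inv' \<alpha> \<in> carrier (GF F)"
    "inv' \<sigma> \<in> carrier (GF F)" "inv' \<omega> \<in> carrier (GF F)"
    "inv' (\<sigma> \<otimes>\<^bsub>GF F\<^esub> \<alpha> \<otimes>\<^bsub>GF F\<^esub> \<omega>) = inv' \<omega> \<otimes>\<^bsub>GF F\<^esub> (inv' \<alpha> \<otimes>\<^bsub>GF F\<^esub> inv' \<sigma>)"
    using a autT_simps[OF F] by (simp_all add: inv'_def)
  have one: "\<one>\<^bsub>GF F\<^esub> \<in> carrier (GF F)" using autT_simps[OF F] by simp
  note t = autTD(1-3)[OF F a(1), folded E_def] autTD(1-3)[OF F a(2), folded E_def]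
    autTD(1-3)[OF F a(3), folded E_def] autTD(1-3)[OF F c(2), folded E_def]
    autTD(1-3)[OF F c(3), folded E_def] autTD(1-3)[OF F c(4), folded E_def]
    bimnd_dataD[OF data_part_at[OF F one], unfolded part_at_simps, folded E_def l_def]
  note n = normal_form t
  have i: "\<omega> \<bullet> inv' \<omega> = id2 K E" "inv' \<sigma> \<bullet> \<sigma> = id2 K E"
    using autT_inv[OF F a(3)] autT_inv[OF F a(2)] by (simp_all add: inv'_def E_def)
  have \<sigma>: "(E \<triangleright> inv' \<sigma>) \<bullet> (E \<triangleright> \<sigma>) = id2 K (E \<cdot> E)"
    by (subst interchange') (simp_all add: n i)
  have \<omega>: "(\<omega> \<star> \<omega>) \<bullet> (E \<triangleright> inv' \<omega>) = \<omega> \<triangleleft> E"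
    by (subst interchange') (simp_all add: n i)
  have s: "(E \<triangleright> \<omega>) \<bullet> (\<sigma> \<triangleleft> E) = (\<sigma> \<triangleleft> E) \<bullet> (E \<triangleright> \<omega>)" "(E \<triangleright> \<omega>) \<bullet> (\<alpha> \<triangleleft> E) = (\<alpha> \<triangleleft> E) \<bullet> (E \<triangleright> \<omega>)"
    "(\<omega> \<triangleleft> E) \<bullet> (E \<triangleright> inv' \<alpha>) = (E \<triangleright> inv' \<alpha>) \<bullet> (\<omega> \<triangleleft> E)"
    "(E \<triangleright> \<omega>) \<bullet> (\<omega> \<triangleleft> E) = \<omega> \<star> \<omega>"
    by (simp_all add: interchange' typing t)
  have "(E \<triangleright> \<omega>) \<bullet> snd F (\<sigma> \<otimes>\<^bsub>GF F\<^esub> \<alpha> \<otimes>\<^bsub>GF F\<^esub> \<omega>) \<bullet> (E \<triangleright> \<sigma>)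
      = (E \<triangleright> \<omega>) \<bullet> (((\<sigma> \<bullet> \<alpha> \<bullet> \<omega>) \<triangleleft> E) \<bullet> l \<bullet> (E \<triangleright> (inv' \<omega> \<bullet> (inv' \<alpha> \<bullet> inv' \<sigma>)))) \<bullet> (E \<triangleright> \<sigma>)"
    by (subst lambda_eq[OF F c(1)]) (simp only: E_def l_def c(5)[unfolded inv'_def autT_mult] inv'_def autT_mult)
  also have "\<dots> = ((E \<triangleright> \<omega>) \<bullet> (\<sigma> \<triangleleft> E)) \<bullet> ((\<alpha> \<triangleleft> E) \<bullet> ((\<omega> \<triangleleft> E) \<bullet> (l \<bullet> ((E \<triangleright> inv' \<omega>) \<bullet> ((E \<triangleright> inv' \<alpha>)
      \<bullet> ((E \<triangleright> inv' \<sigma>) \<bullet> (E \<triangleright> \<sigma>)))))))"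
    by (simp add: n)
  also have "\<dots> = (\<sigma> \<triangleleft> E) \<bullet> (((E \<triangleright> \<omega>) \<bullet> (\<alpha> \<triangleleft> E)) \<bullet> ((\<omega> \<triangleleft> E) \<bullet> (l \<bullet> ((E \<triangleright> inv' \<omega>) \<bullet> (E \<triangleright> inv' \<alpha>)))))"
    unfolding s(1) \<sigma> by (simp add: n)
  also have "\<dots> = (\<sigma> \<triangleleft> E) \<bullet> ((\<alpha> \<triangleleft> E) \<bullet> (((E \<triangleright> \<omega>) \<bullet> (\<omega> \<triangleleft> E)) \<bullet> (l \<bullet> ((E \<triangleright> inv' \<omega>) \<bullet> (E \<triangleright> inv' \<alpha>)))))"
    unfolding s(2) by (simp add: n)
  also have "\<dots> = (\<sigma> \<triangleleft> E) \<bullet> ((\<alpha> \<triangleleft> E) \<bullet> (((\<omega> \<star> \<omega>) \<bullet> l) \<bullet> ((E \<triangleright> inv' \<omega>) \<bullet> (E \<triangleright> inv' \<alpha>))))"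
    unfolding s(4) by (simp add: n)
  \<comment> \<open>The only use of the compatibility of \<omega> with \<lambda>_e; all other steps
    are interchange and cancellation.\<close>
  also have "\<dots> = (\<sigma> \<triangleleft> E) \<bullet> ((\<alpha> \<triangleleft> E) \<bullet> (l \<bullet> (((\<omega> \<star> \<omega>) \<bullet> (E \<triangleright> inv' \<omega>)) \<bullet> (E \<triangleright> inv' \<alpha>))))"
    unfolding autTD(8)[OF F a(3), folded l_def, symmetric] by (simp add: n)
  also have "\<dots> = (\<sigma> \<triangleleft> E) \<bullet> ((\<alpha> \<triangleleft> E) \<bullet> (l \<bullet> ((\<omega> \<triangleleft> E) \<bullet> (E \<triangleright> inv' \<alpha>))))"
    unfolding \<omega> ..
  also have "\<dots> = (\<sigma> \<triangleleft> E) \<bullet> ((\<alpha> \<triangleleft> E) \<bullet> l \<bullet> (E \<triangleright> inv' \<alpha>)) \<bullet> (\<omega> \<triangleleft> E)"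
    unfolding s(3) by (simp add: n)
  also have "(\<alpha> \<triangleleft> E) \<bullet> l \<bullet> (E \<triangleright> inv' \<alpha>) = snd F \<alpha>"
    by (simp only: lambda_eq[OF F a(1)] E_def l_def inv'_def)
  finally show ?thesis by (simp add: E_def)
qed

section \<open>Shifts: the 1-cells over identities\<close>

definition shift :: "('o, 'm, 'c) bimndT \<Rightarrow> 'c \<Rightarrow> 'c \<Rightarrow> 'c \<Rightarrow> ('o, 'm, 'c) bimnd_1cell" where
  "shift F \<alpha> \<sigma> \<omega> = (part_at F \<alpha>, (id1 K (base (fst F)), \<omega>, \<sigma>), part_at F (\<sigma> \<otimes>\<^bsub>GF F\<^esub> \<alpha> \<otimes>\<^bsub>GF F\<^esub> \<omega>))"

text \<open>The (co)monad axioms are the multiplicativity conditions on \<omega> and \<sigma>; the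
  compatibility is \<open>lambda_shift\<close>, and it dictates the target degree \<sigma> \<alpha>
  \<omega>.\<close>

lemma shift_closed:
  assumes F: "F \<in> T" and a: "\<alpha> \<in> carrier (GF F)" "\<sigma> \<in> carrier (GF F)" "\<omega> \<in> carrier (GF F)"
  shows "shift F \<alpha> \<sigma> \<omega> \<in> bimnd_1cells K (part_at F \<alpha>) (part_at F (\<sigma> \<otimes>\<^bsub>GF F\<^esub> \<alpha> \<otimes>\<^bsub>GF F\<^esub> \<omega>))"
proof -
  note s = typed_structureD[OF typed_cell0[OF F]]
  note t = s autTD(1-3)[OF F a(2)] autTD(1-3)[OF F a(3)]
  have c: "\<sigma> \<otimes>\<^bsub>GF F\<^esub> \<alpha> \<otimes>\<^bsub>GF F\<^esub> \<omega> \<in> carrier (GF F)"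
    using a autT_simps[OF F] by simp
  have "mnd_1cell K (fst F) (fst F) (id1 K (base (fst F))) \<omega>"
    "comnd_1cell K (fst F) (fst F) (id1 K (base (fst F))) \<sigma>"
    using Aut0_1cells(1)[OF is_bimonad_unit_part[OF F], of \<omega>] Aut0_1cells(2)[OF is_bimonad_unit_part[OF F], of \<sigma>] a
    by (simp_all add: autT_def[of K F] unit_part_def part_at_simps)
  then show ?thesis
    using lambda_shift[OF F a] bimnd_dataD[OF data_part_at[OF F c]] bimnd_dataD[OF data_part_at[OF F a(1)]]
    unfolding shift_def bimnd_1cells_iff part_at_simps by (simp add: hcomp_id2_id1 typing t)
qed

text \<open>\<phi> runs along X and \<psi> against it, so the \<sigma>'s multiply in the order of
  composition and the \<omega>'s in the opposite order. This agrees with the target degree \<sigma>'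
  \<sigma> \<alpha> \<omega> \<omega>'.\<close>

lemma shift_comp:
  assumes F: "F \<in> T" and a: "\<alpha> \<in> carrier (GF F)" "\<sigma> \<in> carrier (GF F)" "\<omega> \<in> carrier (GF F)"
    "\<sigma>' \<in> carrier (GF F)" "\<omega>' \<in> carrier (GF F)" and \<beta>: "\<beta> = \<sigma> \<otimes>\<^bsub>GF F\<^esub> \<alpha> \<otimes>\<^bsub>GF F\<^esub> \<omega>"
  shows "bimnd_comp1 K (shift F \<beta> \<sigma>' \<omega>') (shift F \<alpha> \<sigma> \<omega>) = shift F \<alpha> (\<sigma>' \<otimes>\<^bsub>GF F\<^esub> \<sigma>) (\<omega> \<otimes>\<^bsub>GF F\<^esub> \<omega>')"
proof -
  note t = typed_structureD(1-4)[OF typed_cell0[OF F]] a[THEN autTD(1)[OF F]] a[THEN autTD(2)[OF F]]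
    a[THEN autTD(3)[OF F]]
  have "\<sigma>' \<otimes>\<^bsub>GF F\<^esub> \<beta> \<otimes>\<^bsub>GF F\<^esub> \<omega>' = \<sigma>' \<otimes>\<^bsub>GF F\<^esub> \<sigma> \<otimes>\<^bsub>GF F\<^esub> \<alpha> \<otimes>\<^bsub>GF F\<^esub> (\<omega> \<otimes>\<^bsub>GF F\<^esub> \<omega>')"
    using a autT_simps[OF F] by (simp add: \<beta>)
  then show ?thesis
    unfolding shift_def bimnd_comp1_def by (simp add: typing t) (simp add: autT_mult)
qed

lemma shift_one:
  assumes F: "F \<in> T" and a: "\<alpha> \<in> carrier (GF F)"
  shows "shift F \<alpha> \<one>\<^bsub>GF F\<^esub> \<one>\<^bsub>GF F\<^esub> = bimnd_id1 K (part_at F \<alpha>)"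
  using autT_simps[OF F] a by (simp add: shift_def bimnd_id1_def part_at_simps) (simp add: autT_one)

text \<open>The end degrees after attaching the shifts. The target moves forward along a shift; the
  new source degree \<delta>' is the solution of \<sigma> \<delta>' \<omega>^-1 = \<delta>, with
  fusion maps suppressed.\<close>

definition twist_degree :: "('o, 'm, 'c) bimndT \<Rightarrow> ('o, 'm, 'c) bimndT \<Rightarrow> 'c \<Rightarrow> 'c \<Rightarrow> 'c \<times> 'c \<Rightarrow> 'c \<times> 'c" where
  "twist_degree F F' \<sigma> \<omega> = (\<lambda>(\<gamma>, \<delta>). (inv\<^bsub>GF F'\<^esub> fs F F' \<sigma> \<otimes>\<^bsub>GF F'\<^esub> \<gamma> \<otimes>\<^bsub>GF F'\<^esub> \<omega>,
     inv\<^bsub>GF F\<^esub> \<sigma> \<otimes>\<^bsub>GF F\<^esub> \<delta> \<otimes>\<^bsub>GF F\<^esub> fs F' F \<omega>))"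

text \<open>The parameters on the two sides are inverse to each other up to fusion maps:
  (\<sigma>^-1, \<omega>) at the target and (\<sigma>, \<omega>^-1) at the source. This is what
  makes adjacent shifts cancel when two twisted 1-cells are composed.\<close>

definition twist :: "('o, 'm, 'c) bimndT \<Rightarrow> ('o, 'm, 'c) bimndT \<Rightarrow> 'c \<times> 'c \<Rightarrow> 'c \<Rightarrow> 'c
    \<Rightarrow> ('o, 'm, 'c) bimnd_1cell \<Rightarrow> ('o, 'm, 'c) bimnd_1cell" where
  "twist F F' c \<sigma> \<omega> y =
     bimnd_comp1 K (shift F' (fst c) (fs F F' (inv\<^bsub>GF F\<^esub> \<sigma>)) \<omega>)
       (bimnd_comp1 K y (shift F (snd (twist_degree F F' \<sigma> \<omega> c)) \<sigma> (fs F' F (inv\<^bsub>GF F'\<^esub> \<omega>))))"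

definition twist2 :: "('o, 'm, 'c) bimndT \<Rightarrow> ('o, 'm, 'c) bimndT \<Rightarrow> 'c \<times> 'c \<Rightarrow> 'c \<Rightarrow> 'c
    \<Rightarrow> ('o, 'm, 'c) bimnd_2cell \<Rightarrow> ('o, 'm, 'c) bimnd_2cell" where
  "twist2 F F' c \<sigma> \<omega> z = (twist F F' c \<sigma> \<omega> (fst z), fst (snd z), twist F F' c \<sigma> \<omega> (snd (snd z)))"

abbreviation one_cells where
  "one_cells F F' c \<equiv> bimnd_1cells K (part_at F (snd c)) (part_at F' (fst c))"

abbreviation two_cells where
  "two_cells F F' c \<equiv> bimnd_2cells K (part_at F (snd c)) (part_at F' (fst c))"

lemma shift_id2:
  "fst (snd (bimnd_id2 K (shift F \<alpha> \<sigma> \<omega>))) = id2 K (id1 K (base (fst F)))"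
  "fst (bimnd_id2 K x) = x" "snd (snd (bimnd_id2 K x)) = x"
  by (simp_all add: shift_def bimnd_id2_def)

context
  fixes F F' assumes F: "F \<in> T" "F' \<in> T" and iso: "GF F \<cong> GF F'"
begin

lemma iso': "GF F' \<cong> GF F"
  using autT_iso_sym[OF F(1) iso] .

lemma twist_degree_closed:
  assumes "c \<in> carrier (grp F F')" "\<sigma> \<in> carrier (GF F)" "\<omega> \<in> carrier (GF F')"
  shows "twist_degree F F' \<sigma> \<omega> c \<in> carrier (grp F F')"
  using assms by (auto simp: twist_degree_def grp_iso iso iso' F word_simps)

lemma twist_degree_twist_degree:
  assumes "c \<in> carrier (grp F F')" "\<sigma> \<in> carrier (GF F)" "\<omega> \<in> carrier (GF F')"
    "\<sigma>' \<in> carrier (GF F)" "\<omega>' \<in> carrier (GF F')"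
  shows "twist_degree F F' \<sigma>' \<omega>' (twist_degree F F' \<sigma> \<omega> c)
    = twist_degree F F' (\<sigma> \<otimes>\<^bsub>GF F\<^esub> \<sigma>') (\<omega> \<otimes>\<^bsub>GF F'\<^esub> \<omega>') c"
  using assms by (auto simp: twist_degree_def grp_iso iso iso' F word_simps)

lemma twist_shifts:
  assumes c: "c \<in> carrier (grp F F')" and a: "\<sigma> \<in> carrier (GF F)" "\<omega> \<in> carrier (GF F')"
  shows "bimnd_data (part_at F (snd c))" "bimnd_data (part_at F' (fst c))"
    "shift F' (fst c) (fs F F' (inv\<^bsub>GF F\<^esub> \<sigma>)) \<omega>
       \<in> bimnd_1cells K (part_at F' (fst c)) (part_at F' (fst (twist_degree F F' \<sigma> \<omega> c)))"
    "shift F (snd (twist_degree F F' \<sigma> \<omega> c)) \<sigma> (fs F' F (inv\<^bsub>GF F'\<^esub> \<omega>))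
       \<in> bimnd_1cells K (part_at F (snd (twist_degree F F' \<sigma> \<omega> c))) (part_at F (snd c))"
proof -
  obtain \<gamma> \<delta> where e: "c = (\<gamma>, \<delta>)" "\<gamma> \<in> carrier (GF F')" "\<delta> \<in> carrier (GF F)"
    using c by (auto simp: grp_iso iso)
  note w = iso iso' F word_simps
  show "bimnd_data (part_at F (snd c))" "bimnd_data (part_at F' (fst c))"
    using e data_part_at F by simp_all
  have "fs F F' (inv\<^bsub>GF F\<^esub> \<sigma>) \<in> carrier (GF F')"
    using a by (simp add: w)
  moreover have "fs F F' (inv\<^bsub>GF F\<^esub> \<sigma>) \<otimes>\<^bsub>GF F'\<^esub> \<gamma> \<otimes>\<^bsub>GF F'\<^esub> \<omega> = fst (twist_degree F F' \<sigma> \<omega> c)"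
    using a e by (simp add: twist_degree_def w)
  ultimately show "shift F' (fst c) (fs F F' (inv\<^bsub>GF F\<^esub> \<sigma>)) \<omega>
       \<in> bimnd_1cells K (part_at F' (fst c)) (part_at F' (fst (twist_degree F F' \<sigma> \<omega> c)))"
    using shift_closed[OF F(2) e(2), of "fs F F' (inv\<^bsub>GF F\<^esub> \<sigma>)" \<omega>] a e(1) by simp
  have d: "fs F' F (inv\<^bsub>GF F'\<^esub> \<omega>) \<in> carrier (GF F)" "snd (twist_degree F F' \<sigma> \<omega> c) \<in> carrier (GF F)"
    using a e by (simp_all add: twist_degree_def w)
  have "\<sigma> \<otimes>\<^bsub>GF F\<^esub> snd (twist_degree F F' \<sigma> \<omega> c) \<otimes>\<^bsub>GF F\<^esub> fs F' F (inv\<^bsub>GF F'\<^esub> \<omega>) = snd c"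
    using a e by (simp add: twist_degree_def w)
  then show "shift F (snd (twist_degree F F' \<sigma> \<omega> c)) \<sigma> (fs F' F (inv\<^bsub>GF F'\<^esub> \<omega>))
       \<in> bimnd_1cells K (part_at F (snd (twist_degree F F' \<sigma> \<omega> c))) (part_at F (snd c))"
    using shift_closed[OF F(1) d(2) a(1) d(1)] by simp
qed

lemma twist_closed:
  assumes c: "c \<in> carrier (grp F F')" and a: "\<sigma> \<in> carrier (GF F)" "\<omega> \<in> carrier (GF F')"
    and y: "y \<in> one_cells F F' c"
  shows "twist F F' c \<sigma> \<omega> y \<in> one_cells F F' (twist_degree F F' \<sigma> \<omega> c)"
proof -
  note s = twist_shifts[OF c a] twist_shifts(1,2)[OF twist_degree_closed[OF c a] a]
  show ?thesis
    unfolding twist_def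
    by (rule bimnd_comp1_closed[OF s(5) s(2) s(6) s(3)])
      (rule bimnd_comp1_closed[OF s(5) s(1) s(2) y s(4)])
qed

text \<open>The identity 2-cell of a shift lies over the identity of an identity 1-cell, and
  whiskering with that changes nothing. So keeping the underlying 2-cell is the same as whiskering
  with the shifts, and closure follows from that of horizontal composition.\<close>

lemma twist2_eq:
  assumes c: "c \<in> carrier (grp F F')" and a: "\<sigma> \<in> carrier (GF F)" "\<omega> \<in> carrier (GF F')"
    and z: "z \<in> two_cells F F' c"
  shows "twist2 F F' c \<sigma> \<omega> z = bimnd_hcomp K (bimnd_id2 K (shift F' (fst c) (fs F F' (inv\<^bsub>GF F\<^esub> \<sigma>)) \<omega>))
      (bimnd_hcomp K z (bimnd_id2 K (shift F (snd (twist_degree F F' \<sigma> \<omega> c)) \<sigma> (fs F' F (inv\<^bsub>GF F'\<^esub> \<omega>)))))"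
proof -
  note t = bimnd_2cells_typing[OF z] bimnd_1cells_typing[OF bimnd_2cells_ends(1)[OF z]]
  show ?thesis
    by (simp add: twist2_def twist_def bimnd_hcomp_def split_beta shift_id2 hcomp_id2_id1 t part_at_simps)
qed

lemma twist2_closed:
  assumes c: "c \<in> carrier (grp F F')" and a: "\<sigma> \<in> carrier (GF F)" "\<omega> \<in> carrier (GF F')"
    and z: "z \<in> two_cells F F' c"
  shows "twist2 F F' c \<sigma> \<omega> z \<in> two_cells F F' (twist_degree F F' \<sigma> \<omega> c)"
proof -
  note s = twist_shifts[OF c a] twist_shifts(1,2)[OF twist_degree_closed[OF c a] a]
  show ?thesis
    unfolding twist2_eq[OF c a z]
    by (rule bimnd_hcomp_closed[OF s(5) s(2) s(6) bimnd_id2_closed[OF s(2) s(6) s(3)]])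
      (rule bimnd_hcomp_closed[OF s(5) s(1) s(2) z bimnd_id2_closed[OF s(5) s(1) s(4)]])
qed

text \<open>After rebracketing, the two shifts on each side merge by \<open>shift_comp\<close>. On
  the target side \<sigma>'^-1 \<sigma>^-1 = (\<sigma> \<sigma>')^-1, which explains the order of
  the products on the right-hand side.\<close>

lemma twist_twist:
  assumes c: "c \<in> carrier (grp F F')" and a: "\<sigma> \<in> carrier (GF F)" "\<omega> \<in> carrier (GF F')"
    and a': "\<sigma>' \<in> carrier (GF F)" "\<omega>' \<in> carrier (GF F')" and y: "y \<in> one_cells F F' c"
    and d: "d = twist_degree F F' \<sigma> \<omega> c"
  shows "twist F F' d \<sigma>' \<omega>' (twist F F' c \<sigma> \<omega> y) = twist F F' c (\<sigma> \<otimes>\<^bsub>GF F\<^esub> \<sigma>') (\<omega> \<otimes>\<^bsub>GF F'\<^esub> \<omega>') y"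
proof -
  note w = iso iso' F word_simps
  have d': "d \<in> carrier (grp F F')" unfolding d by (rule twist_degree_closed[OF c a])
  note s = twist_shifts[OF c a, folded d] twist_shifts[OF d' a']
    twist_shifts(1,2)[OF twist_degree_closed[OF d' a'] a]
  obtain \<gamma> \<delta> where e: "c = (\<gamma>, \<delta>)" "\<gamma> \<in> carrier (GF F')" "\<delta> \<in> carrier (GF F)"
    using c by (auto simp: grp_iso iso)
  let ?l = "shift F' (fst c) (fs F F' (inv\<^bsub>GF F\<^esub> \<sigma>)) \<omega>"
  let ?l' = "shift F' (fst d) (fs F F' (inv\<^bsub>GF F\<^esub> \<sigma>')) \<omega>'"
  let ?r = "shift F (snd d) \<sigma> (fs F' F (inv\<^bsub>GF F'\<^esub> \<omega>))"
  let ?r' = "shift F (snd (twist_degree F F' \<sigma>' \<omega>' d)) \<sigma>' (fs F' F (inv\<^bsub>GF F'\<^esub> \<omega>'))"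
  have yr: "bimnd_comp1 K y ?r \<in> bimnd_1cells K (part_at F (snd d)) (part_at F' (fst c))"
    by (rule bimnd_comp1_closed[OF s(5,1,2) y s(4)])
  have rr: "bimnd_comp1 K ?r ?r' \<in> bimnd_1cells K (part_at F (snd (twist_degree F F' \<sigma>' \<omega>' d))) (part_at F (snd c))"
    by (rule bimnd_comp1_closed[OF s(9,5,1) s(4,8)])
  have "twist F F' d \<sigma>' \<omega>' (twist F F' c \<sigma> \<omega> y)
      = bimnd_comp1 K ?l' (bimnd_comp1 K (bimnd_comp1 K ?l (bimnd_comp1 K y ?r)) ?r')"
    by (simp only: twist_def d)
  also have "\<dots> = bimnd_comp1 K ?l' (bimnd_comp1 K ?l (bimnd_comp1 K y (bimnd_comp1 K ?r ?r')))"
    by (simp only: bimnd_comp1_assoc[OF s(9,5,2,6) s(8) yr s(3)] bimnd_comp1_assoc[OF s(9,5,1,2) s(8,4) y])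
  also have "\<dots> = bimnd_comp1 K (bimnd_comp1 K ?l' ?l) (bimnd_comp1 K y (bimnd_comp1 K ?r ?r'))"
    by (rule bimnd_comp1_assoc[OF s(9,2,6,10) bimnd_comp1_closed[OF s(9,1,2) y rr] s(3,7)])
  also have "bimnd_comp1 K ?l' ?l = shift F' (fst c) (fs F F' (inv\<^bsub>GF F\<^esub> \<sigma>') \<otimes>\<^bsub>GF F'\<^esub> fs F F' (inv\<^bsub>GF F\<^esub> \<sigma>)) (\<omega> \<otimes>\<^bsub>GF F'\<^esub> \<omega>')"
    by (rule shift_comp[OF F(2)]) (use e a a' in \<open>simp_all add: w d twist_degree_def\<close>)
  also have "fs F F' (inv\<^bsub>GF F\<^esub> \<sigma>') \<otimes>\<^bsub>GF F'\<^esub> fs F F' (inv\<^bsub>GF F\<^esub> \<sigma>) = fs F F' (inv\<^bsub>GF F\<^esub> (\<sigma> \<otimes>\<^bsub>GF F\<^esub> \<sigma>'))"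
    using a a' by (simp add: w)
  also have "bimnd_comp1 K ?r ?r' = shift F (snd (twist_degree F F' \<sigma>' \<omega>' d)) (\<sigma> \<otimes>\<^bsub>GF F\<^esub> \<sigma>')
      (fs F' F (inv\<^bsub>GF F'\<^esub> \<omega>') \<otimes>\<^bsub>GF F\<^esub> fs F' F (inv\<^bsub>GF F'\<^esub> \<omega>))"
    by (rule shift_comp[OF F(1)]) (use e a a' in \<open>simp_all add: w d twist_degree_def\<close>)
  also have "fs F' F (inv\<^bsub>GF F'\<^esub> \<omega>') \<otimes>\<^bsub>GF F\<^esub> fs F' F (inv\<^bsub>GF F'\<^esub> \<omega>) = fs F' F (inv\<^bsub>GF F'\<^esub> (\<omega> \<otimes>\<^bsub>GF F'\<^esub> \<omega>'))"
    using a a' by (simp add: w)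
  also have "twist_degree F F' \<sigma>' \<omega>' d = twist_degree F F' (\<sigma> \<otimes>\<^bsub>GF F\<^esub> \<sigma>') (\<omega> \<otimes>\<^bsub>GF F'\<^esub> \<omega>') c"
    unfolding d by (rule twist_degree_twist_degree[OF c a a'])
  finally show ?thesis by (simp only: twist_def)
qed

lemma twist_one:
  assumes c: "c \<in> carrier (grp F F')" and y: "y \<in> one_cells F F' c"
  shows "twist F F' c \<one>\<^bsub>GF F\<^esub> \<one>\<^bsub>GF F'\<^esub> y = y"
proof -
  note w = iso iso' F word_simps
  obtain \<gamma> \<delta> where e: "c = (\<gamma>, \<delta>)" "\<gamma> \<in> carrier (GF F')" "\<delta> \<in> carrier (GF F)"
    using c by (auto simp: grp_iso iso)
  have "snd (twist_degree F F' \<one>\<^bsub>GF F\<^esub> \<one>\<^bsub>GF F'\<^esub> c) = snd c"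
    using e by (simp add: twist_degree_def w)
  then show ?thesis
    using y e bimnd_comp1_id1[OF data_part_at data_part_at, of F \<delta> F' \<gamma> y]
    by (simp add: twist_def w shift_one)
qed

text \<open>The shift at the target contributes \<omega> Y to \<psi> and j(\<sigma>^-1) Y to \<phi>;
  the one at the source contributes Y j^-1(\<omega>^-1) to \<psi> and Y \<sigma> to \<phi>.\<close>

lemma twist_explicit:
  assumes c: "(\<gamma>, \<delta>) \<in> carrier (grp F F')" and a: "\<sigma> \<in> carrier (GF F)" "\<omega> \<in> carrier (GF F')"
    and y: "(P, (Y, \<psi>, \<phi>), P') \<in> one_cells F F' (\<gamma>, \<delta>)"
  shows "twist F F' (\<gamma>, \<delta>) \<sigma> \<omega> (P, (Y, \<psi>, \<phi>), P')
    = (part_at F (snd (twist_degree F F' \<sigma> \<omega> (\<gamma>, \<delta>))),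
       (Y, psi_twist K j F F' \<omega> Y \<psi>, phi_twist K j F F' \<sigma> Y \<phi>),
       part_at F' (fst (twist_degree F F' \<sigma> \<omega> (\<gamma>, \<delta>))))"
proof -
  note w = iso iso' F word_simps
  have e: "\<gamma> \<in> carrier (GF F')" "\<delta> \<in> carrier (GF F)"
    using c by (auto simp: grp_iso iso)
  have P: "P = part_at F \<delta>" "P' = part_at F' \<gamma>"
    using y by (simp_all add: bimnd_1cells_iff)
  have b: "fs F F' (inv\<^bsub>GF F\<^esub> \<sigma>) \<in> carrier (GF F')" "fs F' F (inv\<^bsub>GF F'\<^esub> \<omega>) \<in> carrier (GF F)"
    using a by (simp_all add: w)
  have d: "fs F F' (inv\<^bsub>GF F\<^esub> \<sigma>) \<otimes>\<^bsub>GF F'\<^esub> \<gamma> \<otimes>\<^bsub>GF F'\<^esub> \<omega> = fst (twist_degree F F' \<sigma> \<omega> (\<gamma>, \<delta>))"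
    using a e by (simp add: twist_degree_def w)
  note t = autTD(1-3)[OF F(1) a(1)] autTD(1-3)[OF F(2) a(2)] autTD(1-3)[OF F(2) b(1)]
    autTD(1-3)[OF F(1) b(2)] bimnd_1cellsD[OF y[unfolded P, simplified], unfolded part_at_simps]
    typed_structureD(1-4)[OF typed_cell0[OF F(1)]] typed_structureD(1-4)[OF typed_cell0[OF F(2)]]
  show ?thesis
    unfolding twist_def shift_def bimnd_comp1_def psi_twist_def phi_twist_def
    by (simp add: typing t vcomp_assoc' d)
qed

lemma underlying_twist:
  assumes c: "c \<in> carrier (grp F F')" and a: "\<sigma> \<in> carrier (GF F)" "\<omega> \<in> carrier (GF F')"
    and y: "y \<in> one_cells F F' c"
  shows "fst (fst (snd (twist F F' c \<sigma> \<omega> y))) = fst (fst (snd y))"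
  using assms twist_explicit[of "fst c" "snd c" \<sigma> \<omega> "fst y" "fst (fst (snd y))" "fst (snd (fst (snd y)))"
      "snd (snd (fst (snd y)))" "snd (snd y)"]
  by simp

end

text \<open>Both factors receive images of the same \<sigma> and \<omega> under fusion maps, since
  only then are the shifts facing each other in the middle inverse to one another.\<close>

lemma twist_comp:
  assumes F: "F \<in> T" "F' \<in> T" "F'' \<in> T" and iso: "GF F \<cong> GF F'" "GF F' \<cong> GF F''"
    and c: "\<alpha> \<in> carrier (GF F'')" "\<gamma> \<in> carrier (GF F')" "\<delta> \<in> carrier (GF F)"
    and a: "\<sigma> \<in> carrier (GF F)" "\<omega> \<in> carrier (GF F'')"
    and x: "x \<in> one_cells F' F'' (\<alpha>, \<gamma>)" and y: "y \<in> one_cells F F' (\<gamma>, \<delta>)"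
  shows "twist F F'' (\<alpha>, \<delta>) \<sigma> \<omega> (bimnd_comp1 K x y)
    = bimnd_comp1 K (twist F' F'' (\<alpha>, \<gamma>) (fs F F' \<sigma>) \<omega> x) (twist F F' (\<gamma>, \<delta>) \<sigma> (fs F'' F' \<omega>) y)"
proof -
  have i: "GF F \<cong> GF F''" "GF F' \<cong> GF F" "GF F'' \<cong> GF F'" "GF F'' \<cong> GF F"
    using iso_trans autT_iso_sym F iso by blast+
  note w = i iso F word_simps
  define \<sigma>' \<omega>' where "\<sigma>' = fs F F' \<sigma>" and "\<omega>' = fs F'' F' \<omega>"
  have a': "\<sigma>' \<in> carrier (GF F')" "\<omega>' \<in> carrier (GF F')"
    using a by (simp_all add: \<sigma>'_def \<omega>'_def w)
  have g: "(\<alpha>, \<gamma>) \<in> carrier (grp F' F'')" "(\<gamma>, \<delta>) \<in> carrier (grp F F')"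
    using c by (simp_all add: grp_iso iso)
  \<comment> \<open>The middle degree after twisting; the source of the twisted x and the target of
    the twisted y both move from \<gamma> to it, so the twists are again composable.\<close>
  define \<gamma>' where "\<gamma>' = inv\<^bsub>GF F'\<^esub> \<sigma>' \<otimes>\<^bsub>GF F'\<^esub> \<gamma> \<otimes>\<^bsub>GF F'\<^esub> \<omega>'"
  have \<gamma>': "\<gamma>' \<in> carrier (GF F')" "snd (twist_degree F' F'' \<sigma>' \<omega> (\<alpha>, \<gamma>)) = \<gamma>'"
    "fst (twist_degree F F' \<sigma> \<omega>' (\<gamma>, \<delta>)) = \<gamma>'"
    using a a' c by (simp_all add: \<gamma>'_def twist_degree_def \<omega>'_def \<sigma>'_def w)
  note s = twist_shifts[OF F(2,3) iso(2) g(1) a'(1) a(2), unfolded \<gamma>'(2) fst_conv snd_conv]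
    twist_shifts[OF F(1,2) iso(1) g(2) a(1) a'(2), unfolded \<gamma>'(3) fst_conv snd_conv]
  define \<delta>' where "\<delta>' = snd (twist_degree F F' \<sigma> \<omega>' (\<gamma>, \<delta>))"
  define \<alpha>' where "\<alpha>' = fst (twist_degree F' F'' \<sigma>' \<omega> (\<alpha>, \<gamma>))"
  have D: "bimnd_data (part_at F \<delta>')" "bimnd_data (part_at F' \<gamma>')" "bimnd_data (part_at F'' \<alpha>')"
    using c a a' \<gamma>'(1) F by (auto intro!: data_part_at simp: \<delta>'_def \<alpha>'_def twist_degree_def w)
  let ?lx = "shift F'' \<alpha> (fs F' F'' (inv\<^bsub>GF F'\<^esub> \<sigma>')) \<omega>"
  let ?rx = "shift F' \<gamma>' \<sigma>' (fs F'' F' (inv\<^bsub>GF F''\<^esub> \<omega>))"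
  let ?ly = "shift F' \<gamma> (fs F F' (inv\<^bsub>GF F\<^esub> \<sigma>)) \<omega>'"
  let ?ry = "shift F \<delta>' \<sigma> (fs F' F (inv\<^bsub>GF F'\<^esub> \<omega>'))"
  note S = s(3)[folded \<alpha>'_def] s(4) s(7) s(8)[folded \<delta>'_def]
  \<comment> \<open>The two middle shifts merge to a shift with both parameters trivial, which is an
    identity.\<close>
  have "bimnd_comp1 K ?rx ?ly = shift F' \<gamma> (\<sigma>' \<otimes>\<^bsub>GF F'\<^esub> fs F F' (inv\<^bsub>GF F\<^esub> \<sigma>)) (\<omega>' \<otimes>\<^bsub>GF F'\<^esub> fs F'' F' (inv\<^bsub>GF F''\<^esub> \<omega>))"
    by (rule shift_comp[OF F(2)]) (use c a a' in \<open>simp_all add: w \<gamma>'_def \<sigma>'_def\<close>)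
  also have "\<dots> = shift F' \<gamma> \<one>\<^bsub>GF F'\<^esub> \<one>\<^bsub>GF F'\<^esub>"
    using a by (simp add: w \<sigma>'_def \<omega>'_def)
  finally have m: "bimnd_comp1 K ?rx ?ly = bimnd_id1 K (part_at F' \<gamma>)"
    using shift_one[OF F(2) c(2)] by simp
  have x': "x \<in> bimnd_1cells K (part_at F' \<gamma>) (part_at F'' \<alpha>)" and y': "y \<in> bimnd_1cells K (part_at F \<delta>) (part_at F' \<gamma>)"
    using x y by simp_all
  have yr: "bimnd_comp1 K y ?ry \<in> bimnd_1cells K (part_at F \<delta>') (part_at F' \<gamma>)"
    by (rule bimnd_comp1_closed[OF D(1) s(5,6) y' S(4)])
  have lyr: "bimnd_comp1 K ?ly (bimnd_comp1 K y ?ry) \<in> bimnd_1cells K (part_at F \<delta>') (part_at F' \<gamma>')"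
    by (rule bimnd_comp1_closed[OF D(1) s(6) D(2) S(3) yr])
  have xr: "bimnd_comp1 K x ?rx \<in> bimnd_1cells K (part_at F' \<gamma>') (part_at F'' \<alpha>)"
    by (rule bimnd_comp1_closed[OF D(2) s(1,2) x' S(2)])
  have "bimnd_comp1 K (twist F' F'' (\<alpha>, \<gamma>) \<sigma>' \<omega> x) (twist F F' (\<gamma>, \<delta>) \<sigma> \<omega>' y)
      = bimnd_comp1 K (bimnd_comp1 K ?lx (bimnd_comp1 K x ?rx)) (bimnd_comp1 K ?ly (bimnd_comp1 K y ?ry))"
    by (simp only: twist_def \<gamma>'(2) \<delta>'_def fst_conv)
  also have "\<dots> = bimnd_comp1 K ?lx (bimnd_comp1 K x (bimnd_comp1 K ?rx (bimnd_comp1 K ?ly (bimnd_comp1 K y ?ry))))"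
    by (simp only: bimnd_comp1_assoc[OF D(1,2) s(2) D(3) lyr xr S(1)] bimnd_comp1_assoc[OF D(1,2) s(1,2) lyr S(2) x'])
  also have "bimnd_comp1 K ?rx (bimnd_comp1 K ?ly (bimnd_comp1 K y ?ry)) = bimnd_comp1 K y ?ry"
    by (simp only: bimnd_comp1_assoc[OF D(1) s(6) D(2) s(1) yr S(3,2)] m bimnd_comp1_id1[OF D(1) s(6) yr])
  also have "bimnd_comp1 K x (bimnd_comp1 K y ?ry) = bimnd_comp1 K (bimnd_comp1 K x y) ?ry"
    by (rule bimnd_comp1_assoc[OF D(1) s(5,6,2) S(4) y' x'])
  also have "bimnd_comp1 K ?lx \<dots> = twist F F'' (\<alpha>, \<delta>) \<sigma> \<omega> (bimnd_comp1 K x y)"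
    using a by (simp add: twist_def \<delta>'_def twist_degree_def \<sigma>'_def \<omega>'_def w)
  finally show ?thesis by (simp only: \<sigma>'_def \<omega>'_def)
qed

section \<open>Hom-categories and the group action\<close>

lemma category_bimnd_hom_cat:
  assumes D: "bimnd_data P" "bimnd_data P'"
  shows "category (bimnd_hom_cat K P P')"
proof
  fix f assume f: "f \<in> Ar (bimnd_hom_cat K P P')"
  then have f': "f \<in> bimnd_2cells K P P'" by (simp add: bimnd_hom_cat_def)
  then show "dm (bimnd_hom_cat K P P') f \<in> Ob (bimnd_hom_cat K P P')"
    "cd (bimnd_hom_cat K P P') f \<in> Ob (bimnd_hom_cat K P P')"
    "cmp (bimnd_hom_cat K P P') (idn (bimnd_hom_cat K P P') (cd (bimnd_hom_cat K P P') f)) f = f"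
    "cmp (bimnd_hom_cat K P P') f (idn (bimnd_hom_cat K P P') (dm (bimnd_hom_cat K P P') f)) = f"
    by (simp_all add: bimnd_hom_cat_def bimnd_2cells_ends bimnd_vcomp_id2)
  fix g assume "g \<in> Ar (bimnd_hom_cat K P P')" "cd (bimnd_hom_cat K P P') f = dm (bimnd_hom_cat K P P') g"
  then have g: "g \<in> bimnd_2cells K P P'" "snd (snd f) = fst g" by (simp_all add: bimnd_hom_cat_def)
  then show "cmp (bimnd_hom_cat K P P') g f \<in> Ar (bimnd_hom_cat K P P')"
    "dm (bimnd_hom_cat K P P') (cmp (bimnd_hom_cat K P P') g f) = dm (bimnd_hom_cat K P P') f"
    "cd (bimnd_hom_cat K P P') (cmp (bimnd_hom_cat K P P') g f) = cd (bimnd_hom_cat K P P') g"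
    using bimnd_vcomp_closed[OF D f' g] by (simp_all add: bimnd_hom_cat_def bimnd_vcomp_ends)
  fix h assume "h \<in> Ar (bimnd_hom_cat K P P')" "cd (bimnd_hom_cat K P P') g = dm (bimnd_hom_cat K P P') h"
  then show "cmp (bimnd_hom_cat K P P') h (cmp (bimnd_hom_cat K P P') g f)
      = cmp (bimnd_hom_cat K P P') (cmp (bimnd_hom_cat K P P') h g) f"
    using bimnd_vcomp_assoc[OF f' g(1) _ g(2)] by (simp add: bimnd_hom_cat_def)
next
  fix x assume "x \<in> Ob (bimnd_hom_cat K P P')"
  then show "idn (bimnd_hom_cat K P P') x \<in> Ar (bimnd_hom_cat K P P')"
    "dm (bimnd_hom_cat K P P') (idn (bimnd_hom_cat K P P') x) = x"
    "cd (bimnd_hom_cat K P P') (idn (bimnd_hom_cat K P P') x) = x"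
    using bimnd_id2_closed[OF D] by (simp_all add: bimnd_hom_cat_def bimnd_id2_def)
qed

lemma part_simps:
  "dm (partT F F' c) = fst" "cd (partT F F' c) = (\<lambda>z. snd (snd z))"
  "idn (partT F F' c) = bimnd_id2 K" "cmp (partT F F' c) = bimnd_vcomp K"
  by (simp_all add: bimndT_part_def bimnd_hom_cat_def split_beta Let_def)

lemma part_iso:
  "GF F \<cong> GF F' \<Longrightarrow> partT F F' c = bimnd_hom_cat K (part_at F (snd c)) (part_at F' (fst c))"
  by (simp add: bimndT_part_def split_beta)

lemma part_Ob_iff: "y \<in> Ob (partT F F' c) \<longleftrightarrow> GF F \<cong> GF F' \<and> y \<in> one_cells F F' c"
  by (simp add: bimndT_part_def split_beta bimnd_hom_cat_def Let_def)

lemma part_Ar_iff: "z \<in> Ar (partT F F' c) \<longleftrightarrow> GF F \<cong> GF F' \<and> z \<in> two_cells F F' c"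
  by (simp add: bimndT_part_def split_beta bimnd_hom_cat_def Let_def)

lemma hom_simps:
  "dm (homT F F') = (\<lambda>(c, z). (c, fst z))" "cd (homT F F') = (\<lambda>(c, z). (c, snd (snd z)))"
  "idn (homT F F') = (\<lambda>(c, y). (c, bimnd_id2 K y))"
  "cmp (homT F F') = (\<lambda>(d, w) (c, z). (c, bimnd_vcomp K w z))"
  by (simp_all add: bimndT_hom_def disj_union_cat_def part_simps)

lemma hom_Ob_iff: "(c, y) \<in> Ob (homT F F') \<longleftrightarrow> GF F \<cong> GF F' \<and> c \<in> carrier (grp F F') \<and> y \<in> one_cells F F' c"
  by (auto simp: bimndT_hom_def disj_union_cat_def part_Ob_iff)

lemma hom_Ar_iff: "(c, z) \<in> Ar (homT F F') \<longleftrightarrow> GF F \<cong> GF F' \<and> c \<in> carrier (grp F F') \<and> z \<in> two_cells F F' c"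
  by (auto simp: bimndT_hom_def disj_union_cat_def part_Ar_iff)

lemma category_part:
  assumes "F \<in> T" "F' \<in> T" "c \<in> carrier (grp F F')"
  shows "category (partT F F' c)"
proof (cases "GF F \<cong> GF F'")
  case True
  then have "fst c \<in> carrier (GF F')" "snd c \<in> carrier (GF F)"
    using assms(3) by (auto simp: grp_iso)
  then show ?thesis
    using True assms by (simp add: part_iso category_bimnd_hom_cat data_part_at)
next
  case False
  \<comment> \<open>Here the component is the empty category.\<close>
  then show ?thesis by unfold_locales (simp_all add: part_Ob_iff part_Ar_iff)
qed

lemma category_hom: "F \<in> T \<Longrightarrow> F' \<in> T \<Longrightarrow> category (homT F F')"
  unfolding bimndT_hom_def by (rule category_disj_union) (rule category_part)

text \<open>\<open>act_phi\<close> and \<open>act_psi\<close> are the \<open>\<sigma>\<close> and \<open>\<omega>\<close> of the functor \<open>\<phi>\<^bsub>(\<alpha>,\<beta>)\<^esub>\<close> in degree \<open>(\<gamma>, \<delta>)\<close>.\<close>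

definition act_phi :: "('o, 'm, 'c) bimndT \<Rightarrow> ('o, 'm, 'c) bimndT \<Rightarrow> 'c \<times> 'c \<Rightarrow> 'c" where
  "act_phi F F' = (\<lambda>(\<alpha>, \<beta>). \<beta> \<otimes>\<^bsub>GF F\<^esub> fs F' F (inv\<^bsub>GF F'\<^esub> \<alpha>))"

definition act_psi :: "('o, 'm, 'c) bimndT \<Rightarrow> ('o, 'm, 'c) bimndT \<Rightarrow> 'c \<times> 'c \<Rightarrow> 'c \<times> 'c \<Rightarrow> 'c" where
  "act_psi F F' = (\<lambda>(\<alpha>, \<beta>) (\<gamma>, \<delta>). inv\<^bsub>GF F'\<^esub> \<gamma> \<otimes>\<^bsub>GF F'\<^esub> fs F F' \<beta> \<otimes>\<^bsub>GF F'\<^esub> \<gamma> \<otimes>\<^bsub>GF F'\<^esub> inv\<^bsub>GF F'\<^esub> \<alpha>)"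

abbreviation conj_by where
  "conj_by F F' a c \<equiv> a \<otimes>\<^bsub>grp F F'\<^esub> c \<otimes>\<^bsub>grp F F'\<^esub> inv\<^bsub>grp F F'\<^esub> a"

text \<open>Composition in the Turaev 2-category twists only \<psi>; as a twist it therefore has
  \<sigma> = e, and this must leave \<phi> unchanged.\<close>

lemma phi_twist_one:
  assumes "F \<in> T" "F' \<in> T" "GF F \<cong> GF F'"
    and y: "(part_at F \<delta>, (Y, \<psi>, \<phi>), part_at F' \<gamma>) \<in> bimnd_1cells K (part_at F \<delta>) (part_at F' \<gamma>)"
  shows "phi_twist K j F F' \<one>\<^bsub>GF F\<^esub> Y \<phi> = \<phi>"
proof -
  note t = bimnd_1cellsD[OF y, unfolded part_at_simps] typed_structureD(1-4)[OF typed_cell0[OF assms(1)]]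
    typed_structureD(1-4)[OF typed_cell0[OF assms(2)]]
  have "fs F F' (inv\<^bsub>GF F\<^esub> \<one>\<^bsub>GF F\<^esub>) = \<one>\<^bsub>GF F'\<^esub>"
    using assms by (simp add: word_simps)
  then show ?thesis
    unfolding phi_twist_def by (simp add: autT_one typing t)
qed

context
  fixes F F' assumes F: "F \<in> T" "F' \<in> T" and iso: "GF F \<cong> GF F'"
begin

lemma act_parameters_closed:
  assumes "a \<in> carrier (grp F F')" "c \<in> carrier (grp F F')"
  shows "act_phi F F' a \<in> carrier (GF F)" "act_psi F F' a c \<in> carrier (GF F')"
  using assms by (auto simp: act_phi_def act_psi_def grp_iso iso iso'[OF F iso] F word_simps)

text \<open>With \<sigma> = \<beta> \<alpha>^-1 and \<omega> = \<gamma>^-1 \<beta> \<gamma>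
  \<alpha>^-1, fusion maps suppressed, \<sigma>^-1 \<gamma> \<omega> = \<alpha> \<gamma> \<alpha>^-1
  and \<sigma>^-1 \<delta> \<omega> = \<alpha> \<beta>^-1 \<delta> \<gamma>^-1 \<beta> \<gamma>
  \<alpha>^-1, the two components of the conjugate. This is the origin of the parameters.\<close>

lemma conj_eq_twist_degree:
  assumes "a \<in> carrier (grp F F')" "c \<in> carrier (grp F F')"
  shows "conj_by F F' a c = twist_degree F F' (act_phi F F' a) (act_psi F F' a c) c"
  using assms by (auto simp: grp_iso grp_inv twist_degree_def act_phi_def act_psi_def iso iso'[OF F iso] F word_simps)

lemma conj_closed:
  assumes "a \<in> carrier (grp F F')" "c \<in> carrier (grp F F')"
  shows "conj_by F F' a c \<in> carrier (grp F F')"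
  unfolding conj_eq_twist_degree[OF assms]
  by (rule twist_degree_closed[OF F iso assms(2) act_parameters_closed[OF assms]])

lemma act0_eq_twist:
  assumes a: "a \<in> carrier (grp F F')" and c: "c \<in> carrier (grp F F')" and y: "y \<in> one_cells F F' c"
  shows "bimndT_act0 K j F F' a c y = twist F F' c (act_phi F F' a) (act_psi F F' a c) y"
proof -
  obtain \<alpha> \<beta> \<gamma> \<delta> where e: "a = (\<alpha>, \<beta>)" "c = (\<gamma>, \<delta>)" by fastforce
  obtain Y \<psi> \<phi> where f: "y = (part_at F \<delta>, (Y, \<psi>, \<phi>), part_at F' \<gamma>)"
    using y unfolding e by (elim bimnd_1cells_cases) simp
  have "conj_by F F' (\<alpha>, \<beta>) (\<gamma>, \<delta>) = twist_degree F F' (act_phi F F' a) (act_psi F F' a c) (\<gamma>, \<delta>)"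
    using conj_eq_twist_degree[OF a c] by (simp only: e)
  then show ?thesis
    unfolding e f
    using twist_explicit[OF F iso c[unfolded e] act_parameters_closed[OF a c] y[unfolded e f], unfolded e]
    by (simp add: bimndT_act0_def Let_def split_beta act_phi_def act_psi_def)
qed

lemma act_apply:
  assumes a: "a \<in> carrier (grp F F')" and c: "c \<in> carrier (grp F F')"
  shows "y \<in> one_cells F F' c \<Longrightarrow> fst (actT F F' a) (c, y)
      = (conj_by F F' a c, twist F F' c (act_phi F F' a) (act_psi F F' a c) y)"
    "z \<in> two_cells F F' c \<Longrightarrow> snd (actT F F' a) (c, z)
      = (conj_by F F' a c, twist2 F F' c (act_phi F F' a) (act_psi F F' a c) z)"
proof -
  show "fst (actT F F' a) (c, y)
      = (conj_by F F' a c, twist F F' c (act_phi F F' a) (act_psi F F' a c) y)" if "y \<in> one_cells F F' c"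
    using that c by (simp add: bimndT_act_def Let_def hom_Ob_iff iso act0_eq_twist[OF a c])
  show "snd (actT F F' a) (c, z)
      = (conj_by F F' a c, twist2 F F' c (act_phi F F' a) (act_psi F F' a c) z)" if z: "z \<in> two_cells F F' c"
    using z c bimnd_2cells_ends[OF z]
    by (simp add: bimndT_act_def Let_def hom_Ar_iff iso act0_eq_twist[OF a c] twist2_def split_beta)
qed

lemma twist_act_closed:
  assumes a: "a \<in> carrier (grp F F')" and c: "c \<in> carrier (grp F F')"
  shows "y \<in> one_cells F F' c \<Longrightarrow> twist F F' c (act_phi F F' a) (act_psi F F' a c) y \<in> one_cells F F' (conj_by F F' a c)"
    "z \<in> two_cells F F' c \<Longrightarrow> twist2 F F' c (act_phi F F' a) (act_psi F F' a c) z \<in> two_cells F F' (conj_by F F' a c)"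
  unfolding conj_eq_twist_degree[OF a c]
  using twist_closed[OF F iso c act_parameters_closed[OF a c]] twist2_closed[OF F iso c act_parameters_closed[OF a c]]
  by simp_all

text \<open>\<sigma> is antimultiplicative and \<omega> satisfies a cocycle law, its value for a
  being taken at the degree already conjugated by b. These are the products that
  \<open>twist_twist\<close> produces when acting by b and then by a.\<close>

lemma act_mult_parameters:
  assumes "a \<in> carrier (grp F F')" "b \<in> carrier (grp F F')" "c \<in> carrier (grp F F')"
  shows "act_phi F F' (a \<otimes>\<^bsub>grp F F'\<^esub> b) = act_phi F F' b \<otimes>\<^bsub>GF F\<^esub> act_phi F F' a"
    "act_psi F F' (a \<otimes>\<^bsub>grp F F'\<^esub> b) c = act_psi F F' b c \<otimes>\<^bsub>GF F'\<^esub> act_psi F F' a (conj_by F F' b c)"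
    "conj_by F F' (a \<otimes>\<^bsub>grp F F'\<^esub> b) c = conj_by F F' a (conj_by F F' b c)"
proof -
  show "act_phi F F' (a \<otimes>\<^bsub>grp F F'\<^esub> b) = act_phi F F' b \<otimes>\<^bsub>GF F\<^esub> act_phi F F' a"
    "act_psi F F' (a \<otimes>\<^bsub>grp F F'\<^esub> b) c = act_psi F F' b c \<otimes>\<^bsub>GF F'\<^esub> act_psi F F' a (conj_by F F' b c)"
    using assms by (auto simp: grp_iso grp_inv act_phi_def act_psi_def iso iso'[OF F iso] F word_simps)
  interpret group "grp F F'" by (rule group_grp[OF F])
  show "conj_by F F' (a \<otimes>\<^bsub>grp F F'\<^esub> b) c = conj_by F F' a (conj_by F F' b c)"
    using assms by (simp add: inv_mult_group m_assoc)
qed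

lemma act_one_parameters:
  assumes "c \<in> carrier (grp F F')"
  shows "act_phi F F' \<one>\<^bsub>grp F F'\<^esub> = \<one>\<^bsub>GF F\<^esub>" "act_psi F F' \<one>\<^bsub>grp F F'\<^esub> c = \<one>\<^bsub>GF F'\<^esub>"
    "conj_by F F' \<one>\<^bsub>grp F F'\<^esub> c = c"
proof -
  show "act_phi F F' \<one>\<^bsub>grp F F'\<^esub> = \<one>\<^bsub>GF F\<^esub>" "act_psi F F' \<one>\<^bsub>grp F F'\<^esub> c = \<one>\<^bsub>GF F'\<^esub>"
    using assms by (auto simp: grp_one grp_iso act_phi_def act_psi_def iso iso'[OF F iso] F word_simps)
  interpret group "grp F F'" by (rule group_grp[OF F])
  show "conj_by F F' \<one>\<^bsub>grp F F'\<^esub> c = c"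
    using assms by simp
qed

lemma act_act:
  assumes a: "a \<in> carrier (grp F F')" and b: "b \<in> carrier (grp F F')" and c: "c \<in> carrier (grp F F')"
  shows "y \<in> one_cells F F' c \<Longrightarrow> fst (actT F F' a) (fst (actT F F' b) (c, y))
      = fst (actT F F' (a \<otimes>\<^bsub>grp F F'\<^esub> b)) (c, y)"
    "z \<in> two_cells F F' c \<Longrightarrow> snd (actT F F' a) (snd (actT F F' b) (c, z))
      = snd (actT F F' (a \<otimes>\<^bsub>grp F F'\<^esub> b)) (c, z)"
proof -
  have ab: "a \<otimes>\<^bsub>grp F F'\<^esub> b \<in> carrier (grp F F')"
    using group.is_monoid[OF group_grp[OF F]] a b by (simp add: monoid.m_closed)
  note bc = conj_closed[OF b c]
  have tw: "twist F F' (conj_by F F' b c) (act_phi F F' a) (act_psi F F' a (conj_by F F' b c))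
      (twist F F' c (act_phi F F' b) (act_psi F F' b c) y)
    = twist F F' c (act_phi F F' (a \<otimes>\<^bsub>grp F F'\<^esub> b)) (act_psi F F' (a \<otimes>\<^bsub>grp F F'\<^esub> b) c) y"
    if "y \<in> one_cells F F' c" for y
    unfolding act_mult_parameters[OF a b c]
    by (rule twist_twist[OF F iso c act_parameters_closed[OF b c] act_parameters_closed[OF a bc] that
        conj_eq_twist_degree[OF b c]])
  show "fst (actT F F' a) (fst (actT F F' b) (c, y))
      = fst (actT F F' (a \<otimes>\<^bsub>grp F F'\<^esub> b)) (c, y)" if "y \<in> one_cells F F' c"
    using that by (simp only: act_apply[OF b c] act_apply[OF a bc] act_apply[OF ab c] twist_act_closed[OF b c]
        tw act_mult_parameters(3)[OF a b c])
  show "snd (actT F F' a) (snd (actT F F' b) (c, z))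
      = snd (actT F F' (a \<otimes>\<^bsub>grp F F'\<^esub> b)) (c, z)" if z: "z \<in> two_cells F F' c"
    unfolding act_apply(2)[OF b c z] act_apply(2)[OF a bc twist_act_closed(2)[OF b c z]] act_apply(2)[OF ab c z]
      act_mult_parameters(3)[OF a b c]
    unfolding twist2_def fst_conv snd_conv
    by (simp only: tw[OF bimnd_2cells_ends(1)[OF z]] tw[OF bimnd_2cells_ends(2)[OF z]])
qed

lemma act_one:
  assumes c: "c \<in> carrier (grp F F')"
  shows "y \<in> one_cells F F' c \<Longrightarrow> fst (actT F F' \<one>\<^bsub>grp F F'\<^esub>) (c, y) = (c, y)"
    "z \<in> two_cells F F' c \<Longrightarrow> snd (actT F F' \<one>\<^bsub>grp F F'\<^esub>) (c, z) = (c, z)"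
proof -
  note e = grp_one_closed[OF F]
  show "fst (actT F F' \<one>\<^bsub>grp F F'\<^esub>) (c, y) = (c, y)" if "y \<in> one_cells F F' c"
    using act_apply(1)[OF e c that] twist_one[OF F iso c that] by (simp only: act_one_parameters[OF c])
  show "snd (actT F F' \<one>\<^bsub>grp F F'\<^esub>) (c, z) = (c, z)" if z: "z \<in> two_cells F F' c"
    using act_apply(2)[OF e c z] twist_one[OF F iso c bimnd_2cells_ends(1)[OF z]]
      twist_one[OF F iso c bimnd_2cells_ends(2)[OF z]]
    by (simp add: act_one_parameters[OF c] twist2_def)
qed

lemma twist2_id2:
  assumes c: "c \<in> carrier (grp F F')" and a: "\<sigma> \<in> carrier (GF F)" "\<omega> \<in> carrier (GF F')"
    and y: "y \<in> one_cells F F' c"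
  shows "twist2 F F' c \<sigma> \<omega> (bimnd_id2 K y) = bimnd_id2 K (twist F F' c \<sigma> \<omega> y)"
  using underlying_twist[OF F iso c a y] by (simp add: twist2_def bimnd_id2_def)

end

section \<open>The action as a homomorphism into the automorphism group\<close>

lemma twist2_vcomp:
  "twist2 F F' c \<sigma> \<omega> (bimnd_vcomp K z w) = bimnd_vcomp K (twist2 F F' c \<sigma> \<omega> z) (twist2 F F' c \<sigma> \<omega> w)"
  by (simp add: twist2_def bimnd_vcomp_def split_beta)

lemma act_endofunctor:
  assumes F: "F \<in> T" "F' \<in> T" and a: "a \<in> carrier (grp F F')"
  shows "actT F F' a \<in> endofunctors (homT F F')"
proof -
  let ?H = "homT F F'" and ?A = "actT F F' a"
  interpret category ?H by (rule category_hom[OF F])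
  have "is_functor ?H ?H ?A"
    unfolding is_functor_def
  proof (intro conjI ballI impI)
    show "fst ?A \<in> Ob ?H \<rightarrow> Ob ?H"
    proof
      fix x assume x: "x \<in> Ob ?H"
      obtain c y where e: "x = (c, y)" by (cases x)
      have h: "GF F \<cong> GF F'" "c \<in> carrier (grp F F')" "y \<in> one_cells F F' c"
        using x by (simp_all add: e hom_Ob_iff)
      show "fst ?A x \<in> Ob ?H"
        unfolding e act_apply(1)[OF F h(1) a h(2,3)] hom_Ob_iff
        using h(1) conj_closed[OF F h(1) a h(2)] twist_act_closed(1)[OF F h(1) a h(2,3)] by blast
    qed
    show "snd ?A \<in> Ar ?H \<rightarrow> Ar ?H"
    proof
      fix x assume x: "x \<in> Ar ?H"
      obtain c z where e: "x = (c, z)" by (cases x)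
      have h: "GF F \<cong> GF F'" "c \<in> carrier (grp F F')" "z \<in> two_cells F F' c"
        using x by (simp_all add: e hom_Ar_iff)
      show "snd ?A x \<in> Ar ?H"
        unfolding e act_apply(2)[OF F h(1) a h(2,3)] hom_Ar_iff
        using h(1) conj_closed[OF F h(1) a h(2)] twist_act_closed(2)[OF F h(1) a h(2,3)] by blast
    qed
  next
    fix x assume x: "x \<in> Ar ?H"
    obtain c z where e: "x = (c, z)" by (cases x)
    have h: "GF F \<cong> GF F'" "c \<in> carrier (grp F F')" "z \<in> two_cells F F' c"
      using x by (simp_all add: e hom_Ar_iff)
    note act = act_apply[OF F h(1) a h(2)] and ends = bimnd_2cells_ends[OF h(3)]
    show "dm ?H (snd ?A x) = fst ?A (dm ?H x)" "cd ?H (snd ?A x) = fst ?A (cd ?H x)"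
      by (simp_all add: e hom_simps act(2)[OF h(3)] act(1)[OF ends(1)] act(1)[OF ends(2)] twist2_def)
    fix x' assume x': "x' \<in> Ar ?H" "cd ?H x = dm ?H x'"
    obtain z' where e': "x' = (c, z')"
      using x'(2) by (cases x') (auto simp: e hom_simps)
    have "z' \<in> two_cells F F' c"
      using x'(1) by (simp add: e' hom_Ar_iff)
    moreover have "bimnd_vcomp K z' z \<in> two_cells F F' c"
      using cmp_Ar[OF x x'] by (simp add: e e' hom_simps hom_Ar_iff)
    ultimately show "snd ?A (cmp ?H x' x) = cmp ?H (snd ?A x') (snd ?A x)"
      by (simp add: e e' hom_simps act(2)[OF h(3)] act(2) twist2_vcomp)
  next
    fix x assume x: "x \<in> Ob ?H"
    obtain c y where e: "x = (c, y)" by (cases x)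
    have h: "GF F \<cong> GF F'" "c \<in> carrier (grp F F')" "y \<in> one_cells F F' c"
      using x by (simp_all add: e hom_Ob_iff)
    have "bimnd_id2 K y \<in> two_cells F F' c"
      using idn_Ar[OF x] by (simp add: e hom_simps hom_Ar_iff)
    then show "snd ?A (idn ?H x) = idn ?H (fst ?A x)"
      using twist2_id2[OF F h(1,2) act_parameters_closed[OF F h(1) a h(2)] h(3)]
      by (simp add: e hom_simps act_apply[OF F h(1) a h(2)] h(3))
  qed
  then show ?thesis
    by (simp add: endofunctors_def bimndT_act_def Let_def)
qed

text \<open>Both sides are extensional on objects and arrows of the hom-category, so
  \<open>act_act\<close>, an equation for single cells, gives equality of functors.\<close>

lemma act_mult:
  assumes F: "F \<in> T" "F' \<in> T" and a: "a \<in> carrier (grp F F')" and b: "b \<in> carrier (grp F F')"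
  shows "actT F F' (a \<otimes>\<^bsub>grp F F'\<^esub> b)
    = functor_comp (homT F F') (actT F F' a) (actT F F' b)"
proof -
  let ?H = "homT F F'"
  interpret group "grp F F'" by (rule group_grp[OF F])
  note E = endofunctorsD(3,4)[OF act_endofunctor[OF F m_closed[OF a b]]]
  have "fst (actT F F' (a \<otimes>\<^bsub>grp F F'\<^esub> b)) = compose (Ob ?H) (fst (actT F F' a)) (fst (actT F F' b))"
  proof (rule extensionalityI[OF E(1) compose_extensional])
    fix x assume "x \<in> Ob ?H"
    then show "fst (actT F F' (a \<otimes>\<^bsub>grp F F'\<^esub> b)) x = compose (Ob ?H) (fst (actT F F' a)) (fst (actT F F' b)) x"
      by (cases x) (simp add: compose_def hom_Ob_iff act_act(1)[OF F _ a b])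
  qed
  moreover have "snd (actT F F' (a \<otimes>\<^bsub>grp F F'\<^esub> b)) = compose (Ar ?H) (snd (actT F F' a)) (snd (actT F F' b))"
  proof (rule extensionalityI[OF E(2) compose_extensional])
    fix x assume x: "x \<in> Ar ?H"
    moreover obtain c z where e: "x = (c, z)" by (cases x)
    ultimately have "GF F \<cong> GF F'" "c \<in> carrier (grp F F')" "z \<in> two_cells F F' c"
      by (simp_all add: hom_Ar_iff)
    from act_act(2)[OF F this(1) a b this(2,3)] x
    show "snd (actT F F' (a \<otimes>\<^bsub>grp F F'\<^esub> b)) x = compose (Ar ?H) (snd (actT F F' a)) (snd (actT F F' b)) x"
      by (simp add: compose_def e)
  qed
  ultimately show ?thesis by (simp add: functor_comp_def prod_eq_iff)
qed

lemma act_unit: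
  assumes F: "F \<in> T" "F' \<in> T"
  shows "actT F F' \<one>\<^bsub>grp F F'\<^esub> = functor_id (homT F F')"
proof -
  let ?H = "homT F F'"
  note E = endofunctorsD(3,4)[OF act_endofunctor[OF F grp_one_closed[OF F]]]
  have "fst (actT F F' \<one>\<^bsub>grp F F'\<^esub>) = (\<lambda>x\<in>Ob ?H. x)"
  proof (rule extensionalityI[OF E(1) restrict_extensional])
    fix x assume "x \<in> Ob ?H"
    then show "fst (actT F F' \<one>\<^bsub>grp F F'\<^esub>) x = (\<lambda>x\<in>Ob ?H. x) x"
      by (cases x) (simp add: hom_Ob_iff act_one(1)[OF F])
  qed
  moreover have "snd (actT F F' \<one>\<^bsub>grp F F'\<^esub>) = (\<lambda>x\<in>Ar ?H. x)"
  proof (rule extensionalityI[OF E(2) restrict_extensional])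
    fix x assume x: "x \<in> Ar ?H"
    moreover obtain c z where e: "x = (c, z)" by (cases x)
    ultimately have "GF F \<cong> GF F'" "c \<in> carrier (grp F F')" "z \<in> two_cells F F' c"
      by (simp_all add: hom_Ar_iff)
    from act_one(2)[OF F this] x show "snd (actT F F' \<one>\<^bsub>grp F F'\<^esub>) x = (\<lambda>x\<in>Ar ?H. x) x"
      by (simp add: e)
  qed
  ultimately show ?thesis by (simp add: functor_id_def prod_eq_iff)
qed

lemma act_group_hom:
  assumes F: "F \<in> T" "F' \<in> T"
  shows "group_hom (grp F F') (Aut_cat (homT F F')) (actT F F')"
proof -
  interpret group "grp F F'" by (rule group_grp[OF F])
  have "actT F F' a \<in> carrier (Aut_cat (homT F F'))" if a: "a \<in> carrier (grp F F')" for a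
  proof -
    have "functor_comp (homT F F') (actT F F' a) (actT F F' (inv\<^bsub>grp F F'\<^esub> a)) = functor_id (homT F F')"
      "functor_comp (homT F F') (actT F F' (inv\<^bsub>grp F F'\<^esub> a)) (actT F F' a) = functor_id (homT F F')"
      using a by (simp_all add: act_mult[OF F, symmetric] act_unit[OF F])
    then show ?thesis
      using act_endofunctor[OF F a] act_endofunctor[OF F inv_closed[OF a]] by (auto simp: Aut_cat_def)
  qed
  then have "actT F F' \<in> hom (grp F F') (Aut_cat (homT F F'))"
    by (simp add: hom_def act_mult[OF F]) (simp add: Aut_cat_def)
  then show ?thesis
    by (simp add: group_hom_def group_hom_axioms_def group_Aut_cat category_hom F group_grp)
qed

text \<open>One inclusion is closure under the action. For the other, a cell of the conjugate degree
  is carried back by the action of the inverse, which provides the preimage.\<close>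

lemma act_part_image:
  assumes F: "F \<in> T" "F' \<in> T" and c: "c \<in> carrier (grp F F')" and a: "a \<in> carrier (grp F F')"
  shows "fst (actT F F' a) ` ({c} \<times> Ob (partT F F' c))
      = {conj_by F F' a c} \<times> Ob (partT F F' (conj_by F F' a c))"
    "snd (actT F F' a) ` ({c} \<times> Ar (partT F F' c))
      = {conj_by F F' a c} \<times> Ar (partT F F' (conj_by F F' a c))"
proof -
  interpret group "grp F F'" by (rule group_grp[OF F])
  note a' = inv_closed[OF a]
  define d where "d = conj_by F F' a c"
  have d: "d \<in> carrier (grp F F')" "conj_by F F' (inv\<^bsub>grp F F'\<^esub> a) d = c"
    using a c by (simp_all add: d_def m_assoc inv_cancel)
  show "fst (actT F F' a) ` ({c} \<times> Ob (partT F F' c))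
      = {conj_by F F' a c} \<times> Ob (partT F F' (conj_by F F' a c))"
    unfolding d_def[symmetric]
  proof (intro equalityI subsetI)
    fix x assume "x \<in> fst (actT F F' a) ` ({c} \<times> Ob (partT F F' c))"
    then show "x \<in> {d} \<times> Ob (partT F F' d)"
      using act_apply(1)[OF F _ a c] twist_act_closed(1)[OF F _ a c, folded d_def] by (auto simp: part_Ob_iff d_def)
  next
    fix x assume "x \<in> {d} \<times> Ob (partT F F' d)"
    then obtain y where e: "x = (d, y)" "GF F \<cong> GF F'" "y \<in> one_cells F F' d"
      by (auto simp: part_Ob_iff)
    \<comment> \<open>The preimage of x: it lies in degree c, because conjugating d back by the
      inverse of a returns c.\<close>
    let ?x = "fst (actT F F' (inv\<^bsub>grp F F'\<^esub> a)) x"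
    have "fst (actT F F' a) ?x = x"
      using act_act(1)[OF F e(2) a a' d(1) e(3)] act_one(1)[OF F e(2) d(1) e(3)] a by (simp add: e(1))
    moreover have "?x \<in> {c} \<times> Ob (partT F F' c)"
      using act_apply(1)[OF F e(2) a' d(1) e(3)] twist_act_closed(1)[OF F e(2) a' d(1) e(3)] d(2) e(2)
      by (simp add: e(1) part_Ob_iff)
    ultimately show "x \<in> fst (actT F F' a) ` ({c} \<times> Ob (partT F F' c))"
      by (metis imageI)
  qed
  show "snd (actT F F' a) ` ({c} \<times> Ar (partT F F' c))
      = {conj_by F F' a c} \<times> Ar (partT F F' (conj_by F F' a c))"
    unfolding d_def[symmetric]
  proof (intro equalityI subsetI)
    fix x assume "x \<in> snd (actT F F' a) ` ({c} \<times> Ar (partT F F' c))"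
    then obtain z where "x = snd (actT F F' a) (c, z)" "GF F \<cong> GF F'" "z \<in> two_cells F F' c"
      by (auto simp: part_Ar_iff)
    then show "x \<in> {d} \<times> Ar (partT F F' d)"
      using act_apply(2)[OF F _ a c] twist_act_closed(2)[OF F _ a c, folded d_def] by (simp add: part_Ar_iff d_def)
  next
    fix x assume "x \<in> {d} \<times> Ar (partT F F' d)"
    then obtain y where e: "x = (d, y)" "GF F \<cong> GF F'" "y \<in> two_cells F F' d"
      by (auto simp: part_Ar_iff)
    let ?x = "snd (actT F F' (inv\<^bsub>grp F F'\<^esub> a)) x"
    have "snd (actT F F' a) ?x = x"
      using act_act(2)[OF F e(2) a a' d(1) e(3)] act_one(2)[OF F e(2) d(1) e(3)] a by (simp add: e(1))
    moreover have "?x \<in> {c} \<times> Ar (partT F F' c)"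
      using act_apply(2)[OF F e(2) a' d(1) e(3)] twist_act_closed(2)[OF F e(2) a' d(1) e(3)] d(2) e(2)
      by (simp add: e(1) part_Ar_iff)
    ultimately show "x \<in> snd (actT F F' a) ` ({c} \<times> Ar (partT F F' c))"
      by (metis imageI)
  qed
qed

section \<open>Composition\<close>

text \<open>With nothing between them, the two shifts of the twist meet and cancel. What remains is
  an identity again, but at the degree \<sigma>^-1 \<omega> to which the twist has moved both
  ends.\<close>

lemma twist_id1:
  assumes F: "F \<in> T" and a: "\<sigma> \<in> carrier (GF F)" "\<omega> \<in> carrier (GF F)"
  shows "twist F F (\<one>\<^bsub>GF F\<^esub>, \<one>\<^bsub>GF F\<^esub>) \<sigma> \<omega> (bimnd_id1 K (unit_part K F))
    = bimnd_id1 K (part_at F (inv\<^bsub>GF F\<^esub> \<sigma> \<otimes>\<^bsub>GF F\<^esub> \<omega>))"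
proof -
  note w = autT_simps[OF F] fus_self[OF F]
  define d where "d = inv\<^bsub>GF F\<^esub> \<sigma> \<otimes>\<^bsub>GF F\<^esub> \<omega>"
  have d: "d \<in> carrier (GF F)" "\<sigma> \<otimes>\<^bsub>GF F\<^esub> d \<otimes>\<^bsub>GF F\<^esub> inv\<^bsub>GF F\<^esub> \<omega> = \<one>\<^bsub>GF F\<^esub>"
    using a by (simp_all add: d_def w)
  have i: "inv\<^bsub>GF F\<^esub> \<sigma> \<in> carrier (GF F)" "inv\<^bsub>GF F\<^esub> \<omega> \<in> carrier (GF F)" "\<one>\<^bsub>GF F\<^esub> \<in> carrier (GF F)"
    using a by (simp_all add: w)
  have s: "shift F d \<sigma> (inv\<^bsub>GF F\<^esub> \<omega>) \<in> bimnd_1cells K (part_at F d) (part_at F \<one>\<^bsub>GF F\<^esub>)"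
    using shift_closed[OF F d(1) a(1) i(2)] by (simp only: d(2))
  have "snd (twist_degree F F \<sigma> \<omega> (\<one>\<^bsub>GF F\<^esub>, \<one>\<^bsub>GF F\<^esub>)) = d"
    using a by (simp add: twist_degree_def d_def w)
  then have "twist F F (\<one>\<^bsub>GF F\<^esub>, \<one>\<^bsub>GF F\<^esub>) \<sigma> \<omega> (bimnd_id1 K (unit_part K F))
      = bimnd_comp1 K (shift F \<one>\<^bsub>GF F\<^esub> (inv\<^bsub>GF F\<^esub> \<sigma>) \<omega>) (shift F d \<sigma> (inv\<^bsub>GF F\<^esub> \<omega>))"
    using bimnd_comp1_id1(1)[OF data_part_at[OF F d(1)] data_part_at[OF F i(3)] s] i
    by (simp add: twist_def w unit_part_eq)
  also have "\<dots> = shift F d (inv\<^bsub>GF F\<^esub> \<sigma> \<otimes>\<^bsub>GF F\<^esub> \<sigma>) (inv\<^bsub>GF F\<^esub> \<omega> \<otimes>\<^bsub>GF F\<^esub> \<omega>)"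
    by (rule shift_comp[OF F d(1) a(1) i(2,1) a(2) d(2)[symmetric]])
  also have "\<dots> = bimnd_id1 K (part_at F d)"
    using a shift_one[OF F d(1)] by (simp add: w)
  finally show ?thesis by (simp only: d_def)
qed

text \<open>In \<open>\<psi>\<^bsub>XY\<^esub>\<close> the factor \<open>\<psi>\<^sub>X\<close> is twisted by \<open>j'(\<gamma>)\<close> and \<open>\<psi>\<^sub>Y\<close> by \<open>\<gamma>\<^sup>-\<^sup>1\<beta>\<gamma>\<close>.\<close>

definition comp_psi1 :: "('o, 'm, 'c) bimndT \<Rightarrow> ('o, 'm, 'c) bimndT \<Rightarrow> 'c \<times> 'c \<Rightarrow> 'c" where
  "comp_psi1 F' F'' a = fs F' F'' (fst a)"

definition comp_psi2 :: "('o, 'm, 'c) bimndT \<Rightarrow> 'c \<times> 'c \<Rightarrow> 'c \<times> 'c \<Rightarrow> 'c" where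
  "comp_psi2 F' b a = inv\<^bsub>GF F'\<^esub> (fst a) \<otimes>\<^bsub>GF F'\<^esub> snd b \<otimes>\<^bsub>GF F'\<^esub> fst a"

context
  fixes F F' F'' assumes F: "F \<in> T" "F' \<in> T" "F'' \<in> T" and iso: "GF F \<cong> GF F'" "GF F' \<cong> GF F''"
begin

lemma isos: "GF F \<cong> GF F''" "GF F' \<cong> GF F" "GF F'' \<cong> GF F'" "GF F'' \<cong> GF F"
  using iso_trans autT_iso_sym F iso by blast+

lemma comp_parameters_closed:
  assumes "b \<in> carrier (grp F' F'')" "a \<in> carrier (grp F F')"
  shows "comp_psi1 F' F'' a \<in> carrier (GF F'')" "comp_psi2 F' b a \<in> carrier (GF F')"
    "\<one>\<^bsub>GF F\<^esub> \<in> carrier (GF F)" "\<one>\<^bsub>GF F'\<^esub> \<in> carrier (GF F')"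
  using assms by (auto simp: comp_psi1_def comp_psi2_def grp_iso iso isos F word_simps)

text \<open>For b = (\<alpha>, \<beta>) and a = (\<gamma>, \<delta>) both inner ends move to \<beta>
  \<gamma>: on the left as \<beta> times \<gamma>, on the right as \<gamma> times \<gamma>^-1
  \<beta> \<gamma>. The outer ends become the components of the transitive product.\<close>

lemma comp_degrees:
  assumes "b \<in> carrier (grp F' F'')" "a \<in> carrier (grp F F')"
  shows "twist_degree F' F'' \<one>\<^bsub>GF F'\<^esub> (comp_psi1 F' F'' a) b
      = (fst (multT F F' F'' b a), snd b \<otimes>\<^bsub>GF F'\<^esub> fst a)"
    "twist_degree F F' \<one>\<^bsub>GF F\<^esub> (comp_psi2 F' b a) a
      = (snd b \<otimes>\<^bsub>GF F'\<^esub> fst a, snd (multT F F' F'' b a))"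
  using assms by (auto simp: comp_psi1_def comp_psi2_def grp_iso mult_iso twist_degree_def iso isos F word_simps)

text \<open>Identifies the composition of the Turaev 2-category with ordinary composition after a
  correction of degrees; from here on its explicit formula is no longer touched.\<close>

lemma comp1_eq_twist:
  assumes b: "b \<in> carrier (grp F' F'')" and a: "a \<in> carrier (grp F F')"
    and x: "x \<in> one_cells F' F'' b" and y: "y \<in> one_cells F F' a"
  shows "comp1T F F' F'' b a x y
    = bimnd_comp1 K (twist F' F'' b \<one>\<^bsub>GF F'\<^esub> (comp_psi1 F' F'' a) x) (twist F F' a \<one>\<^bsub>GF F\<^esub> (comp_psi2 F' b a) y)"
proof -
  obtain \<alpha> \<beta> \<gamma> \<delta> where e: "b = (\<alpha>, \<beta>)" "a = (\<gamma>, \<delta>)" by fastforce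
  obtain X \<psi> \<phi> where f: "x = (part_at F' \<beta>, (X, \<psi>, \<phi>), part_at F'' \<alpha>)"
    using x unfolding e by (elim bimnd_1cells_cases) simp
  obtain Y \<psi>' \<phi>' where g: "y = (part_at F \<delta>, (Y, \<psi>', \<phi>'), part_at F' \<gamma>)"
    using y unfolding e by (elim bimnd_1cells_cases) simp
  note p = comp_parameters_closed[OF b a]
  have \<gamma>: "\<gamma> \<in> carrier (GF F')" using a by (simp add: e grp_iso iso)
  \<comment> \<open>Since \<omega> = j'(\<gamma>), the factor j'^-1(\<omega>^-1) of the twist is
    \<gamma>^-1 itself.\<close>
  have 1: "psi_twist K j F' F'' (comp_psi1 F' F'' (\<gamma>, \<delta>)) X \<psi> = (X \<triangleright> inv\<^bsub>GF F'\<^esub> \<gamma>) \<bullet> \<psi> \<bullet> (fs F' F'' \<gamma> \<triangleleft> X)"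
    using \<gamma> by (simp add: psi_twist_def comp_psi1_def iso isos F word_simps)
  have 2: "phi_twist K j F' F'' \<one>\<^bsub>GF F'\<^esub> X \<phi> = \<phi>"
    using phi_twist_one[OF F(2,3) iso(2)] x unfolding e f by simp
  have 3: "phi_twist K j F F' \<one>\<^bsub>GF F\<^esub> Y \<phi>' = \<phi>'"
    using phi_twist_one[OF F(1,2) iso(1)] y unfolding e g by simp
  show ?thesis
    using twist_explicit[OF F(2,3) iso(2) b[unfolded e] p(4,1)[unfolded e] x[unfolded e f], unfolded 1 2]
      twist_explicit[OF F(1,2) iso(1) a[unfolded e] p(3,2)[unfolded e] y[unfolded e g], unfolded 3]
      comp_degrees[OF b a, unfolded e]
    unfolding e f g
    by (simp add: bimndT_comp1_def Let_def split_beta bimnd_comp1_def comp_psi2_def)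
qed

lemma comp_twists:
  assumes b: "b \<in> carrier (grp F' F'')" and a: "a \<in> carrier (grp F F')"
  shows "x \<in> one_cells F' F'' b \<Longrightarrow> twist F' F'' b \<one>\<^bsub>GF F'\<^esub> (comp_psi1 F' F'' a) x
      \<in> bimnd_1cells K (part_at F' (snd b \<otimes>\<^bsub>GF F'\<^esub> fst a)) (part_at F'' (fst (multT F F' F'' b a)))"
    "y \<in> one_cells F F' a \<Longrightarrow> twist F F' a \<one>\<^bsub>GF F\<^esub> (comp_psi2 F' b a) y
      \<in> bimnd_1cells K (part_at F (snd (multT F F' F'' b a))) (part_at F' (snd b \<otimes>\<^bsub>GF F'\<^esub> fst a))"
    "z \<in> two_cells F' F'' b \<Longrightarrow> twist2 F' F'' b \<one>\<^bsub>GF F'\<^esub> (comp_psi1 F' F'' a) z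
      \<in> bimnd_2cells K (part_at F' (snd b \<otimes>\<^bsub>GF F'\<^esub> fst a)) (part_at F'' (fst (multT F F' F'' b a)))"
    "w \<in> two_cells F F' a \<Longrightarrow> twist2 F F' a \<one>\<^bsub>GF F\<^esub> (comp_psi2 F' b a) w
      \<in> bimnd_2cells K (part_at F (snd (multT F F' F'' b a))) (part_at F' (snd b \<otimes>\<^bsub>GF F'\<^esub> fst a))"
  using twist_closed[OF F(2,3) iso(2) b comp_parameters_closed(4,1)[OF b a]]
    twist_closed[OF F(1,2) iso(1) a comp_parameters_closed(3,2)[OF b a]]
    twist2_closed[OF F(2,3) iso(2) b comp_parameters_closed(4,1)[OF b a]]
    twist2_closed[OF F(1,2) iso(1) a comp_parameters_closed(3,2)[OF b a]]
  by (simp_all add: comp_degrees[OF b a])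

lemma comp_data:
  assumes b: "b \<in> carrier (grp F' F'')" and a: "a \<in> carrier (grp F F')"
  shows "bimnd_data (part_at F (snd (multT F F' F'' b a)))"
    "bimnd_data (part_at F' (snd b \<otimes>\<^bsub>GF F'\<^esub> fst a))"
    "bimnd_data (part_at F'' (fst (multT F F' F'' b a)))"
  using assms F by (auto intro!: data_part_at simp: grp_iso mult_iso iso isos word_simps)

lemma comp1_closed:
  assumes b: "b \<in> carrier (grp F' F'')" and a: "a \<in> carrier (grp F F')"
    and x: "x \<in> one_cells F' F'' b" and y: "y \<in> one_cells F F' a"
  shows "comp1T F F' F'' b a x y \<in> one_cells F F'' (multT F F' F'' b a)"
  unfolding comp1_eq_twist[OF assms]
  by (rule bimnd_comp1_closed[OF comp_data[OF b a] comp_twists(1,2)[OF b a]]) fact+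

lemma comp2_eq_twist2:
  assumes b: "b \<in> carrier (grp F' F'')" and a: "a \<in> carrier (grp F F')"
    and z: "z \<in> two_cells F' F'' b" and w: "w \<in> two_cells F F' a"
  shows "snd (compT F F' F'' b a) (z, w)
    = bimnd_hcomp K (twist2 F' F'' b \<one>\<^bsub>GF F'\<^esub> (comp_psi1 F' F'' a) z) (twist2 F F' a \<one>\<^bsub>GF F\<^esub> (comp_psi2 F' b a) w)"
  using comp1_eq_twist[OF b a bimnd_2cells_ends(1)[OF z] bimnd_2cells_ends(1)[OF w]]
    comp1_eq_twist[OF b a bimnd_2cells_ends(2)[OF z] bimnd_2cells_ends(2)[OF w]]
  by (simp add: bimndT_comp_def bimnd_hcomp_def twist2_def split_beta)

text \<open>\<open>twist_comp\<close> distributes the outer twist over the ordinary composite, and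
  \<open>twist_twist\<close> merges it with the corrections already made to x and y. Hence the
  correction is the left factor in each product of \<omega>'s.\<close>

lemma twist_comp1:
  assumes b: "b \<in> carrier (grp F' F'')" and a: "a \<in> carrier (grp F F')"
    and p: "\<sigma> \<in> carrier (GF F)" "\<omega> \<in> carrier (GF F'')"
    and x: "x \<in> one_cells F' F'' b" and y: "y \<in> one_cells F F' a"
  shows "twist F F'' (multT F F' F'' b a) \<sigma> \<omega> (comp1T F F' F'' b a x y)
    = bimnd_comp1 K (twist F' F'' b (fs F F' \<sigma>) (comp_psi1 F' F'' a \<otimes>\<^bsub>GF F''\<^esub> \<omega>) x)
        (twist F F' a \<sigma> (comp_psi2 F' b a \<otimes>\<^bsub>GF F'\<^esub> fs F'' F' \<omega>) y)"
proof -
  let ?m = "multT F F' F'' b a" and ?c = "snd b \<otimes>\<^bsub>GF F'\<^esub> fst a"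
  have m: "fst ?m \<in> carrier (GF F'')" "?c \<in> carrier (GF F')" "snd ?m \<in> carrier (GF F)"
    using b a by (auto simp: grp_iso mult_iso iso isos F word_simps)
  have q: "fs F F' \<sigma> \<in> carrier (GF F')" "fs F'' F' \<omega> \<in> carrier (GF F')"
    using p by (simp_all add: iso isos F word_simps)
  note r = comp_parameters_closed[OF b a]
  have "twist F F'' ?m \<sigma> \<omega> (comp1T F F' F'' b a x y)
      = bimnd_comp1 K (twist F' F'' (fst ?m, ?c) (fs F F' \<sigma>) \<omega> (twist F' F'' b \<one>\<^bsub>GF F'\<^esub> (comp_psi1 F' F'' a) x))
          (twist F F' (?c, snd ?m) \<sigma> (fs F'' F' \<omega>) (twist F F' a \<one>\<^bsub>GF F\<^esub> (comp_psi2 F' b a) y))"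
    using twist_comp[OF F iso m p, of "twist F' F'' b \<one>\<^bsub>GF F'\<^esub> (comp_psi1 F' F'' a) x"
        "twist F F' a \<one>\<^bsub>GF F\<^esub> (comp_psi2 F' b a) y"] comp_twists(1,2)[OF b a] x y
    by (simp add: comp1_eq_twist[OF b a x y])
  also have "\<dots> = bimnd_comp1 K (twist F' F'' b (\<one>\<^bsub>GF F'\<^esub> \<otimes>\<^bsub>GF F'\<^esub> fs F F' \<sigma>) (comp_psi1 F' F'' a \<otimes>\<^bsub>GF F''\<^esub> \<omega>) x)
        (twist F F' a (\<one>\<^bsub>GF F\<^esub> \<otimes>\<^bsub>GF F\<^esub> \<sigma>) (comp_psi2 F' b a \<otimes>\<^bsub>GF F'\<^esub> fs F'' F' \<omega>) y)"
    by (simp only: twist_twist[OF F(2,3) iso(2) b r(4,1) q(1) p(2) x comp_degrees(1)[OF b a, symmetric]]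
        twist_twist[OF F(1,2) iso(1) a r(3,2) p(1) q(2) y comp_degrees(2)[OF b a, symmetric]])
  finally show ?thesis
    using p q F by (simp add: autT_simps)
qed

text \<open>Each side is the ordinary composite of one twist of x and one twist of y, so naturality
  of the action amounts to comparing the parameters of these twists.\<close>

lemma act_comp1:
  assumes b: "b \<in> carrier (grp F' F'')" and a: "a \<in> carrier (grp F F')" and \<omega>: "\<omega> \<in> carrier (grp F F'')"
  defines "\<omega>1 \<equiv> prT1 F F' F'' \<omega>" and "\<omega>2 \<equiv> prT2 F F' F'' \<omega>"
    and "m \<equiv> multT F F' F'' b a"
  shows "conj_by F F'' \<omega> m = multT F F' F'' (conj_by F' F'' \<omega>1 b) (conj_by F F' \<omega>2 a)"
    "x \<in> one_cells F' F'' b \<Longrightarrow> y \<in> one_cells F F' a \<Longrightarrow>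
      twist F F'' m (act_phi F F'' \<omega>) (act_psi F F'' \<omega> m) (comp1T F F' F'' b a x y)
      = comp1T F F' F'' (conj_by F' F'' \<omega>1 b) (conj_by F F' \<omega>2 a)
          (twist F' F'' b (act_phi F' F'' \<omega>1) (act_psi F' F'' \<omega>1 b) x)
          (twist F F' a (act_phi F F' \<omega>2) (act_psi F F' \<omega>2 a) y)"
proof -
  note w = iso isos F word_simps
  have m: "m \<in> carrier (grp F F'')"
    unfolding m_def by (rule mult_closed[OF F a b])
  have p: "\<omega>1 \<in> carrier (grp F' F'')" "\<omega>2 \<in> carrier (grp F F')"
    using \<omega> by (auto simp: \<omega>1_def \<omega>2_def pr_iso grp_iso w)
  have b': "conj_by F' F'' \<omega>1 b \<in> carrier (grp F' F'')" and a': "conj_by F F' \<omega>2 a \<in> carrier (grp F F')"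
    by (rule conj_closed[OF F(2,3) iso(2) p(1) b] conj_closed[OF F(1,2) iso(1) p(2) a])+
  show "conj_by F F'' \<omega> m = multT F F' F'' (conj_by F' F'' \<omega>1 b) (conj_by F F' \<omega>2 a)"
    using assms(1-3) unfolding m_def \<omega>1_def \<omega>2_def
    by (auto simp: pr_iso grp_iso grp_inv mult_iso w)
  assume x: "x \<in> one_cells F' F'' b" and y: "y \<in> one_cells F F' a"
  note q = act_parameters_closed[OF F(1,3) isos(1) \<omega> m]
  note q1 = act_parameters_closed[OF F(2,3) iso(2) p(1) b] and q2 = act_parameters_closed[OF F(1,2) iso(1) p(2) a]
  note r = comp_parameters_closed[OF b' a']
  let ?x = "twist F' F'' b (act_phi F' F'' \<omega>1) (act_psi F' F'' \<omega>1 b) x"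
    and ?y = "twist F F' a (act_phi F F' \<omega>2) (act_psi F F' \<omega>2 a) y"
  have "comp1T F F' F'' (conj_by F' F'' \<omega>1 b) (conj_by F F' \<omega>2 a) ?x ?y
    = bimnd_comp1 K (twist F' F'' (conj_by F' F'' \<omega>1 b) \<one>\<^bsub>GF F'\<^esub> (comp_psi1 F' F'' (conj_by F F' \<omega>2 a)) ?x)
       (twist F F' (conj_by F F' \<omega>2 a) \<one>\<^bsub>GF F\<^esub> (comp_psi2 F' (conj_by F' F'' \<omega>1 b) (conj_by F F' \<omega>2 a)) ?y)"
    by (rule comp1_eq_twist[OF b' a' twist_act_closed(1)[OF F(2,3) iso(2) p(1) b x]
        twist_act_closed(1)[OF F(1,2) iso(1) p(2) a y]])
  also have "\<dots> = bimnd_comp1 K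
      (twist F' F'' b (act_phi F' F'' \<omega>1 \<otimes>\<^bsub>GF F'\<^esub> \<one>\<^bsub>GF F'\<^esub>)
        (act_psi F' F'' \<omega>1 b \<otimes>\<^bsub>GF F''\<^esub> comp_psi1 F' F'' (conj_by F F' \<omega>2 a)) x)
      (twist F F' a (act_phi F F' \<omega>2 \<otimes>\<^bsub>GF F\<^esub> \<one>\<^bsub>GF F\<^esub>)
        (act_psi F F' \<omega>2 a \<otimes>\<^bsub>GF F'\<^esub> comp_psi2 F' (conj_by F' F'' \<omega>1 b) (conj_by F F' \<omega>2 a)) y)"
    by (simp only: twist_twist[OF F(2,3) iso(2) b q1 r(4,1) x conj_eq_twist_degree[OF F(2,3) iso(2) p(1) b]]
        twist_twist[OF F(1,2) iso(1) a q2 r(3,2) y conj_eq_twist_degree[OF F(1,2) iso(1) p(2) a]])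
  \<comment> \<open>Four words have to agree. The \<sigma>'s do because \<beta> \<alpha>^-1 is the
    same, up to fusion maps, for both projections of \<omega>. In the \<omega>'s the order of
    factors is exchanged: acting before composing puts the action on the left, acting afterwards
    puts it on the right.\<close>
  also have "act_phi F' F'' \<omega>1 \<otimes>\<^bsub>GF F'\<^esub> \<one>\<^bsub>GF F'\<^esub> = fs F F' (act_phi F F'' \<omega>)"
    using \<omega> by (auto simp: act_phi_def \<omega>1_def pr_iso grp_iso w)
  also have "act_phi F F' \<omega>2 \<otimes>\<^bsub>GF F\<^esub> \<one>\<^bsub>GF F\<^esub> = act_phi F F'' \<omega>"
    using \<omega> by (auto simp: act_phi_def \<omega>2_def pr_iso grp_iso w)
  also have "act_psi F' F'' \<omega>1 b \<otimes>\<^bsub>GF F''\<^esub> comp_psi1 F' F'' (conj_by F F' \<omega>2 a) = comp_psi1 F' F'' a \<otimes>\<^bsub>GF F''\<^esub> act_psi F F'' \<omega> m"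
    using \<omega> a b by (auto simp: act_psi_def comp_psi1_def m_def mult_iso \<omega>1_def \<omega>2_def pr_iso grp_iso grp_inv w)
  also have "act_psi F F' \<omega>2 a \<otimes>\<^bsub>GF F'\<^esub> comp_psi2 F' (conj_by F' F'' \<omega>1 b) (conj_by F F' \<omega>2 a)
      = comp_psi2 F' b a \<otimes>\<^bsub>GF F'\<^esub> fs F'' F' (act_psi F F'' \<omega> m)"
    using \<omega> a b by (auto simp: act_psi_def comp_psi2_def m_def mult_iso \<omega>1_def \<omega>2_def pr_iso grp_iso grp_inv w)
  finally show "twist F F'' m (act_phi F F'' \<omega>) (act_psi F F'' \<omega> m) (comp1T F F' F'' b a x y)
      = comp1T F F' F'' (conj_by F' F'' \<omega>1 b) (conj_by F F' \<omega>2 a) ?x ?y"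
    using twist_comp1[OF b a q x y] by (simp only: m_def)
qed

end

text \<open>Both bracketings become ordinary triple composites of one twist each of z, x and y.
  Associativity of \<open>bimnd_comp1\<close> applies, and what remains is that the twisting
  parameters agree.\<close>

lemma comp1_assoc:
  assumes F: "F \<in> T" "F' \<in> T" "F'' \<in> T" "F''' \<in> T"
    and iso: "GF F \<cong> GF F'" "GF F' \<cong> GF F''" "GF F'' \<cong> GF F'''"
    and c: "c \<in> carrier (grp F'' F''')" and b: "b \<in> carrier (grp F' F'')" and a: "a \<in> carrier (grp F F')"
  shows "multT F F'' F''' c (multT F F' F'' b a)
      = multT F F' F''' (multT F' F'' F''' c b) a"
    "z \<in> one_cells F'' F''' c \<Longrightarrow> x \<in> one_cells F' F'' b \<Longrightarrow> y \<in> one_cells F F' a \<Longrightarrow>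
      comp1T F F'' F''' c (multT F F' F'' b a) z (comp1T F F' F'' b a x y)
      = comp1T F F' F''' (multT F' F'' F''' c b) a (comp1T F' F'' F''' c b z x) y"
proof -
  have i: "GF F \<cong> GF F''" "GF F' \<cong> GF F" "GF F'' \<cong> GF F'" "GF F'' \<cong> GF F"
    "GF F' \<cong> GF F'''" "GF F''' \<cong> GF F''" "GF F''' \<cong> GF F'" "GF F \<cong> GF F'''" "GF F''' \<cong> GF F"
    using isos[OF F(1,2,3) iso(1,2)] isos[OF F(2,3,4) iso(2,3)]
      isos[OF F(1,2,4) iso(1) isos(1)[OF F(2,3,4) iso(2,3)]] by blast+
  note w = iso i F word_simps
  let ?ba = "multT F F' F'' b a" and ?cb = "multT F' F'' F''' c b"
  note ba = mult_closed[OF F(1,2,3) a b] and cb = mult_closed[OF F(2,3,4) b c]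
  show m: "multT F F'' F''' c ?ba = multT F F' F''' ?cb a"
    using a b c by (auto simp: grp_iso mult_iso w)
  assume z: "z \<in> one_cells F'' F''' c" and x: "x \<in> one_cells F' F'' b" and y: "y \<in> one_cells F F' a"
  note p = comp_parameters_closed[OF F(1,3,4) i(1) iso(3) c ba]
  note q = comp_parameters_closed[OF F(1,2,4) iso(1) i(5) cb a]
  let ?z = "twist F'' F''' c \<one>\<^bsub>GF F''\<^esub> (comp_psi1 F'' F''' ?ba) z"
    and ?x = "twist F' F'' b \<one>\<^bsub>GF F'\<^esub> (comp_psi1 F' F'' a \<otimes>\<^bsub>GF F''\<^esub> comp_psi2 F'' c ?ba) x"
    and ?y = "twist F F' a \<one>\<^bsub>GF F\<^esub> (comp_psi2 F' ?cb a) y"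
  have "comp1T F F'' F''' c ?ba z (comp1T F F' F'' b a x y)
      = bimnd_comp1 K ?z (twist F F'' ?ba \<one>\<^bsub>GF F\<^esub> (comp_psi2 F'' c ?ba) (comp1T F F' F'' b a x y))"
    by (rule comp1_eq_twist[OF F(1,3,4) i(1) iso(3) c ba z comp1_closed[OF F(1,2,3) iso(1,2) b a x y]])
  also have "twist F F'' ?ba \<one>\<^bsub>GF F\<^esub> (comp_psi2 F'' c ?ba) (comp1T F F' F'' b a x y)
      = bimnd_comp1 K (twist F' F'' b (fs F F' \<one>\<^bsub>GF F\<^esub>) (comp_psi1 F' F'' a \<otimes>\<^bsub>GF F''\<^esub> comp_psi2 F'' c ?ba) x)
         (twist F F' a \<one>\<^bsub>GF F\<^esub> (comp_psi2 F' b a \<otimes>\<^bsub>GF F'\<^esub> fs F'' F' (comp_psi2 F'' c ?ba)) y)"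
    by (rule twist_comp1[OF F(1,2,3) iso(1,2) b a p(3,2) x y])
  also have "fs F F' \<one>\<^bsub>GF F\<^esub> = \<one>\<^bsub>GF F'\<^esub>"
    by (simp add: w)
  \<comment> \<open>With a1, b1 for first and b2, c2 for second components, the word a1^-1 b2 a1 (b1
    a1)^-1 c2 (b1 a1) equals a1^-1 (b2 b1^-1 c2 b1) a1, and b2 b1^-1 c2 b1 is the second component
    of \<open>?cb\<close>.\<close>
  also have "comp_psi2 F' b a \<otimes>\<^bsub>GF F'\<^esub> fs F'' F' (comp_psi2 F'' c ?ba) = comp_psi2 F' ?cb a"
    using a b c by (auto simp: comp_psi2_def grp_iso mult_iso w)
  also have "bimnd_comp1 K ?z (bimnd_comp1 K ?x ?y) = bimnd_comp1 K (bimnd_comp1 K ?z ?x) ?y"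
  proof (rule bimnd_comp1_assoc)
    note d1 = comp_data[OF F(1,3,4) i(1) iso(3) c ba] and d2 = comp_data[OF F(1,2,4) iso(1) i(5) cb a]
    show "bimnd_data (part_at F (snd (multT F F' F''' ?cb a)))"
      "bimnd_data (part_at F' (snd ?cb \<otimes>\<^bsub>GF F'\<^esub> fst a))"
      "bimnd_data (part_at F'' (snd c \<otimes>\<^bsub>GF F''\<^esub> fst ?ba))"
      "bimnd_data (part_at F''' (fst (multT F F'' F''' c ?ba)))"
      using d1 d2 by simp_all
    show "?y \<in> bimnd_1cells K (part_at F (snd (multT F F' F''' ?cb a))) (part_at F' (snd ?cb \<otimes>\<^bsub>GF F'\<^esub> fst a))"
      by (rule comp_twists(2)[OF F(1,2,4) iso(1) i(5) cb a y])
    show "?z \<in> bimnd_1cells K (part_at F'' (snd c \<otimes>\<^bsub>GF F''\<^esub> fst ?ba)) (part_at F''' (fst (multT F F'' F''' c ?ba)))"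
      by (rule comp_twists(1)[OF F(1,3,4) i(1) iso(3) c ba z])
    have r: "\<one>\<^bsub>GF F'\<^esub> \<in> carrier (GF F')" "comp_psi1 F' F'' a \<otimes>\<^bsub>GF F''\<^esub> comp_psi2 F'' c ?ba \<in> carrier (GF F'')"
      using comp_parameters_closed(1,4)[OF F(1,2,3) iso(1,2) b a] p(2) autT_simps F by simp_all
    have "twist_degree F' F'' \<one>\<^bsub>GF F'\<^esub> (comp_psi1 F' F'' a \<otimes>\<^bsub>GF F''\<^esub> comp_psi2 F'' c ?ba) b
        = (snd c \<otimes>\<^bsub>GF F''\<^esub> fst ?ba, snd ?cb \<otimes>\<^bsub>GF F'\<^esub> fst a)"
      using a b c by (auto simp: twist_degree_def comp_psi1_def comp_psi2_def grp_iso mult_iso w)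
    then show "?x \<in> bimnd_1cells K (part_at F' (snd ?cb \<otimes>\<^bsub>GF F'\<^esub> fst a)) (part_at F'' (snd c \<otimes>\<^bsub>GF F''\<^esub> fst ?ba))"
      using twist_closed[OF F(2,3) iso(2) b r x] by simp
  qed
  also have "bimnd_comp1 K ?z ?x = twist F' F''' ?cb \<one>\<^bsub>GF F'\<^esub> (comp_psi1 F' F''' a) (comp1T F' F'' F''' c b z x)"
  proof -
    \<comment> \<open>The middle factor x is corrected once for y and once for z, in either order:
      a1 (b1 a1)^-1 c2 (b1 a1) = (b1^-1 c2 b1) a1.\<close>
    have "comp_psi1 F'' F''' ?ba = comp_psi1 F'' F''' b \<otimes>\<^bsub>GF F'''\<^esub> comp_psi1 F' F''' a"
      "comp_psi1 F' F'' a \<otimes>\<^bsub>GF F''\<^esub> comp_psi2 F'' c ?ba = comp_psi2 F'' c b \<otimes>\<^bsub>GF F''\<^esub> fs F''' F'' (comp_psi1 F' F''' a)"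
      "\<one>\<^bsub>GF F''\<^esub> = fs F' F'' \<one>\<^bsub>GF F'\<^esub>"
      using a b c by (auto simp: comp_psi1_def comp_psi2_def grp_iso mult_iso w)
    then show ?thesis
      using twist_comp1[OF F(2,3,4) iso(2,3) c b q(4,1) z x] by simp
  qed
  also have "bimnd_comp1 K \<dots> ?y = comp1T F F' F''' ?cb a (comp1T F' F'' F''' c b z x) y"
    by (rule comp1_eq_twist[OF F(1,2,4) iso(1) i(5) cb a comp1_closed[OF F(2,3,4) iso(2,3) c b z x] y, symmetric])
  finally show "comp1T F F'' F''' c ?ba z (comp1T F F' F'' b a x y)
      = comp1T F F' F''' ?cb a (comp1T F' F'' F''' c b z x) y" .
qed

text \<open>The correction falls entirely on the identity, which by \<open>twist_id1\<close> turns
  from the identity in degree e into the one at the degree of the neighbouring end of x; x itself is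
  twisted by units.\<close>

lemma bimndT_comp1_id1:
  assumes F: "F \<in> T" "F' \<in> T" and iso: "GF F \<cong> GF F'" and c: "c \<in> carrier (grp F F')" and x: "x \<in> one_cells F F' c"
  shows "comp1T F F' F' \<one>\<^bsub>grp F' F'\<^esub> c (bimnd_id1 K (unit_part K F')) x = x"
    "comp1T F F F' c \<one>\<^bsub>grp F F\<^esub> x (bimnd_id1 K (unit_part K F)) = x"
proof -
  note i = iso'[OF F iso]
  note w = iso i F word_simps
  have cc: "fst c \<in> carrier (GF F')" "snd c \<in> carrier (GF F)"
    using c by (auto simp: grp_iso iso)
  have D: "bimnd_data (part_at F (snd c))" "bimnd_data (part_at F' (fst c))"
    using cc data_part_at F by simp_all
  have id: "bimnd_id1 K (unit_part K F) \<in> one_cells F F \<one>\<^bsub>grp F F\<^esub>" if "F \<in> T" for F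
    using bimnd_id1_closed[OF bimnd_data_bimonad[OF is_bimonad_unit_part[OF that]]] by (simp add: grp_one unit_part_eq)
  have one: "\<one>\<^bsub>GF F\<^esub> \<in> carrier (GF F)" "\<one>\<^bsub>GF F'\<^esub> \<in> carrier (GF F')"
    using autT_simps F by simp_all
  have "comp_psi1 F' F' c = fst c" "comp_psi2 F' \<one>\<^bsub>grp F' F'\<^esub> c = \<one>\<^bsub>GF F'\<^esub>"
    using cc by (simp_all add: comp_psi1_def comp_psi2_def grp_one w)
  then show "comp1T F F' F' \<one>\<^bsub>grp F' F'\<^esub> c (bimnd_id1 K (unit_part K F')) x = x"
    using comp1_eq_twist[OF F(1,2,2) iso iso_refl grp_one_closed[OF F(2,2)] c id[OF F(2)] x] cc(1)
      twist_id1[OF F(2) one(2) cc(1)] twist_one[OF F iso c x] bimnd_comp1_id1(1)[OF D x]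
    by (simp add: grp_one w)
  have "comp_psi1 F F' \<one>\<^bsub>grp F F\<^esub> = \<one>\<^bsub>GF F'\<^esub>" "comp_psi2 F c \<one>\<^bsub>grp F F\<^esub> = snd c"
    using cc by (simp_all add: comp_psi1_def comp_psi2_def grp_one w)
  then show "comp1T F F F' c \<one>\<^bsub>grp F F\<^esub> x (bimnd_id1 K (unit_part K F)) = x"
    using comp1_eq_twist[OF F(1,1,2) iso_refl iso c grp_one_closed[OF F(1,1)] x id[OF F(1)]] cc(2)
      twist_id1[OF F(1) one(1) cc(2)] twist_one[OF F iso c x] bimnd_comp1_id1(2)[OF D x]
    by (simp add: grp_one w)
qed

text \<open>Twisting keeps the underlying 2-cells and hence preserves identities and vertical
  composites; the rest is functoriality of ordinary horizontal composition, that is,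
  interchange.\<close>

lemma comp_is_functor:
  assumes F: "F \<in> T" "F' \<in> T" "F'' \<in> T" and a: "a \<in> carrier (grp F F')" and b: "b \<in> carrier (grp F' F'')"
  shows "is_functor (prod_cat (partT F' F'' b) (partT F F' a))
    (partT F F'' (multT F F' F'' b a)) (compT F F' F'' b a)"
proof (cases "GF F \<cong> GF F' \<and> GF F' \<cong> GF F''")
  case False
  \<comment> \<open>One of the two factors is empty, hence so is the product category.\<close>
  then show ?thesis by (auto simp: is_functor_def prod_cat_def part_Ob_iff part_Ar_iff)
next
  case True
  then have iso: "GF F \<cong> GF F'" "GF F' \<cong> GF F''" by simp_all
  note i = isos[OF F iso]
  note D = comp_data[OF F iso b a] and tw = comp_twists[OF F iso b a] and r = comp_parameters_closed[OF F iso b a]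
  have O: "(x, y) \<in> Ob (prod_cat (partT F' F'' b) (partT F F' a)) \<longleftrightarrow> x \<in> one_cells F' F'' b \<and> y \<in> one_cells F F' a" for x y
    by (simp add: prod_cat_def part_Ob_iff iso)
  have A: "(x, y) \<in> Ar (prod_cat (partT F' F'' b) (partT F F' a)) \<longleftrightarrow> x \<in> two_cells F' F'' b \<and> y \<in> two_cells F F' a" for x y
    by (simp add: prod_cat_def part_Ar_iff iso)
  show ?thesis
    unfolding is_functor_def part_simps
  proof (intro conjI ballI impI)
    show "fst (compT F F' F'' b a) \<in> Ob (prod_cat (partT F' F'' b) (partT F F' a))
        \<rightarrow> Ob (partT F F'' (multT F F' F'' b a))"
      using comp1_closed[OF F iso b a] by (auto simp: bimndT_comp_def O part_Ob_iff i)
    show "snd (compT F F' F'' b a) \<in> Ar (prod_cat (partT F' F'' b) (partT F F' a))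
        \<rightarrow> Ar (partT F F'' (multT F F' F'' b a))"
    proof
      fix f assume f: "f \<in> Ar (prod_cat (partT F' F'' b) (partT F F' a))"
      obtain z w where e: "f = (z, w)" by (cases f)
      then have zw: "z \<in> two_cells F' F'' b" "w \<in> two_cells F F' a" using f by (simp_all add: A)
      have "snd (compT F F' F'' b a) f \<in> two_cells F F'' (multT F F' F'' b a)"
        unfolding e comp2_eq_twist2[OF F iso b a zw]
        by (rule bimnd_hcomp_closed[OF D tw(3)[OF zw(1)] tw(4)[OF zw(2)]])
      then show "snd (compT F F' F'' b a) f \<in> Ar (partT F F'' (multT F F' F'' b a))"
        by (simp add: part_Ar_iff i)
    qed
  next
    fix f assume "f \<in> Ar (prod_cat (partT F' F'' b) (partT F F' a))"
    obtain x \<xi> x' y \<zeta> y' where "f = ((x, \<xi>, x'), (y, \<zeta>, y'))" by (cases f) auto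
    then show "fst (snd (compT F F' F'' b a) f) = fst (compT F F' F'' b a)
          (dm (prod_cat (partT F' F'' b) (partT F F' a)) f)"
      "snd (snd (snd (compT F F' F'' b a) f)) = fst (compT F F' F'' b a)
          (cd (prod_cat (partT F' F'' b) (partT F F' a)) f)"
      by (simp_all add: bimndT_comp_def prod_cat_def part_simps)
  next
    fix u assume u: "u \<in> Ob (prod_cat (partT F' F'' b) (partT F F' a))"
    obtain x y where e: "u = (x, y)" by (cases u)
    then have xy: "x \<in> one_cells F' F'' b" "y \<in> one_cells F F' a" using u by (simp_all add: O)
    have "bimnd_id2 K x \<in> two_cells F' F'' b" "bimnd_id2 K y \<in> two_cells F F' a"
      by (rule bimnd_id2_closed[OF twist_shifts(1,2)[OF F(2,3) iso(2) b r(4,1)] xy(1)]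
          bimnd_id2_closed[OF twist_shifts(1,2)[OF F(1,2) iso(1) a r(3,2)] xy(2)])+
    from comp2_eq_twist2[OF F iso b a this]
    show "snd (compT F F' F'' b a) (idn (prod_cat (partT F' F'' b) (partT F F' a)) u)
        = bimnd_id2 K (fst (compT F F' F'' b a) u)"
      using twist2_id2[OF F(2,3) iso(2) b r(4,1) xy(1)] twist2_id2[OF F(1,2) iso(1) a r(3,2) xy(2)]
        bimnd_hcomp_id2[OF tw(1)[OF xy(1)] tw(2)[OF xy(2)]] comp1_eq_twist[OF F iso b a xy]
      by (simp add: e prod_cat_def part_simps) (simp add: bimndT_comp_def)
  next
    fix f g assume f: "f \<in> Ar (prod_cat (partT F' F'' b) (partT F F' a))"
      and g: "g \<in> Ar (prod_cat (partT F' F'' b) (partT F F' a))"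
      and fg: "cd (prod_cat (partT F' F'' b) (partT F F' a)) f = dm (prod_cat (partT F' F'' b) (partT F F' a)) g"
    obtain z w where e: "f = (z, w)" by (cases f)
    obtain z' w' where e': "g = (z', w')" by (cases g)
    have zw: "z \<in> two_cells F' F'' b" "w \<in> two_cells F F' a" "z' \<in> two_cells F' F'' b" "w' \<in> two_cells F F' a"
      using f g by (simp_all add: A e e')
    have m: "snd (snd z) = fst z'" "snd (snd w) = fst w'"
      using fg by (simp_all add: e e' prod_cat_def part_simps)
    have v: "bimnd_vcomp K z' z \<in> two_cells F' F'' b" "bimnd_vcomp K w' w \<in> two_cells F F' a"
      by (rule bimnd_vcomp_closed[OF twist_shifts(1,2)[OF F(2,3) iso(2) b r(4,1)] zw(1,3) m(1)]
          bimnd_vcomp_closed[OF twist_shifts(1,2)[OF F(1,2) iso(1) a r(3,2)] zw(2,4) m(2)])+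
    have "snd (compT F F' F'' b a) (bimnd_vcomp K z' z, bimnd_vcomp K w' w)
        = bimnd_vcomp K (snd (compT F F' F'' b a) (z', w')) (snd (compT F F' F'' b a) (z, w))"
      unfolding comp2_eq_twist2[OF F iso b a v] comp2_eq_twist2[OF F iso b a zw(1,2)]
        comp2_eq_twist2[OF F iso b a zw(3,4)] twist2_vcomp
      by (rule bimnd_interchange[OF tw(4)[OF zw(2)] tw(4)[OF zw(4)] tw(3)[OF zw(1)] tw(3)[OF zw(3)]])
        (simp_all add: twist2_def m)
    then show "snd (compT F F' F'' b a) (cmp (prod_cat (partT F' F'' b) (partT F F' a)) g f)
        = bimnd_vcomp K (snd (compT F F' F'' b a) g) (snd (compT F F' F'' b a) f)"
      by (simp add: e e' prod_cat_def part_simps)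
  qed
qed

section \<open>The Turaev 2-category and its underlying 2-category\<close>

lemma BimndT_simps:
  "tcells0 (BimndT K j I) = I" "tgrp (BimndT K j I) = grp" "tmult (BimndT K j I) = multT"
  "tpr1 (BimndT K j I) = prT1" "tpr2 (BimndT K j I) = prT2"
  "tpart (BimndT K j I) = partT" "tact (BimndT K j I) = actT"
  "tid (BimndT K j I) = (\<lambda>F. bimnd_id1 K (unit_part K F))" "tcomp (BimndT K j I) = compT"
  by (simp_all add: BimndT_def)

lemma thom_BimndT: "thom (BimndT K j I) F F' = homT F F'"
  by (simp add: thom_def BimndT_simps bimndT_hom_def)

lemma tcomp0_BimndT:
  "tcomp0 (BimndT K j I) F F' F'' (b, x) (a, y) = (multT F F' F'' b a, comp1T F F' F'' b a x y)"
  by (simp add: tcomp0_def BimndT_simps bimndT_comp_def)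

lemma tcomp1_BimndT:
  "tcomp1 (BimndT K j I) F F' F'' (b, z) (a, w) = (multT F F' F'' b a,
     comp1T F F' F'' b a (fst z) (fst w), fst (snd z) \<star> fst (snd w),
     comp1T F F' F'' b a (snd (snd z)) (snd (snd w)))"
  by (simp add: tcomp1_def BimndT_simps bimndT_comp_def split_beta)

lemma id1_one_cells: "F \<in> T \<Longrightarrow> bimnd_id1 K (unit_part K F) \<in> one_cells F F \<one>\<^bsub>grp F F\<^esub>"
  using bimnd_id1_closed[OF bimnd_data_bimonad[OF is_bimonad_unit_part]] by (simp add: grp_one unit_part_eq)

text \<open>In the unit degree \<gamma> = e the parameters \<omega> and \<sigma> of the action
  coincide, both being \<beta> \<alpha>^-1 up to fusion maps, so the degree \<sigma>^-1 \<omega> of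
  the twisted identity is again e.\<close>

lemma act_id1:
  assumes F: "F \<in> T" and w: "w \<in> carrier (grp F F)"
  shows "fst (actT F F w) (\<one>\<^bsub>grp F F\<^esub>, bimnd_id1 K (unit_part K F)) = (\<one>\<^bsub>grp F F\<^esub>, bimnd_id1 K (unit_part K F))"
proof -
  note e = grp_one_closed[OF F F]
  interpret group "grp F F" by (rule group_grp[OF F F])
  note q = act_parameters_closed[OF F F iso_refl w e]
  have "inv\<^bsub>GF F\<^esub> act_phi F F w \<otimes>\<^bsub>GF F\<^esub> act_psi F F w \<one>\<^bsub>grp F F\<^esub> = \<one>\<^bsub>GF F\<^esub>"
    using w F by (auto simp: act_phi_def act_psi_def grp_one grp_iso word_simps)
  then show ?thesis
    using act_apply(1)[OF F F iso_refl w e id1_one_cells[OF F]] twist_id1[OF F q] w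
    by (simp add: unit_part_eq) (simp add: grp_one)
qed

text \<open>An object or arrow from A to B exists only if the two groups are isomorphic. Every law
  about cells therefore supplies the isomorphisms it needs, and I may be any set of 0-cells.\<close>

lemma turaev_homs_BimndT:
  assumes I: "I \<subseteq> T"
  shows "turaev_homs (BimndT K j I)"
proof (rule turaev_homs.intro; unfold BimndT_simps thom_BimndT)
  fix A B assume "A \<in> I" "B \<in> I"
  then have F: "A \<in> T" "B \<in> T" using I by auto
  show "category (partT A B \<alpha>)" if "\<alpha> \<in> carrier (grp A B)" for \<alpha>
    by (rule category_part[OF F that])
  show "group_hom (grp A B) (Aut_cat (homT A B)) (actT A B)"
    by (rule act_group_hom[OF F])
  fix \<alpha> \<beta> \<gamma> assume "\<alpha> \<in> carrier (grp A B)" "\<beta> \<in> carrier (grp A B)" "\<gamma> = conj_by A B \<beta> \<alpha>"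
  then show "fst (actT A B \<beta>) ` ({\<alpha>} \<times> Ob (partT A B \<alpha>)) = {\<gamma>} \<times> Ob (partT A B \<gamma>)"
    "snd (actT A B \<beta>) ` ({\<alpha>} \<times> Ar (partT A B \<alpha>)) = {\<gamma>} \<times> Ar (partT A B \<gamma>)"
    using act_part_image[OF F] by simp_all
next
  fix A assume "A \<in> I"
  then have F: "A \<in> T" using I by auto
  show "bimnd_id1 K (unit_part K A) \<in> Ob (partT A A \<one>\<^bsub>grp A A\<^esub>)"
    using id1_one_cells[OF F] by (simp add: part_Ob_iff)
  show "fst (actT A A w) (\<one>\<^bsub>grp A A\<^esub>, bimnd_id1 K (unit_part K A)) = (\<one>\<^bsub>grp A A\<^esub>, bimnd_id1 K (unit_part K A))"
    if "w \<in> carrier (grp A A)" for w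
    by (rule act_id1[OF F that])
next
  fix A B C \<alpha> \<beta> assume "A \<in> I" "B \<in> I" "C \<in> I" and ab: "\<alpha> \<in> carrier (grp A B)" "\<beta> \<in> carrier (grp B C)"
  then have F: "A \<in> T" "B \<in> T" "C \<in> T" using I by auto
  show "is_functor (prod_cat (partT B C \<beta>) (partT A B \<alpha>))
      (partT A C (multT A B C \<beta> \<alpha>)) (compT A B C \<beta> \<alpha>)"
    by (rule comp_is_functor[OF F ab])
next
  fix A B C D x y z assume "A \<in> I" "B \<in> I" "C \<in> I" "D \<in> I"
    and xyz: "x \<in> Ob (homT A B)" "y \<in> Ob (homT B C)" "z \<in> Ob (homT C D)"
  then have F: "A \<in> T" "B \<in> T" "C \<in> T" "D \<in> T" using I by auto
  obtain a x' b y' c z' where e: "x = (a, x')" "y = (b, y')" "z = (c, z')" by (cases x, cases y, cases z)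
  have h: "GF A \<cong> GF B" "GF B \<cong> GF C" "GF C \<cong> GF D" "a \<in> carrier (grp A B)" "b \<in> carrier (grp B C)"
    "c \<in> carrier (grp C D)" "x' \<in> one_cells A B a" "y' \<in> one_cells B C b" "z' \<in> one_cells C D c"
    using xyz by (simp_all add: e hom_Ob_iff)
  show "tcomp0 (BimndT K j I) A C D z (tcomp0 (BimndT K j I) A B C y x)
      = tcomp0 (BimndT K j I) A B D (tcomp0 (BimndT K j I) B C D z y) x"
    unfolding e tcomp0_BimndT using comp1_assoc[OF F h(1-3,6,5,4)] h(7-9) by simp
next
  fix A B C D f g h' assume "A \<in> I" "B \<in> I" "C \<in> I" "D \<in> I"
    and xyz: "f \<in> Ar (homT A B)" "g \<in> Ar (homT B C)" "h' \<in> Ar (homT C D)"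
  then have F: "A \<in> T" "B \<in> T" "C \<in> T" "D \<in> T" using I by auto
  obtain a x b y c z where e: "f = (a, x)" "g = (b, y)" "h' = (c, z)" by (cases f, cases g, cases h')
  have h: "GF A \<cong> GF B" "GF B \<cong> GF C" "GF C \<cong> GF D" "a \<in> carrier (grp A B)" "b \<in> carrier (grp B C)"
    "c \<in> carrier (grp C D)" "x \<in> two_cells A B a" "y \<in> two_cells B C b" "z \<in> two_cells C D c"
    using xyz by (simp_all add: e hom_Ar_iff)
  note t = bimnd_2cells_typing[OF h(7)] bimnd_2cells_typing[OF h(8)] bimnd_2cells_typing[OF h(9)]
    bimnd_1cells_typing[OF bimnd_2cells_ends(1)[OF h(7)]] bimnd_1cells_typing[OF bimnd_2cells_ends(1)[OF h(8)]]
    bimnd_1cells_typing[OF bimnd_2cells_ends(1)[OF h(9)]]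
  show "tcomp1 (BimndT K j I) A C D h' (tcomp1 (BimndT K j I) A B C g f)
      = tcomp1 (BimndT K j I) A B D (tcomp1 (BimndT K j I) B C D h' g) f"
    unfolding e tcomp1_BimndT fst_conv snd_conv comp1_assoc(1)[OF F h(1-3,6,5,4)]
      comp1_assoc(2)[OF F h(1-3,6,5,4) bimnd_2cells_ends(1)[OF h(9)] bimnd_2cells_ends(1)[OF h(8)] bimnd_2cells_ends(1)[OF h(7)]]
      comp1_assoc(2)[OF F h(1-3,6,5,4) bimnd_2cells_ends(2)[OF h(9)] bimnd_2cells_ends(2)[OF h(8)] bimnd_2cells_ends(2)[OF h(7)]]
    by (simp add: hcomp_assoc' t part_at_simps comp1_assoc(1)[OF F h(1-3,6,5,4)])
next
  fix A B x assume "A \<in> I" "B \<in> I" and x: "x \<in> Ob (homT A B)"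
  then have F: "A \<in> T" "B \<in> T" using I by auto
  obtain a x' where e: "x = (a, x')" by (cases x)
  have h: "GF A \<cong> GF B" "a \<in> carrier (grp A B)" "x' \<in> one_cells A B a"
    using x by (simp_all add: e hom_Ob_iff)
  interpret graded_groups I grp "multT" "prT1" "prT2"
    by (rule graded_groups_bimndT[OF I])
  show "tcomp0 (BimndT K j I) A B B (\<one>\<^bsub>grp B B\<^esub>, bimnd_id1 K (unit_part K B)) x = x"
    "tcomp0 (BimndT K j I) A A B x (\<one>\<^bsub>grp A A\<^esub>, bimnd_id1 K (unit_part K A)) = x"
    unfolding e tcomp0_BimndT bimndT_comp1_id1[OF F h] m_unit_left[OF \<open>A \<in> I\<close> \<open>B \<in> I\<close> h(2)] m_unit_right[OF \<open>A \<in> I\<close> \<open>B \<in> I\<close> h(2)]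
    by (rule refl)+
next
  fix A B f assume "A \<in> I" "B \<in> I" and f: "f \<in> Ar (homT A B)"
  then have F: "A \<in> T" "B \<in> T" using I by auto
  obtain a z where e: "f = (a, z)" by (cases f)
  have h: "GF A \<cong> GF B" "a \<in> carrier (grp A B)" "z \<in> two_cells A B a"
    using f by (simp_all add: e hom_Ar_iff)
  interpret graded_groups I grp "multT" "prT1" "prT2"
    by (rule graded_groups_bimndT[OF I])
  note t = bimnd_2cells_typing[OF h(3)] bimnd_1cells_typing[OF bimnd_2cells_ends(1)[OF h(3)]]
  have i: "fst (fst (snd (bimnd_id1 K (unit_part K F)))) = id1 K (base (fst F))" for F :: "('o, 'm, 'c) bimndT"
    by (simp add: bimnd_id1_def unit_part_eq part_at_simps)
  show "tcomp1 (BimndT K j I) A B B (idn (homT B B) (\<one>\<^bsub>grp B B\<^esub>, bimnd_id1 K (unit_part K B))) f = f"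
    "tcomp1 (BimndT K j I) A A B f (idn (homT A A) (\<one>\<^bsub>grp A A\<^esub>, bimnd_id1 K (unit_part K A))) = f"
    using bimndT_comp1_id1[OF F h(1,2) bimnd_2cells_ends(1)[OF h(3)]] bimndT_comp1_id1[OF F h(1,2) bimnd_2cells_ends(2)[OF h(3)]]
      m_unit_left[OF \<open>A \<in> I\<close> \<open>B \<in> I\<close> h(2)] m_unit_right[OF \<open>A \<in> I\<close> \<open>B \<in> I\<close> h(2)]
    by (simp_all add: e hom_simps tcomp1_BimndT bimnd_id2_def i hcomp_id2_id1 t part_at_simps)
next
  fix A B C w x y assume "A \<in> I" "B \<in> I" "C \<in> I" and w: "w \<in> carrier (grp A C)"
    and xy: "x \<in> Ob (homT A B)" "y \<in> Ob (homT B C)"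
  then have F: "A \<in> T" "B \<in> T" "C \<in> T" using I by auto
  obtain a x' b y' where e: "x = (a, x')" "y = (b, y')" by (cases x, cases y)
  have h: "GF A \<cong> GF B" "GF B \<cong> GF C" "a \<in> carrier (grp A B)" "b \<in> carrier (grp B C)"
    "x' \<in> one_cells A B a" "y' \<in> one_cells B C b"
    using xy by (simp_all add: e hom_Ob_iff)
  have p: "prT1 A B C w \<in> carrier (grp B C)" "prT2 A B C w \<in> carrier (grp A B)"
    using graded_groups.p1_hom[OF graded_groups_bimndT[OF I] \<open>A \<in> I\<close> \<open>B \<in> I\<close> \<open>C \<in> I\<close>]
      graded_groups.p2_hom[OF graded_groups_bimndT[OF I] \<open>A \<in> I\<close> \<open>B \<in> I\<close> \<open>C \<in> I\<close>] w
    by (auto simp: hom_def)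
  show "fst (actT A C w) (tcomp0 (BimndT K j I) A B C y x)
      = tcomp0 (BimndT K j I) A B C (fst (actT B C (prT1 A B C w)) y)
          (fst (actT A B (prT2 A B C w)) x)"
    unfolding e act_apply(1)[OF F(2,3) h(2) p(1) h(4,6)] act_apply(1)[OF F(1,2) h(1) p(2) h(3,5)] tcomp0_BimndT
      act_apply(1)[OF F(1,3) isos(1)[OF F h(1,2)] w mult_closed[OF F h(3,4)] comp1_closed[OF F h(1,2,4,3,6,5)]]
      act_comp1(1)[OF F h(1,2,4,3) w] act_comp1(2)[OF F h(1,2,4,3) w h(6,5)]
    by (rule refl)
next
  fix A B C w f g assume "A \<in> I" "B \<in> I" "C \<in> I" and w: "w \<in> carrier (grp A C)"
    and fg: "f \<in> Ar (homT A B)" "g \<in> Ar (homT B C)"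
  then have F: "A \<in> T" "B \<in> T" "C \<in> T" using I by auto
  obtain a x b y where e: "f = (a, x)" "g = (b, y)" by (cases f, cases g)
  have h: "GF A \<cong> GF B" "GF B \<cong> GF C" "a \<in> carrier (grp A B)" "b \<in> carrier (grp B C)"
    "x \<in> two_cells A B a" "y \<in> two_cells B C b"
    using fg by (simp_all add: e hom_Ar_iff)
  have p: "prT1 A B C w \<in> carrier (grp B C)" "prT2 A B C w \<in> carrier (grp A B)"
    using graded_groups.p1_hom[OF graded_groups_bimndT[OF I] \<open>A \<in> I\<close> \<open>B \<in> I\<close> \<open>C \<in> I\<close>]
      graded_groups.p2_hom[OF graded_groups_bimndT[OF I] \<open>A \<in> I\<close> \<open>B \<in> I\<close> \<open>C \<in> I\<close>] w
    by (auto simp: hom_def)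
  \<comment> \<open>The composite 2-cell. It has to be recognised as a 2-cell of the product degree
    before the action can be evaluated on it.\<close>
  define z where "z = (comp1T A B C b a (fst y) (fst x), fst (snd y) \<star> fst (snd x),
     comp1T A B C b a (snd (snd y)) (snd (snd x)))"
  have "z = snd (compT A B C b a) (y, x)"
    by (simp add: z_def bimndT_comp_def split_beta)
  also have "\<dots> \<in> two_cells A C (multT A B C b a)"
    unfolding comp2_eq_twist2[OF F h(1,2,4,3,6,5)]
    by (rule bimnd_hcomp_closed[OF comp_data[OF F h(1,2,4,3)] comp_twists(3,4)[OF F h(1,2,4,3)]]) (fact h)+
  finally have z: "z \<in> two_cells A C (multT A B C b a)" .
  note ends = bimnd_2cells_ends[OF h(5)] bimnd_2cells_ends[OF h(6)]
  show "snd (actT A C w) (tcomp1 (BimndT K j I) A B C g f)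
      = tcomp1 (BimndT K j I) A B C (snd (actT B C (prT1 A B C w)) g)
          (snd (actT A B (prT2 A B C w)) f)"
    unfolding e act_apply(2)[OF F(2,3) h(2) p(1) h(4,6)] act_apply(2)[OF F(1,2) h(1) p(2) h(3,5)] tcomp1_BimndT
      z_def[symmetric] act_apply(2)[OF F(1,3) isos(1)[OF F h(1,2)] w mult_closed[OF F h(3,4)] z]
      act_comp1(1)[OF F h(1,2,4,3) w]
    unfolding z_def twist2_def fst_conv snd_conv
      act_comp1(2)[OF F h(1,2,4,3) w ends(3,1)] act_comp1(2)[OF F h(1,2,4,3) w ends(4,2)]
    by (rule refl)
qed

section \<open>The components of unit degree and the underlying 2-category\<close>

lemma comp1_one:
  assumes F: "F \<in> T" "F' \<in> T" "F'' \<in> T" and iso: "GF F \<cong> GF F'" "GF F' \<cong> GF F''"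
    and x: "x \<in> one_cells F' F'' \<one>\<^bsub>grp F' F''\<^esub>" and y: "y \<in> one_cells F F' \<one>\<^bsub>grp F F'\<^esub>"
  shows "comp1T F F' F'' \<one>\<^bsub>grp F' F''\<^esub> \<one>\<^bsub>grp F F'\<^esub> x y = bimnd_comp1 K x y"
proof -
  note w = iso F word_simps
  \<comment> \<open>In unit degrees the inner ends already match, so both corrections are trivial
    and ordinary composition remains.\<close>
  have "comp_psi1 F' F'' \<one>\<^bsub>grp F F'\<^esub> = \<one>\<^bsub>GF F''\<^esub>" "comp_psi2 F' \<one>\<^bsub>grp F' F''\<^esub> \<one>\<^bsub>grp F F'\<^esub> = \<one>\<^bsub>GF F'\<^esub>"
    by (simp_all add: comp_psi1_def comp_psi2_def grp_one w)
  then show ?thesis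
    using comp1_eq_twist[OF F iso grp_one_closed[OF F(2,3)] grp_one_closed[OF F(1,2)] x y]
      twist_one[OF F(2,3) iso(2) grp_one_closed[OF F(2,3)] x] twist_one[OF F(1,2) iso(1) grp_one_closed[OF F(1,2)] y]
    by simp
qed

text \<open>\<open>lambda_eq\<close> recovers the family on the carrier from \<lambda>_e, and
  extensionality fixes it elsewhere.\<close>

lemma unit_part_inj: "inj_on (unit_part K) T"
proof (rule inj_onI)
  fix F F' assume F: "F \<in> T" "F' \<in> T" and e: "unit_part K F = unit_part K F'"
  then have g: "GF F = GF F'" by (simp add: autT_def)
  from e have f: "fst F = fst F'" "snd F \<one>\<^bsub>GF F\<^esub> = snd F' \<one>\<^bsub>GF F'\<^esub>"
    by (simp_all add: unit_part_eq part_at_def)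
  have x: "snd F \<in> extensional (carrier (GF F))" "snd F' \<in> extensional (carrier (GF F))"
    using F unfolding bimndT_cells0_def Let_def g[symmetric] by (auto simp: g)
  have "snd F = snd F'"
    by (rule extensionalityI[OF x]) (simp add: lambda_eq[OF F(1)] lambda_eq[OF F(2)] f(1) f(2)[unfolded g] g)
  then show "F = F'" using f(1) by (simp add: prod_eq_iff)
qed

text \<open>\<open>Bimnd K\<close> may contain 1-cells between bimonads with non-isomorphic groups,
  where the Turaev hom-category is empty, so in general the comparison is with the sub-2-category
  cut out by isomorphy. R is kept abstract to include the constantly true relation, which describes
  the same thing when all groups are isomorphic.\<close>

lemma turaev_extension_BimndT:
  assumes I: "I \<subseteq> T" and R: "\<And>F F'. F \<in> I \<Longrightarrow> F' \<in> I \<Longrightarrow> R (unit_part K F) (unit_part K F') \<longleftrightarrow> GF F \<cong> GF F'"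
  shows "turaev_extension (BimndT K j I) (autT K) part_at (sub_two_cat (Bimnd K) (unit_part K ` I) R)"
proof -
  let ?E = "sub_two_cat (Bimnd K) (unit_part K ` I) R"
  interpret B: two_category "Bimnd K" by (rule two_category_Bimnd)
  have J: "unit_part K ` I \<subseteq> Collect (is_bimonad K)"
    using I is_bimonad_unit_part by blast
  have "two_category ?E"
  proof (rule B.two_category_sub_two_cat)
    show "unit_part K ` I \<subseteq> cells0 (Bimnd K)" using J by (simp add: Bimnd_def)
    show "R P P" if "P \<in> unit_part K ` I" for P
      using that R by (auto simp: iso_refl)
    show "R P P''" if "P \<in> unit_part K ` I" "P' \<in> unit_part K ` I" "P'' \<in> unit_part K ` I" "R P P'" "R P' P''" for P P' P''
      using that R iso_trans by (auto simp: image_iff) blast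
  qed
  moreover have "inj_on (\<lambda>F. part_at F \<one>\<^bsub>GF F\<^esub>) I"
    using inj_on_subset[OF unit_part_inj I] by (simp add: unit_part_eq[symmetric])
  moreover have "same_cat (hom_cat ?E (unit_part K F) (unit_part K F')) (partT F F' \<one>\<^bsub>grp F F'\<^esub>)"
    if "F \<in> I" "F' \<in> I" for F F'
  proof -
    have "hom_cat ?E (unit_part K F) (unit_part K F') = partT F F' \<one>\<^bsub>grp F F'\<^esub>"
      by (simp add: hom_cat_sub_Bimnd[OF imageI[OF that(1)] imageI[OF that(2)] J] R[OF that] bimndT_part_def grp_one
          unit_part_eq[symmetric])
    then show ?thesis by (simp add: same_cat_def)
  qed
  moreover have "comp1 ?E Y X = fst (compT F F' F'' \<one>\<^bsub>grp F' F''\<^esub> \<one>\<^bsub>grp F F'\<^esub>) (Y, X)"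
    if FI: "F \<in> I" "F' \<in> I" "F'' \<in> I" and X: "X \<in> Ob (partT F F' \<one>\<^bsub>grp F F'\<^esub>)"
      and Y: "Y \<in> Ob (partT F' F'' \<one>\<^bsub>grp F' F''\<^esub>)" for F F' F'' X Y
    using comp1_one[OF FI[THEN subsetD[OF I]], of Y X] X Y by (auto simp: part_Ob_iff sub_two_cat_simps Bimnd_def bimndT_comp_def)
  moreover have "hcomp ?E g f = snd (compT F F' F'' \<one>\<^bsub>grp F' F''\<^esub> \<one>\<^bsub>grp F F'\<^esub>) (g, f)"
    if FI: "F \<in> I" "F' \<in> I" "F'' \<in> I" and f: "f \<in> Ar (partT F F' \<one>\<^bsub>grp F F'\<^esub>)"
      and g: "g \<in> Ar (partT F' F'' \<one>\<^bsub>grp F' F''\<^esub>)" for F F' F'' f g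
  proof -
    have h: "GF F \<cong> GF F'" "GF F' \<cong> GF F''" "f \<in> two_cells F F' \<one>\<^bsub>grp F F'\<^esub>" "g \<in> two_cells F' F'' \<one>\<^bsub>grp F' F''\<^esub>"
      using f g by (simp_all add: part_Ar_iff)
    have F: "F \<in> T" "F' \<in> T" "F'' \<in> T" using FI I by auto
    show ?thesis
      using comp1_one[OF F h(1,2) bimnd_2cells_ends(1)[OF h(4)] bimnd_2cells_ends(1)[OF h(3)]]
        comp1_one[OF F h(1,2) bimnd_2cells_ends(2)[OF h(4)] bimnd_2cells_ends(2)[OF h(3)]]
      by (simp add: sub_two_cat_simps Bimnd_def bimndT_comp_def split_beta)
  qed
  ultimately show ?thesis
    unfolding turaev_extension_def Let_def BimndT_simps unit_part_eq[symmetric]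
    by (simp add: sub_two_cat_simps Bimnd_def)
qed

end

theorem mainTheorem1:
  fixes K :: "('o, 'm, 'c) two_cat"
    and j :: "('o, 'm, 'c) bimnd \<Rightarrow> ('o, 'm, 'c) bimnd \<Rightarrow> 'c \<Rightarrow> 'c"
  assumes "two_category K"
    and "fusion_maps K j"
  shows "graded_groups (bimndT_cells0 K) (bimndT_grp K j) (bimndT_mult K j) (bimndT_pr1 K j) (bimndT_pr2 K j)
    \<and> turaev_homs (BimndT K j (bimndT_cells0 K))
    \<and> turaev_extension (BimndT K j (bimndT_cells0 K)) (autT K) part_at
        (sub_two_cat (Bimnd K) (cells0 (Bimnd K)) (\<lambda>P P'. Aut0 K P \<cong> Aut0 K P'))
    \<and> (\<forall>I \<subseteq> bimndT_cells0 K. (\<forall>F\<in>I. \<forall>F'\<in>I. autT K F \<cong> autT K F') \<longrightarrow>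
         turaev_2category (BimndT K j I)
         \<and> turaev_extension (BimndT K j I) (autT K) part_at
             (sub_two_cat (Bimnd K) (unit_part K ` I) (\<lambda>_ _. True)))"
proof -
  interpret two_category K by fact
  interpret fused_two_category K j by unfold_locales fact
  \<comment> \<open>Every bimonad extends to a 0-cell with a family \<lambda>_\<alpha>, so over all
    0-cells no bimonad is missing from the underlying 2-category.\<close>
  have "cells0 (Bimnd K) = unit_part K ` T"
  proof (intro equalityI subsetI)
    fix P assume "P \<in> cells0 (Bimnd K)"
    then have "is_bimonad K P" by (simp add: Bimnd_def)
    then show "P \<in> unit_part K ` T" using bimonad_is_unit_part by blast
  next
    fix P assume "P \<in> unit_part K ` T"
    then show "P \<in> cells0 (Bimnd K)" using is_bimonad_unit_part by (auto simp only: Bimnd_def two_cat.simps mem_Collect_eq)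
  qed
  then have "turaev_extension (BimndT K j T) (autT K) part_at
      (sub_two_cat (Bimnd K) (cells0 (Bimnd K)) (\<lambda>P P'. Aut0 K P \<cong> Aut0 K P'))"
    using turaev_extension_BimndT[of T "\<lambda>P P'. Aut0 K P \<cong> Aut0 K P'"] by (simp add: autT_def)
  moreover have "turaev_2category (BimndT K j I)
      \<and> turaev_extension (BimndT K j I) (autT K) part_at (sub_two_cat (Bimnd K) (unit_part K ` I) (\<lambda>_ _. True))"
    if "I \<subseteq> T" "\<forall>F\<in>I. \<forall>F'\<in>I. autT K F \<cong> autT K F'" for I
    using that transitive_system_bimndT[of I] turaev_homs_BimndT[of I] turaev_extension_BimndT[of I "\<lambda>_ _. True"]
    by (simp add: turaev_2category_def BimndT_simps)
  ultimately show ?thesis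
    using graded_groups_bimndT[of T] turaev_homs_BimndT[of T] by simp
qed

end
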